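(* Let $(\mathcal{M}^2,g)$ be a smooth two-manifold, let $\Omega\subset\mathcal{M}^2$ be a smooth open domain, and let $\omega$ be an admissible weight with associated function $\kappa$. Suppose that for some $0<\tau\leq 2$ one has $$-\frac{\lambda_1}{8}(2-\tau)\leq \kappa \leq \lambda_1\qquad\text{on }\Omega .$$ Then every $f\in C_c^{\infty}(\Omega)$ satisfies $$\int_{\Omega} \omega^2 |\nabla f|^2\, d\mathrm{vol}_g \leq \tau^{-1}\int_{\Omega}\left(2\frac{\omega^4}{|\nabla \omega|^2}|\Delta_g f|^2+5|\nabla \omega|^2 |f|^2\right) d\mathrm{vol}_g .$$
   Context: $(\mathcal{M}^2,g)$ is a smooth connected Riemannian manifold of dimension two, possibly with boundary; $\Omega\subset\mathcal M^2$ is a smooth connected open domain. $\nabla$ is the gradient with respect to $g$, and $\Delta_g$ is the Laplace--Beltrami operator with the sign convention $\int_\Omega -\Delta_g u\, v\, d\mathrm{vol}_g=\int_\Omega\langle\nabla u,\nabla v\rangle\, d\mathrm{vol}_g$ for all $v\in W^{1,2}_0(\Omega)$. Eigenvalue: $\lambda_1$ denotes the first Dirichlet eigenvalue of the Laplace--Beltrami operator on $\Omega$ (that of $-\Delta_g$, so $\lambda_1\int_\Omega |u|^2\,d\mathrm{vol}_g\le \int_\Omega|\nabla u|^2\,d\mathrm{vol}_g$ for $u\in W^{1,2}_0(\Omega)$). Convention: if the domain is unbounded (for example when $\mathcal M^2=\mathbb{R}^2$), one sets $\lambda_1=0$. Admissible weight: $\omega\in W^{1,2}(\mathcal M^2)$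 is a positive weight (i.e. $\omega\ge 0$ and $\omega>0$ almost everywhere; it may vanish, e.g. at finitely many points), and there is a real-valued function $\kappa=\kappa(x)$ such that the weak form of $\omega^2\Delta_g\log\omega=-\kappa\,\omega^2$ holds, namely for every $\phi\in C_c^\infty(\Omega)$, $$\int_{\Omega}\left[(4|\nabla\omega|^2-2\kappa\,\omega^2)\,\phi-\omega^2\Delta_g\phi\right]d\mathrm{vol}_g=0 .$$ The function $\kappa$ is measurable with $\kappa\omega^2$ locally integrable, so that this makes sense. The right-hand side integral takes values in $[0,+\infty]$: at points where $\nabla\omega=0$, the quotient $\frac{\omega^4}{|\nabla\omega|^2}|\Delta_g f|^2$ is read as $0$ if its numerator vanishes and $+\infty$ otherwise; the inequality is trivial if the right-hand side is infinite. *)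

theory Defs
  imports "HOL-Analysis.Analysis"
begin

section \<open>Smooth functions of two real variables\<close>

text \<open>For open \<open>S\<close> this is \<open>C\<^sup>k\<close>-regularity, stated through iterated partial derivatives.\<close>

primrec Ck_on :: "nat \<Rightarrow> (real^2) set \<Rightarrow> (real^2 \<Rightarrow> 'b::real_normed_vector) \<Rightarrow> bool" where
  "Ck_on 0 S f \<longleftrightarrow> continuous_on S f"
| "Ck_on (Suc k) S f \<longleftrightarrow>
     f differentiable_on S \<and> (\<forall>i. Ck_on k S (\<lambda>p. frechet_derivative f (at p) (axis i 1)))"

text \<open>On a set that need not be open (a relatively open part of the half plane), smoothness means
  the local existence of smooth extensions to open subsets of the plane.\<close>

definition smooth_on :: "(real^2) set \<Rightarrow> (real^2 \<Rightarrow> 'b::real_normed_vector) \<Rightarrow> bool" where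
  "smooth_on S f \<longleftrightarrow>
     (\<forall>p\<in>S. \<exists>W F. open W \<and> p \<in> W \<and> (\<forall>k. Ck_on k W F) \<and> (\<forall>q\<in>W \<inter> S. F q = f q))"

definition partial_within :: "(real^2) set \<Rightarrow> 2 \<Rightarrow> (real^2 \<Rightarrow> real) \<Rightarrow> real^2 \<Rightarrow> real" where
  "partial_within S i f p = frechet_derivative f (at p within S) (axis i 1)"

section \<open>Smooth surfaces with boundary\<close>

text \<open>A surface is carried by a whole type. A chart is a pair of an open set and a coordinate map
  onto a relatively open subset of the closed half plane; charts whose image avoids the edge of the
  half plane are ordinary interior charts. The values of the coordinate map off the chart domain
  are irrelevant.\<close>

type_synonym 'a chart = "'a set \<times> ('a \<Rightarrow> real^2)"

definition half_plane :: "(real^2) set" where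
  "half_plane = {p. 0 \<le> p $ 1}"

abbreviation chart_dom :: "'a chart \<Rightarrow> 'a set" where
  "chart_dom c \<equiv> fst c"

abbreviation chart_map :: "'a chart \<Rightarrow> 'a \<Rightarrow> real^2" where
  "chart_map c \<equiv> snd c"

abbreviation chart_cod :: "'a chart \<Rightarrow> (real^2) set" where
  "chart_cod c \<equiv> chart_map c ` chart_dom c"

abbreviation chart_inv :: "'a chart \<Rightarrow> real^2 \<Rightarrow> 'a" where
  "chart_inv c \<equiv> inv_into (chart_dom c) (chart_map c)"

definition is_chart :: "'a::topological_space chart \<Rightarrow> bool" where
  "is_chart c \<longleftrightarrow> open (chart_dom c)
     \<and> openin (top_of_set half_plane) (chart_cod c)
     \<and> homeomorphism (chart_dom c) (chart_cod c) (chart_map c) (chart_inv c)"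

definition transition :: "'a chart \<Rightarrow> 'a chart \<Rightarrow> real^2 \<Rightarrow> real^2" where
  "transition c c' = chart_map c' \<circ> chart_inv c"

definition smooth_atlas :: "'a::topological_space chart set \<Rightarrow> bool" where
  "smooth_atlas A \<longleftrightarrow> (\<forall>c\<in>A. is_chart c) \<and> (\<Union>c\<in>A. chart_dom c) = UNIV
     \<and> (\<forall>c\<in>A. \<forall>c'\<in>A. smooth_on (chart_map c ` (chart_dom c \<inter> chart_dom c')) (transition c c'))"

definition jacobian :: "'a chart \<Rightarrow> 'a chart \<Rightarrow> 'a \<Rightarrow> real^2^2" where
  "jacobian c c' x = matrix (frechet_derivative (transition c c')
     (at (chart_map c x) within chart_map c ` (chart_dom c \<inter> chart_dom c')))"

definition manifold_interior :: "'a chart set \<Rightarrow> 'a set" where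
  "manifold_interior A = {x. \<exists>c\<in>A. x \<in> chart_dom c \<and> 0 < chart_map c x $ 1}"

definition smooth_fun_on :: "'a chart set \<Rightarrow> 'a set \<Rightarrow> ('a \<Rightarrow> real) \<Rightarrow> bool" where
  "smooth_fun_on A W f \<longleftrightarrow>
     (\<forall>c\<in>A. smooth_on (chart_map c ` (chart_dom c \<inter> W)) (f \<circ> chart_inv c))"

text \<open>Some chart around a point; it is only used to evaluate expressions that do not depend on
  the chart.\<close>

definition chart_at :: "'a chart set \<Rightarrow> 'a \<Rightarrow> 'a chart" where
  "chart_at A x = (SOME c. c \<in> A \<and> x \<in> chart_dom c)"

text \<open>The space of smooth functions with compact support in \<open>\<Omega>\<close>, extended by zero. As usual for
  Dirichlet problems, the supports stay away from the boundary of the surface, even if the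
  (relatively) open set \<open>\<Omega>\<close> contains boundary points.\<close>

definition test_function ::
  "'a::topological_space chart set \<Rightarrow> 'a set \<Rightarrow> ('a \<Rightarrow> real) \<Rightarrow> bool" where
  "test_function A \<Omega> f \<longleftrightarrow> smooth_fun_on A UNIV f
     \<and> compact (closure {x. f x \<noteq> 0}) \<and> closure {x. f x \<noteq> 0} \<subseteq> \<Omega> \<inter> manifold_interior A"

section \<open>Riemannian metrics and differential operators\<close>

text \<open>Tensor fields are families of component fields, one for each chart, related by the classical
  transformation laws: \<open>g c x\<close> is the matrix of the metric at \<open>x\<close>, and \<open>X c x\<close> is the coordinate
  vector of a tangent vector at \<open>x\<close>, with respect to the chart \<open>c\<close>.\<close>

type_synonym 'a metric = "'a chart \<Rightarrow> 'a \<Rightarrow> real^2^2"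
type_synonym 'a vfield = "'a chart \<Rightarrow> 'a \<Rightarrow> real^2"

definition riemannian_metric :: "'a chart set \<Rightarrow> 'a metric \<Rightarrow> bool" where
  "riemannian_metric A g \<longleftrightarrow>
     (\<forall>c\<in>A. smooth_on (chart_cod c) (\<lambda>p. g c (chart_inv c p)))
   \<and> (\<forall>c\<in>A. \<forall>x\<in>chart_dom c. transpose (g c x) = g c x \<and> (\<forall>v. v \<noteq> 0 \<longrightarrow> 0 < v \<bullet> (g c x *v v)))
   \<and> (\<forall>c\<in>A. \<forall>c'\<in>A. \<forall>x\<in>chart_dom c \<inter> chart_dom c'.
        g c x = transpose (jacobian c c' x) ** g c' x ** jacobian c c' x)"

definition riemannian_surface ::
  "'a::{second_countable_topology,t2_space} chart set \<Rightarrow> 'a metric \<Rightarrow> bool" where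
  "riemannian_surface A g \<longleftrightarrow> smooth_atlas A \<and> riemannian_metric A g \<and> connected (UNIV :: 'a set)"

definition vector_field_on :: "'a chart set \<Rightarrow> 'a set \<Rightarrow> 'a vfield \<Rightarrow> bool" where
  "vector_field_on A \<Omega> X \<longleftrightarrow> (\<forall>c\<in>A. \<forall>c'\<in>A. \<forall>x\<in>chart_dom c \<inter> chart_dom c' \<inter> \<Omega>.
     X c' x = jacobian c c' x *v X c x)"

definition metric_inner :: "'a chart set \<Rightarrow> 'a metric \<Rightarrow> 'a vfield \<Rightarrow> 'a vfield \<Rightarrow> 'a \<Rightarrow> real" where
  "metric_inner A g X Y x = (let c = chart_at A x in X c x \<bullet> (g c x *v Y c x))"

definition differential :: "('a \<Rightarrow> real) \<Rightarrow> 'a chart \<Rightarrow> 'a \<Rightarrow> real^2" where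
  "differential f c x = (\<chi> i. partial_within (chart_cod c) i (f \<circ> chart_inv c) (chart_map c x))"

definition gradient :: "'a metric \<Rightarrow> ('a \<Rightarrow> real) \<Rightarrow> 'a vfield" where
  "gradient g f c x = matrix_inv (g c x) *v differential f c x"

definition divergence :: "'a chart set \<Rightarrow> 'a metric \<Rightarrow> 'a vfield \<Rightarrow> 'a \<Rightarrow> real" where
  "divergence A g X x = (let c = chart_at A x in
     (\<Sum>i\<in>UNIV. partial_within (chart_cod c) i
        (\<lambda>p. sqrt (det (g c (chart_inv c p))) * X c (chart_inv c p) $ i) (chart_map c x))
     / sqrt (det (g c x)))"

definition laplace_beltrami :: "'a chart set \<Rightarrow> 'a metric \<Rightarrow> ('a \<Rightarrow> real) \<Rightarrow> 'a \<Rightarrow> real" where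
  "laplace_beltrami A g f = divergence A g (gradient g f)"

text \<open>This determines the Riemannian measure uniquely, since countably many charts cover the
  surface.\<close>

definition riemannian_volume ::
  "'a::topological_space chart set \<Rightarrow> 'a metric \<Rightarrow> 'a measure \<Rightarrow> bool" where
  "riemannian_volume A g vol \<longleftrightarrow> sets vol = sets borel
     \<and> (\<forall>c\<in>A. \<forall>E\<in>sets borel. E \<subseteq> chart_dom c \<longrightarrow>
          emeasure vol E =
            (\<integral>\<^sup>+p\<in>chart_map c ` E. ennreal (sqrt (det (g c (chart_inv c p)))) \<partial>lborel))"

section \<open>Riemannian distance and domains\<close>

definition piecewise_C1_curve ::
  "'a::topological_space chart set \<Rightarrow> (real \<Rightarrow> 'a) \<Rightarrow> bool" where
  "piecewise_C1_curve A \<gamma> \<longleftrightarrow> continuous_on {0..1} \<gamma>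
     \<and> (\<exists>S. finite S \<and> (\<forall>c\<in>A.
          (chart_map c \<circ> \<gamma>) C1_differentiable_on {t \<in> {0..1} - S. \<gamma> t \<in> chart_dom c}))"

definition curve_length :: "'a chart set \<Rightarrow> 'a metric \<Rightarrow> (real \<Rightarrow> 'a) \<Rightarrow> ennreal" where
  "curve_length A g \<gamma> = (\<integral>\<^sup>+t\<in>{0..1}.
     (let c = chart_at A (\<gamma> t); v = vector_derivative (chart_map c \<circ> \<gamma>) (at t)
      in ennreal (sqrt (v \<bullet> (g c (\<gamma> t) *v v)))) \<partial>lborel)"

definition riemannian_dist ::
  "'a::topological_space chart set \<Rightarrow> 'a metric \<Rightarrow> 'a \<Rightarrow> 'a \<Rightarrow> ennreal" where
  "riemannian_dist A g x y =
     (INF \<gamma>\<in>{\<gamma>. piecewise_C1_curve A \<gamma> \<and> \<gamma> 0 = x \<and> \<gamma> 1 = y}. curve_length A g \<gamma>)"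

definition riemannian_bounded ::
  "'a::topological_space chart set \<Rightarrow> 'a metric \<Rightarrow> 'a set \<Rightarrow> bool" where
  "riemannian_bounded A g \<Omega> \<longleftrightarrow>
     (\<exists>B::real. \<forall>x\<in>\<Omega>. \<forall>y\<in>\<Omega>. riemannian_dist A g x y \<le> ennreal B)"

text \<open>Near each of its frontier points in the interior of the surface, a smooth domain is a strict
  sublevel set of a smooth function with nonvanishing differential. No condition is imposed at
  points where the frontier meets the boundary of the surface.\<close>

definition smooth_domain :: "'a::topological_space chart set \<Rightarrow> 'a set \<Rightarrow> bool" where
  "smooth_domain A \<Omega> \<longleftrightarrow> open \<Omega> \<and> connected \<Omega>
     \<and> (\<forall>x\<in>frontier \<Omega> \<inter> manifold_interior A. \<exists>W \<rho>. open W \<and> x \<in> W \<and> smooth_fun_on A W \<rho>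
          \<and> \<Omega> \<inter> W = {y\<in>W. \<rho> y < 0} \<and> \<rho> x = 0 \<and> differential \<rho> (chart_at A x) x \<noteq> 0)"

section \<open>Sobolev spaces\<close>

text \<open>\<open>X\<close> is the weak gradient of \<open>u\<close> on \<open>\<Omega>\<close>: in each chart, the covector components \<open>g X\<close> are the
  distributional partial derivatives of \<open>u\<close>. For square integrable \<open>u\<close> and \<open>X\<close> all integrands below
  are integrable.\<close>

definition weak_gradient ::
  "'a::topological_space chart set \<Rightarrow> 'a metric \<Rightarrow> 'a set \<Rightarrow> ('a \<Rightarrow> real) \<Rightarrow> 'a vfield \<Rightarrow> bool" where
  "weak_gradient A g \<Omega> u X \<longleftrightarrow> vector_field_on A \<Omega> X
     \<and> (\<forall>c\<in>A. set_borel_measurable borel (chart_dom c \<inter> \<Omega>) (X c))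
     \<and> (\<forall>c\<in>A. \<forall>i. \<forall>\<psi>::real^2 \<Rightarrow> real.
          let V = chart_map c ` (chart_dom c \<inter> \<Omega> \<inter> manifold_interior A) in
          smooth_on UNIV \<psi> \<and> compact (closure {p. \<psi> p \<noteq> 0}) \<and> closure {p. \<psi> p \<noteq> 0} \<subseteq> V \<longrightarrow>
            (LINT p:V|lborel. u (chart_inv c p) * partial_within UNIV i \<psi> p)
          = - (LINT p:V|lborel. (g c (chart_inv c p) *v X c (chart_inv c p)) $ i * \<psi> p))"

definition L2_on :: "'a::topological_space measure \<Rightarrow> 'a set \<Rightarrow> ('a \<Rightarrow> real) \<Rightarrow> bool" where
  "L2_on vol \<Omega> u \<longleftrightarrow> set_borel_measurable borel \<Omega> u \<and> set_integrable vol \<Omega> (\<lambda>x. (u x)\<^sup>2)"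

text \<open>\<open>u \<in> W\<^sup>1\<^sup>,\<^sup>2(\<Omega>)\<close> with weak gradient \<open>X\<close>.\<close>

definition W12 ::
  "'a::topological_space chart set \<Rightarrow> 'a metric \<Rightarrow> 'a measure \<Rightarrow> 'a set \<Rightarrow> ('a \<Rightarrow> real) \<Rightarrow> 'a vfield \<Rightarrow> bool"
  where
  "W12 A g vol \<Omega> u X \<longleftrightarrow> L2_on vol \<Omega> u \<and> weak_gradient A g \<Omega> u X
     \<and> set_integrable vol \<Omega> (metric_inner A g X X)"

text \<open>The closure of the test functions in \<open>W\<^sup>1\<^sup>,\<^sup>2(\<Omega>)\<close>.\<close>

definition W12_zero ::
  "'a::topological_space chart set \<Rightarrow> 'a metric \<Rightarrow> 'a measure \<Rightarrow> 'a set \<Rightarrow> ('a \<Rightarrow> real) \<Rightarrow> 'a vfield \<Rightarrow> bool"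
  where
  "W12_zero A g vol \<Omega> u X \<longleftrightarrow> W12 A g vol \<Omega> u X
     \<and> (\<exists>\<psi>. (\<forall>n. test_function A \<Omega> (\<psi> n))
          \<and> (\<lambda>n. LINT x:\<Omega>|vol. (u x - \<psi> n x)\<^sup>2) \<longlonglongrightarrow> 0
          \<and> (\<lambda>n. LINT x:\<Omega>|vol. (let Y = (\<lambda>c y. X c y - gradient g (\<psi> n) c y)
                               in metric_inner A g Y Y x)) \<longlonglongrightarrow> 0)"

section \<open>The first Dirichlet eigenvalue\<close>

text \<open>\<open>u\<close>, with weak gradient \<open>X\<close>, is a weak solution of \<open>- \<Delta> u - \<mu> u = h\<close> with Dirichlet boundary
  condition.\<close>

definition dirichlet_solution ::
  "'a::topological_space chart set \<Rightarrow> 'a metric \<Rightarrow> 'a measure \<Rightarrow> 'a set \<Rightarrow> real \<Rightarrow> ('a \<Rightarrow> real)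
     \<Rightarrow> ('a \<Rightarrow> real) \<Rightarrow> 'a vfield \<Rightarrow> bool" where
  "dirichlet_solution A g vol \<Omega> \<mu> h u X \<longleftrightarrow> W12_zero A g vol \<Omega> u X
     \<and> (\<forall>v Y. W12_zero A g vol \<Omega> v Y \<longrightarrow>
          (LINT x:\<Omega>|vol. metric_inner A g X Y x) - \<mu> * (LINT x:\<Omega>|vol. u x * v x)
          = (LINT x:\<Omega>|vol. h x * v x))"

definition dirichlet_eigenvalue ::
  "'a::topological_space chart set \<Rightarrow> 'a metric \<Rightarrow> 'a measure \<Rightarrow> 'a set \<Rightarrow> real \<Rightarrow> bool" where
  "dirichlet_eigenvalue A g vol \<Omega> \<mu> \<longleftrightarrow>
     (\<exists>u X. dirichlet_solution A g vol \<Omega> \<mu> (\<lambda>_. 0) u X \<and> \<not> (AE x in vol. x \<in> \<Omega> \<longrightarrow> u x = 0))"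

text \<open>The spectrum of \<open>- \<Delta>\<close> on \<open>L\<^sup>2(\<Omega>)\<close>: \<open>\<mu>\<close> is in the resolvent set iff \<open>- \<Delta> - \<mu>\<close> has an everywhere
  defined bounded inverse. Uniqueness of solutions is contained in the bound, by linearity.\<close>

definition dirichlet_spectrum ::
  "'a::topological_space chart set \<Rightarrow> 'a metric \<Rightarrow> 'a measure \<Rightarrow> 'a set \<Rightarrow> real set" where
  "dirichlet_spectrum A g vol \<Omega> = {\<mu>. \<not> (\<exists>C. \<forall>h. L2_on vol \<Omega> h \<longrightarrow>
     (\<exists>u X. dirichlet_solution A g vol \<Omega> \<mu> h u X)
   \<and> (\<forall>u X. dirichlet_solution A g vol \<Omega> \<mu> h u X \<longrightarrow>
        (LINT x:\<Omega>|vol. (u x)\<^sup>2) \<le> C * (LINT x:\<Omega>|vol. (h x)\<^sup>2)))}"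

text \<open>An eigenvalue at the bottom of the spectrum. When the spectrum is discrete (for instance if
  \<open>\<Omega>\<close> is relatively compact), it consists of eigenvalues only and this is the smallest one.\<close>

definition first_dirichlet_eigenvalue ::
  "'a::topological_space chart set \<Rightarrow> 'a metric \<Rightarrow> 'a measure \<Rightarrow> 'a set \<Rightarrow> real \<Rightarrow> bool" where
  "first_dirichlet_eigenvalue A g vol \<Omega> \<mu> \<longleftrightarrow> dirichlet_eigenvalue A g vol \<Omega> \<mu>
     \<and> (\<forall>\<nu>\<in>dirichlet_spectrum A g vol \<Omega>. \<mu> \<le> \<nu>)"

text \<open>The convention for unbounded domains overrides the spectral definition.\<close>

definition is_lambda1 ::
  "'a::topological_space chart set \<Rightarrow> 'a metric \<Rightarrow> 'a measure \<Rightarrow> 'a set \<Rightarrow> real \<Rightarrow> bool" where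
  "is_lambda1 A g vol \<Omega> \<mu> \<longleftrightarrow>
     (if riemannian_bounded A g \<Omega> then first_dirichlet_eigenvalue A g vol \<Omega> \<mu> else \<mu> = 0)"

section \<open>Admissible weights\<close>

text \<open>\<open>\<omega> \<in> W\<^sup>1\<^sup>,\<^sup>2\<close> has weak gradient \<open>D\<close> and satisfies \<open>\<omega>\<^sup>2 \<Delta> (log \<omega>) = - \<kappa> \<omega>\<^sup>2\<close> weakly.\<close>

definition admissible_weight ::
  "'a::topological_space chart set \<Rightarrow> 'a metric \<Rightarrow> 'a measure \<Rightarrow> 'a set \<Rightarrow> ('a \<Rightarrow> real) \<Rightarrow> 'a vfield
     \<Rightarrow> ('a \<Rightarrow> real) \<Rightarrow> bool" where
  "admissible_weight A g vol \<Omega> \<omega> D \<kappa> \<longleftrightarrow>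
     W12 A g vol UNIV \<omega> D \<and> (\<forall>x. 0 \<le> \<omega> x) \<and> (AE x in vol. 0 < \<omega> x)
   \<and> set_borel_measurable borel \<Omega> \<kappa>
   \<and> (\<forall>K. compact K \<and> K \<subseteq> \<Omega> \<inter> manifold_interior A \<longrightarrow> set_integrable vol K (\<lambda>x. \<kappa> x * (\<omega> x)\<^sup>2))
   \<and> (\<forall>\<phi>. test_function A \<Omega> \<phi> \<longrightarrow>
        (LINT x:\<Omega>|vol. (4 * metric_inner A g D D x - 2 * \<kappa> x * (\<omega> x)\<^sup>2) * \<phi> x
           - (\<omega> x)\<^sup>2 * laplace_beltrami A g \<phi> x) = 0)"

end

theory Submission
  imports Defs
begin

text \<open>Testing the equation of the weight with \<open>\<phi> = f\<^sup>2\<close> and expanding \<open>\<Delta>(f\<^sup>2) = 2 f \<Delta>f + 2 |\<nabla>f|\<^sup>2\<close> gives the identity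
  \<open>\<integral>\<omega>\<^sup>2|\<nabla>f|\<^sup>2 = 2 \<integral>|\<nabla>\<omega>|\<^sup>2f\<^sup>2 - \<integral>\<kappa>\<omega>\<^sup>2f\<^sup>2 - \<integral>\<omega>\<^sup>2f\<Delta>f\<close>. The last term is absorbed by completing a square,
  \<open>- \<omega>\<^sup>2f\<Delta>f \<le> \<omega>\<^sup>4|\<Delta>f|\<^sup>2/|\<nabla>\<omega>|\<^sup>2 + |\<nabla>\<omega>|\<^sup>2f\<^sup>2/4\<close>. In the term with \<open>\<kappa>\<close> the lower bound on \<open>\<kappa>\<close> leaves
  \<open>\<lambda>\<^sub>1(2 - \<tau>)/8\<close> times the integral of \<open>(\<omega>f)\<^sup>2\<close>. By the Poincare inequality for \<open>\<omega>f\<close> this is at most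
  \<open>(2 - \<tau>)/8\<close> times the integral of \<open>|\<nabla>(\<omega>f)|\<^sup>2 \<le> 2 \<omega>\<^sup>2|\<nabla>f|\<^sup>2 + 2 f\<^sup>2|\<nabla>\<omega>|\<^sup>2\<close>, part of which is absorbed on the
  left. The constants of the theorem remain because \<open>\<tau> \<le> 2\<close> and \<open>\<tau>\<^sup>2 - 6\<tau> + 10 > 0\<close>.

  Three ingredients of this argument carry the weight of the text.

  The Poincare inequality has to be extracted from a definition of \<open>\<lambda>\<^sub>1\<close> by resolvents. If the best
  constant in that inequality were smaller than \<open>\<lambda>\<^sub>1\<close>, the resolvent at this constant would exist, and
  positivity of the energy form would improve the constant (\<open>rayleigh_bound\<close>).

  The inequality is needed for \<open>\<omega>f\<close>, which is not smooth, so \<open>\<omega>f\<close> has to be approximated by test functions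
  in \<open>W\<^sup>1\<^sup>,\<^sup>2\<close> (\<open>weight_times_test_W12_zero\<close>). A partition of unity reduces this to one chart, where
  mollification in the plane applies. Hence the first part of the text: smooth bump functions,
  convolutions, and their convergence in the mean.

  The identity is meaningless unless \<open>\<Delta>f\<close> is measurable, and the Laplacian is evaluated in an arbitrarily
  chosen chart at every point. It is therefore shown not to depend on the chart (\<open>divergence_transform\<close>); the
  reason is the Piola identity for the cofactors of a change of coordinates. Consequently \<open>\<Delta>f\<close> is continuous
  with compact support, and all integrals exist. By invariance of domain the boundary of the surface does
  not interfere, since a boundary point lies on the edge in every chart.\<close>

section \<open>Calculus of smooth functions on the plane\<close>

definition pd :: "2 \<Rightarrow> (real^2 \<Rightarrow> 'b::real_normed_vector) \<Rightarrow> real^2 \<Rightarrow> 'b" where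
  "pd i f p = frechet_derivative f (at p) (axis i 1)"

text \<open>Smoothness without the local extensions of \<open>smooth_on\<close>. Both notions agree on open sets, but this one
  can be proved by induction on the order.\<close>

definition Csmooth :: "(real^2) set \<Rightarrow> (real^2 \<Rightarrow> 'b::real_normed_vector) \<Rightarrow> bool" where
  "Csmooth S f \<longleftrightarrow> (\<forall>k. Ck_on k S f)"

lemma Ck_on_Suc_pd:
  "Ck_on (Suc k) S f \<longleftrightarrow> f differentiable_on S \<and> (\<forall>i. Ck_on k S (pd i f))"
  by (simp add: pd_def[abs_def])

lemma has_derivative_pd:
  assumes "(f has_derivative f') (at p)"
  shows "pd i f p = f' (axis i 1)"
  using frechet_derivative_at[OF assms] by (simp add: pd_def)

lemma has_derivative_cong_open:
  assumes "open S" "p \<in> S" "\<And>x. x \<in> S \<Longrightarrow> f x = g x"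
  shows "(f has_derivative f') (at p) \<longleftrightarrow> (g has_derivative f') (at p)"
  using has_derivative_transform_within_open[OF _ assms(1,2), of f f' UNIV g]
    has_derivative_transform_within_open[OF _ assms(1,2), of g f' UNIV f] assms(3) by auto

lemma pd_cong:
  assumes "open S" "p \<in> S" "\<And>x. x \<in> S \<Longrightarrow> f x = g x"
  shows "pd i f p = pd i g p"
  unfolding pd_def frechet_derivative_def using has_derivative_cong_open[OF assms] by simp

lemma Ck_on_subset: "Ck_on k S f \<Longrightarrow> T \<subseteq> S \<Longrightarrow> Ck_on k T f"
  by (induction k arbitrary: f) (auto intro: continuous_on_subset differentiable_on_subset)

lemma Ck_on_cong:
  assumes "open S" "\<And>x. x \<in> S \<Longrightarrow> f x = g x" "Ck_on k S f"
  shows "Ck_on k S g"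
  using assms(2,3)
proof (induction k arbitrary: f g)
  case 0
  then show ?case using continuous_on_cong[of S S f g] by simp
next
  case (Suc k)
  have 1: "g differentiable_on S"
    using Suc.prems(2) has_derivative_cong_open[OF assms(1), of _ f g] Suc.prems(1)
    by (auto simp: differentiable_on_eq_differentiable_at[OF assms(1)] differentiable_def)
  have "Ck_on k S (pd i g)" for i
  proof (rule Suc.IH)
    show "Ck_on k S (pd i f)" using Suc.prems(2) by (simp add: Ck_on_Suc_pd del: Ck_on.simps)
    show "pd i f x = pd i g x" if "x \<in> S" for x
      by (rule pd_cong[OF assms(1) that]) (rule Suc.prems(1))
  qed
  then show ?case using 1 by (simp add: Ck_on_Suc_pd del: Ck_on.simps)
qed

lemma Ck_on_local:
  assumes "\<And>p. p \<in> S \<Longrightarrow> \<exists>W. open W \<and> p \<in> W \<and> Ck_on k W f"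
  shows "Ck_on k S f"
  using assms
proof (induction k arbitrary: f)
  case 0
  have "continuous (at p within S) f" if p: "p \<in> S" for p
  proof -
    obtain W where W: "open W" "p \<in> W" "continuous_on W f" using 0[OF p] by auto
    have "continuous (at p) f" using W by (simp add: continuous_on_eq_continuous_at)
    then show ?thesis by (rule continuous_at_imp_continuous_at_within)
  qed
  then show ?case by (simp add: continuous_on_eq_continuous_within)
next
  case (Suc k)
  have "f differentiable (at p within S)" if p: "p \<in> S" for p
  proof -
    obtain W where W: "open W" "p \<in> W" "f differentiable_on W"
      using Suc.prems[OF p] by auto
    have "f differentiable (at p)"
      using W by (metis at_within_open differentiable_on_def)
    then show ?thesis by (rule differentiable_at_withinI)
  qed
  moreover have "Ck_on k S (pd i f)" for i
    by (rule Suc.IH) (metis Ck_on_Suc_pd Suc.prems)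
  ultimately show ?case by (simp add: Ck_on_Suc_pd differentiable_on_def del: Ck_on.simps)
qed

lemma Ck_on_lower: "Ck_on (Suc k) S f \<Longrightarrow> Ck_on k S f"
proof (induction k arbitrary: f)
  case 0
  then show ?case using differentiable_imp_continuous_on by auto
next
  case (Suc k)
  then show ?case by (meson Ck_on_Suc_pd)
qed

lemma Ck_on_Suc_differentiable:
  "open S \<Longrightarrow> Ck_on (Suc k) S f \<Longrightarrow> p \<in> S \<Longrightarrow> f differentiable (at p)"
  by (metis Ck_on_Suc_pd at_within_open differentiable_on_def)

lemma Ck_on_SucI:
  assumes "open S" "\<And>p. p \<in> S \<Longrightarrow> f differentiable (at p)"
    "\<And>i p. p \<in> S \<Longrightarrow> pd i f p = d i p" "\<And>i. Ck_on k S (d i)"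
  shows "Ck_on (Suc k) S f"
  unfolding Ck_on_Suc_pd
proof
  show "f differentiable_on S"
    using assms(2) by (simp add: differentiable_on_def differentiable_at_withinI)
  show "\<forall>i. Ck_on k S (pd i f)"
    using Ck_on_cong[OF assms(1) _ assms(4)] assms(3) by simp
qed

lemma pd_const [simp]: "pd i (\<lambda>_. c) p = 0"
  by (simp add: pd_def)

lemma pd_add:
  "f differentiable (at p) \<Longrightarrow> g differentiable (at p) \<Longrightarrow>
   pd i (\<lambda>x. f x + g x) p = pd i f p + pd i g p"
  unfolding frechet_derivative_works
  by (rule has_derivative_pd[THEN trans], rule has_derivative_add) (auto simp: pd_def)

lemma pd_mult:
  fixes f g :: "real^2 \<Rightarrow> real"
  shows "f differentiable (at p) \<Longrightarrow> g differentiable (at p) \<Longrightarrow>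
   pd i (\<lambda>x. f x * g x) p = f p * pd i g p + pd i f p * g p"
  unfolding frechet_derivative_works
  by (rule has_derivative_pd[THEN trans], rule has_derivative_mult) (auto simp: pd_def)

lemma pd_compose_real:
  assumes "f differentiable (at p)" "(\<phi> has_field_derivative d) (at (f p))"
  shows "(\<lambda>x. \<phi> (f x)) differentiable (at p)" "pd i (\<lambda>x. \<phi> (f x)) p = d * pd i f p"
proof -
  have "((\<lambda>x. \<phi> (f x)) has_derivative (\<lambda>v. d * frechet_derivative f (at p) v)) (at p)"
    using diff_chain_at[OF assms(1)[unfolded frechet_derivative_works]
        assms(2)[unfolded has_field_derivative_def]]
    by (simp add: o_def)
  then show "(\<lambda>x. \<phi> (f x)) differentiable (at p)" "pd i (\<lambda>x. \<phi> (f x)) p = d * pd i f p"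
    using has_derivative_pd by (auto simp: differentiable_def pd_def)
qed

lemma pd_bounded_linear:
  assumes "bounded_linear L" "f differentiable (at p)"
  shows "(\<lambda>x. L (f x)) differentiable (at p)" "pd i (\<lambda>x. L (f x)) p = L (pd i f p)"
proof -
  have "((\<lambda>x. L (f x)) has_derivative (\<lambda>v. L (frechet_derivative f (at p) v))) (at p)"
    using assms bounded_linear.has_derivative frechet_derivative_works by blast
  then show "(\<lambda>x. L (f x)) differentiable (at p)" "pd i (\<lambda>x. L (f x)) p = L (pd i f p)"
    using has_derivative_pd by (auto simp: differentiable_def pd_def)
qed

lemma frechet_derivative_pd:
  fixes f :: "real^2 \<Rightarrow> 'b::real_normed_vector"
  assumes "f differentiable (at p)"
  shows "frechet_derivative f (at p) v = v$1 *\<^sub>R pd 1 f p + v$2 *\<^sub>R pd 2 f p"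
proof -
  interpret linear "frechet_derivative f (at p)"
    by (rule linear_frechet_derivative[OF assms])
  have "v = v$1 *\<^sub>R axis 1 1 + v$2 *\<^sub>R axis 2 1"
    by (simp add: vec_eq_iff axis_def forall_2)
  then have "frechet_derivative f (at p) v
      = frechet_derivative f (at p) (v$1 *\<^sub>R axis 1 1 + v$2 *\<^sub>R axis 2 1)"
    by simp
  then show ?thesis by (simp add: add scaleR pd_def)
qed

lemma pd_compose:
  fixes G :: "real^2 \<Rightarrow> 'b::real_normed_vector" and T :: "real^2 \<Rightarrow> real^2"
  assumes "T differentiable (at p)" "G differentiable (at (T p))"
  shows "(\<lambda>x. G (T x)) differentiable (at p)"
    "pd i (\<lambda>x. G (T x)) p = (pd i T p)$1 *\<^sub>R pd 1 G (T p) + (pd i T p)$2 *\<^sub>R pd 2 G (T p)"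
proof -
  have "((\<lambda>x. G (T x)) has_derivative
      (\<lambda>v. frechet_derivative G (at (T p)) (frechet_derivative T (at p) v))) (at p)"
    using diff_chain_at[OF assms[unfolded frechet_derivative_works]] by (simp add: o_def)
  note D = this
  show "(\<lambda>x. G (T x)) differentiable (at p)"
    using D unfolding differentiable_def by blast
  show "pd i (\<lambda>x. G (T x)) p = (pd i T p)$1 *\<^sub>R pd 1 G (T p) + (pd i T p)$2 *\<^sub>R pd 2 G (T p)"
    using has_derivative_pd[OF D, of i] frechet_derivative_pd[OF assms(2)]
    by (simp only: pd_def[of i T])
qed

lemma Ck_on_const [simp]: "Ck_on k S (\<lambda>_. c)"
  by (induction k arbitrary: c) auto

lemma Ck_on_add:
  assumes "open S" "Ck_on k S f" "Ck_on k S g"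
  shows "Ck_on k S (\<lambda>x. f x + g x)"
  using assms(2,3)
proof (induction k arbitrary: f g)
  case 0
  then show ?case by (auto intro: continuous_on_add)
next
  case (Suc k)
  note df = Ck_on_Suc_differentiable[OF assms(1) Suc.prems(1)]
    and dg = Ck_on_Suc_differentiable[OF assms(1) Suc.prems(2)]
  show ?case
  proof (rule Ck_on_SucI[OF assms(1)])
    show "pd i (\<lambda>x. f x + g x) p = pd i f p + pd i g p" if "p \<in> S" for i p
      using df dg that by (simp add: pd_add)
    show "Ck_on k S (\<lambda>p. pd i f p + pd i g p)" for i
      by (metis Ck_on_Suc_pd Suc.IH Suc.prems)
  qed (use df dg in auto)
qed

lemma Ck_on_mult:
  fixes f g :: "real^2 \<Rightarrow> real"
  assumes "open S" "Ck_on k S f" "Ck_on k S g"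
  shows "Ck_on k S (\<lambda>x. f x * g x)"
  using assms(2,3)
proof (induction k arbitrary: f g)
  case 0
  then show ?case by (auto intro: continuous_on_mult)
next
  case (Suc k)
  note df = Ck_on_Suc_differentiable[OF assms(1) Suc.prems(1)]
    and dg = Ck_on_Suc_differentiable[OF assms(1) Suc.prems(2)]
  show ?case
  proof (rule Ck_on_SucI[OF assms(1)])
    show "pd i (\<lambda>x. f x * g x) p = f p * pd i g p + pd i f p * g p" if "p \<in> S" for i p
      using df dg that by (simp add: pd_mult)
    show "Ck_on k S (\<lambda>p. f p * pd i g p + pd i f p * g p)" for i
      by (rule Ck_on_add[OF assms(1)]) (metis Ck_on_Suc_pd Suc.IH Suc.prems Ck_on_lower)+
  qed (use df dg in auto)
qed

text \<open>The derivatives of \<open>\<phi> \<circ> f\<close> are again of the form \<open>\<phi>' \<circ> f\<close> up to smooth factors. Closure of the family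
  \<open>\<Phi>\<close> under differentiation on \<open>I\<close> therefore replaces any computation of higher derivatives of \<open>\<phi>\<close>;
  powers (hence quotients and square roots) and the flat exponential are instances.\<close>

lemma Ck_on_family_compose:
  fixes f :: "real^2 \<Rightarrow> real"
  assumes S: "open S" and f: "\<And>k. Ck_on k S f" and fI: "\<And>p. p \<in> S \<Longrightarrow> f p \<in> I"
    and step: "\<And>\<phi>. \<phi> \<in> \<Phi> \<Longrightarrow> \<exists>\<phi>'\<in>\<Phi>. \<forall>t\<in>I. (\<phi> has_field_derivative \<phi>' t) (at t)"
    and \<phi>: "\<phi> \<in> \<Phi>"
  shows "Ck_on k S (\<lambda>x. \<phi> (f x))"
  using \<phi>
proof (induction k arbitrary: \<phi>)
  case 0
  have "(\<lambda>x. \<phi> (f x)) differentiable (at p)" if "p \<in> S" for p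
    using step[OF 0] pd_compose_real(1)[OF Ck_on_Suc_differentiable[OF S f that]] fI[OF that]
    by blast
  then show ?case
    by (simp add: continuous_on_eq_continuous_at S differentiable_imp_continuous_within)
next
  case (Suc k)
  obtain \<phi>' where \<phi>': "\<phi>' \<in> \<Phi>" "\<And>t. t \<in> I \<Longrightarrow> (\<phi> has_field_derivative \<phi>' t) (at t)"
    using step[OF Suc.prems] by blast
  note df = Ck_on_Suc_differentiable[OF S f]
  show ?case
  proof (rule Ck_on_SucI[OF S])
    show "pd i (\<lambda>x. \<phi> (f x)) p = \<phi>' (f p) * pd i f p" if "p \<in> S" for i p
      using pd_compose_real(2)[OF df[OF that] \<phi>'(2)[OF fI[OF that]]] .
    show "Ck_on k S (\<lambda>p. \<phi>' (f p) * pd i f p)" for i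
      using f[of "Suc k"] by (intro Ck_on_mult[OF S] Suc.IH[OF \<phi>'(1)]) (simp add: Ck_on_Suc_pd del: Ck_on.simps)
  qed (use pd_compose_real(1)[OF df \<phi>'(2)] fI in auto)
qed

text \<open>Each partial derivative of \<open>G \<circ> T\<close> is a sum of products of a partial derivative of \<open>G\<close>, composed with
  \<open>T\<close>, and a partial derivative of a component of \<open>T\<close>; the order drops by one.\<close>

lemma Ck_on_compose:
  fixes G :: "real^2 \<Rightarrow> real" and T :: "real^2 \<Rightarrow> real^2"
  assumes S: "open S" and S': "open S'" and T: "\<And>i. Ck_on k S (\<lambda>p. T p $ i)" and G: "Ck_on k S' G"
    and TS: "\<And>p. p \<in> S \<Longrightarrow> T p \<in> S'"
  shows "Ck_on k S (\<lambda>p. G (T p))"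
  using T G
proof (induction k arbitrary: G)
  case 0
  have "continuous_on S T"
    using 0(1) continuous_on_vec_lambda[of S "\<lambda>i p. T p $ i"] by simp
  then show ?case
    using 0(2) TS by (auto intro!: continuous_on_compose2[of S' G S T])
next
  case (Suc k)
  have dT: "T differentiable (at p)" if p: "p \<in> S" for p
  proof -
    have "(\<lambda>p. T p $ i) differentiable (at p)" for i
      using Ck_on_Suc_differentiable[OF S Suc.prems(1) p] .
    then show ?thesis
      by (subst differentiable_componentwise_within) (auto simp: Basis_vec_def inner_axis)
  qed
  have dG: "G differentiable (at (T p))" if p: "p \<in> S" for p
    using Ck_on_Suc_differentiable[OF S' Suc.prems(2)] TS p by blast
  have pT: "pd i T p $ j = pd i (\<lambda>p. T p $ j) p" if "p \<in> S" for i j p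
    using pd_bounded_linear(2)[OF bounded_linear_vec_nth dT[OF that]] by simp
  have TT: "Ck_on k S (\<lambda>p. T p $ i)" for i
    using Suc.prems(1) Ck_on_lower by blast
  have TT': "Ck_on k S (pd i (\<lambda>p. T p $ j))" for i j
    using Suc.prems(1)[of j] by (simp only: Ck_on_Suc_pd)
  have GG: "Ck_on k S' (pd i G)" for i
    using Suc.prems(2) by (simp only: Ck_on_Suc_pd)
  have GT: "Ck_on k S (\<lambda>p. pd i G (T p))" for i
    by (rule Suc.IH[OF TT GG])
  show ?case
  proof (rule Ck_on_SucI[OF S])
    show "pd i (\<lambda>x. G (T x)) p = pd i (\<lambda>p. T p $ 1) p * pd 1 G (T p)
        + pd i (\<lambda>p. T p $ 2) p * pd 2 G (T p)" if "p \<in> S" for i p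
      using pd_compose(2)[OF dT[OF that] dG[OF that]] pT[OF that] by simp
    show "Ck_on k S (\<lambda>p. pd i (\<lambda>p. T p $ 1) p * pd 1 G (T p)
        + pd i (\<lambda>p. T p $ 2) p * pd 2 G (T p))" for i
      by (intro Ck_on_add[OF S] Ck_on_mult[OF S] TT' GT)
  qed (use pd_compose(1)[OF dT dG] in auto)
qed

lemma Csmooth_imp_differentiable: "open S \<Longrightarrow> Csmooth S f \<Longrightarrow> p \<in> S \<Longrightarrow> f differentiable (at p)"
  unfolding Csmooth_def using Ck_on_Suc_differentiable by blast

lemma Csmooth_imp_continuous_on: "Csmooth S f \<Longrightarrow> continuous_on S f"
  unfolding Csmooth_def by (metis Ck_on.simps(1))

lemma Csmooth_pd: "Csmooth S f \<Longrightarrow> Csmooth S (pd i f)"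
  unfolding Csmooth_def by (meson Ck_on_Suc_pd)

lemma Csmooth_subset: "Csmooth S f \<Longrightarrow> T \<subseteq> S \<Longrightarrow> Csmooth T f"
  unfolding Csmooth_def using Ck_on_subset by blast

lemma Csmooth_cong:
  "open S \<Longrightarrow> Csmooth S f \<Longrightarrow> (\<And>x. x \<in> S \<Longrightarrow> f x = g x) \<Longrightarrow> Csmooth S g"
  unfolding Csmooth_def using Ck_on_cong by blast

lemma Csmooth_local:
  "(\<And>p. p \<in> S \<Longrightarrow> \<exists>W. open W \<and> p \<in> W \<and> Csmooth W f) \<Longrightarrow> Csmooth S f"
  unfolding Csmooth_def by (meson Ck_on_local)

lemma smooth_on_open_iff:
  assumes "open S"
  shows "smooth_on S f \<longleftrightarrow> Csmooth S f"
proof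
  assume R: "smooth_on S f"
  show "Csmooth S f"
  proof (rule Csmooth_local)
    fix p assume "p \<in> S"
    then obtain W F where W: "open W" "p \<in> W" "\<And>k. Ck_on k W F" "\<And>q. q \<in> W \<inter> S \<Longrightarrow> F q = f q"
      using R unfolding smooth_on_def by meson
    have "Csmooth (W \<inter> S) F" using W(3) Ck_on_subset unfolding Csmooth_def by blast
    then have "Csmooth (W \<inter> S) f"
      using Csmooth_cong[of "W \<inter> S" F f] W assms by auto
    then show "\<exists>W. open W \<and> p \<in> W \<and> Csmooth W f"
      using W assms \<open>p \<in> S\<close> by (meson IntI open_Int)
  qed
next
  assume "Csmooth S f"
  then show "smooth_on S f"
    unfolding smooth_on_def Csmooth_def using assms by blast
qed

lemma Csmooth_const [simp]: "Csmooth S (\<lambda>_. c)"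
  by (simp add: Csmooth_def)

lemma Csmooth_add: "open S \<Longrightarrow> Csmooth S f \<Longrightarrow> Csmooth S g \<Longrightarrow> Csmooth S (\<lambda>x. f x + g x)"
  by (simp add: Csmooth_def Ck_on_add)

lemma Csmooth_mult:
  fixes f g :: "real^2 \<Rightarrow> real"
  shows "open S \<Longrightarrow> Csmooth S f \<Longrightarrow> Csmooth S g \<Longrightarrow> Csmooth S (\<lambda>x. f x * g x)"
  by (simp add: Csmooth_def Ck_on_mult)

lemma Csmooth_diff:
  fixes f g :: "real^2 \<Rightarrow> real"
  assumes "open S" "Csmooth S f" "Csmooth S g"
  shows "Csmooth S (\<lambda>x. f x - g x)"
  using Csmooth_add[OF assms(1,2) Csmooth_mult[OF assms(1) Csmooth_const[of S "-1"] assms(3)]] by simp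

lemma Csmooth_sum:
  fixes f :: "'i \<Rightarrow> real^2 \<Rightarrow> real"
  assumes "open S" "\<And>i. i \<in> I \<Longrightarrow> Csmooth S (f i)"
  shows "Csmooth S (\<lambda>x. \<Sum>i\<in>I. f i x)"
  using assms(2) by (induction I rule: infinite_finite_induct) (auto intro: Csmooth_add[OF assms(1)])

lemma Csmooth_family_compose:
  fixes f :: "real^2 \<Rightarrow> real"
  assumes "open S" "Csmooth S f" "\<And>p. p \<in> S \<Longrightarrow> f p \<in> I"
    "\<And>\<phi>. \<phi> \<in> \<Phi> \<Longrightarrow> \<exists>\<phi>'\<in>\<Phi>. \<forall>t\<in>I. (\<phi> has_field_derivative \<phi>' t) (at t)" "\<phi> \<in> \<Phi>"
  shows "Csmooth S (\<lambda>x. \<phi> (f x))"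
  using assms Ck_on_family_compose unfolding Csmooth_def by blast

lemma Csmooth_powr:
  fixes f :: "real^2 \<Rightarrow> real"
  assumes "open S" "Csmooth S f" "\<And>p. p \<in> S \<Longrightarrow> f p > 0"
  shows "Csmooth S (\<lambda>x. f x powr a)"
proof (rule Csmooth_family_compose[OF assms(1,2), where I="{0<..}" and \<Phi>="{\<lambda>t. c * t powr b |c b. True}"
      and \<phi>="\<lambda>t. t powr a"])
  show "(\<lambda>t. t powr a) \<in> {\<lambda>t. c * t powr b |c b. True}"
    by (rule CollectI, rule exI[of _ 1], rule exI[of _ a]) simp
  fix \<phi> :: "real \<Rightarrow> real" assume "\<phi> \<in> {\<lambda>t. c * t powr b |c b. True}"
  then obtain c b where \<phi>: "\<phi> = (\<lambda>t. c * t powr b)" by blast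
  have "\<forall>t\<in>{0<..}. (\<phi> has_field_derivative (c * b) * t powr (b - 1)) (at t)"
    unfolding \<phi> by (auto intro!: derivative_eq_intros simp: algebra_simps)
  then show "\<exists>\<phi>'\<in>{\<lambda>t. c * t powr b |c b. True}. \<forall>t\<in>{0<..}. (\<phi> has_field_derivative \<phi>' t) (at t)"
    by (intro bexI[of _ "\<lambda>t. (c * b) * t powr (b - 1)"]) auto
qed (use assms in auto)

lemma Csmooth_sqrt:
  fixes f :: "real^2 \<Rightarrow> real"
  assumes "open S" "Csmooth S f" "\<And>p. p \<in> S \<Longrightarrow> f p > 0"
  shows "Csmooth S (\<lambda>x. sqrt (f x))"
  by (rule Csmooth_cong[OF assms(1) Csmooth_powr[OF assms, of "1/2"]])
    (use assms(3) in \<open>auto simp: powr_half_sqrt less_imp_le\<close>)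

lemma Csmooth_divide_pos:
  fixes f g :: "real^2 \<Rightarrow> real"
  assumes "open S" "Csmooth S f" "Csmooth S g" "\<And>p. p \<in> S \<Longrightarrow> g p > 0"
  shows "Csmooth S (\<lambda>x. f x / g x)"
  by (rule Csmooth_cong[OF assms(1) Csmooth_mult[OF assms(1,2) Csmooth_powr[OF assms(1,3,4), of "-1"]]])
    (use assms(4) in \<open>auto simp: powr_minus_divide less_imp_le\<close>)

lemma Csmooth_bounded_linear_compose:
  assumes "bounded_linear L" "open S" "Csmooth S f"
  shows "Csmooth S (\<lambda>x. L (f x))"
proof -
  have "Ck_on k S (\<lambda>x. L (f x))" if "Ck_on k S f" for k
    using that
  proof (induction k arbitrary: f)
    case 0
    then show ?case using bounded_linear.continuous_on[OF assms(1)] by auto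
  next
    case (Suc k)
    note df = Ck_on_Suc_differentiable[OF assms(2) Suc.prems]
    show ?case
    proof (rule Ck_on_SucI[OF assms(2)])
      show "pd i (\<lambda>x. L (f x)) p = L (pd i f p)" if "p \<in> S" for i p
        using pd_bounded_linear(2)[OF assms(1) df[OF that]] .
      show "Ck_on k S (\<lambda>p. L (pd i f p))" for i
        using Suc.IH Suc.prems by (simp only: Ck_on_Suc_pd)
    qed (use pd_bounded_linear(1)[OF assms(1) df] in auto)
  qed
  then show ?thesis using assms(3) by (simp add: Csmooth_def)
qed

lemma Csmooth_nth: "open S \<Longrightarrow> Csmooth S f \<Longrightarrow> Csmooth S (\<lambda>x. f x $ i)"
  using Csmooth_bounded_linear_compose[OF bounded_linear_vec_nth] .

lemma Csmooth_compose:
  fixes G :: "real^2 \<Rightarrow> real" and T :: "real^2 \<Rightarrow> real^2"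
  assumes "open S" "open S'" "Csmooth S T" "Csmooth S' G" "\<And>p. p \<in> S \<Longrightarrow> T p \<in> S'"
  shows "Csmooth S (\<lambda>p. G (T p))"
  unfolding Csmooth_def
proof
  fix k
  have "Ck_on k S (\<lambda>p. T p $ i)" for i
    using Csmooth_nth[OF assms(1,3)] by (simp add: Csmooth_def)
  then show "Ck_on k S (\<lambda>p. G (T p))"
    using Ck_on_compose[OF assms(1,2), of k T G] assms(4,5) by (simp add: Csmooth_def)
qed

lemma Csmooth_linear:
  assumes "bounded_linear (L :: real^2 \<Rightarrow> 'b::real_normed_vector)"
  shows "Csmooth S L"
  unfolding Csmooth_def
proof
  fix k show "Ck_on k S L"
  proof (cases k)
    case 0
    then show ?thesis using assms by (simp add: linear_continuous_on)
  next
    case (Suc j)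
    have "pd i L = (\<lambda>p. L (axis i 1))" for i
      using has_derivative_pd[OF bounded_linear_imp_has_derivative[OF assms]] by blast
    then show ?thesis
      unfolding Suc Ck_on_Suc_pd using bounded_linear_imp_has_derivative[OF assms]
      by (auto simp: differentiable_on_def differentiable_def)
  qed
qed

section \<open>Symmetry of second derivatives and the Piola identity\<close>

lemma has_field_derivative_pd_line:
  fixes F :: "real^2 \<Rightarrow> real"
  assumes "F differentiable (at (a + s *\<^sub>R axis i 1))"
  shows "((\<lambda>s. F (a + s *\<^sub>R axis i 1)) has_field_derivative pd i F (a + s *\<^sub>R axis i 1)) (at s)"
proof -
  have 1: "((\<lambda>s. a + s *\<^sub>R axis i (1::real)) has_derivative (\<lambda>t. t *\<^sub>R axis i 1)) (at s)"
    by (auto intro!: derivative_eq_intros)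
  have "((\<lambda>s. F (a + s *\<^sub>R axis i 1)) has_derivative
      (\<lambda>t. frechet_derivative F (at (a + s *\<^sub>R axis i 1)) (t *\<^sub>R axis i 1))) (at s)"
    using diff_chain_at[OF 1 assms[unfolded frechet_derivative_works]] by (simp add: o_def)
  moreover have "frechet_derivative F (at (a + s *\<^sub>R axis i 1)) (t *\<^sub>R axis i 1)
      = pd i F (a + s *\<^sub>R axis i 1) * t" for t
    using linear_scale[OF linear_frechet_derivative[OF assms]] by (simp add: pd_def)
  ultimately show ?thesis
    by (simp add: has_field_derivative_def)
qed

text \<open>The mean value theorem is applied once in direction \<open>i\<close> to a difference in direction \<open>j\<close>, and then
  in direction \<open>j\<close>. As the left-hand side is symmetric in \<open>i\<close> and \<open>j\<close>, both mixed derivatives are limits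
  of the same quotient.\<close>

lemma second_difference:
  fixes F :: "real^2 \<Rightarrow> real"
  assumes F: "Csmooth (ball p r) F" and h: "0 < h" "2 * h < r"
  shows "\<exists>q. dist p q < 2 * h \<and>
    F (p + h *\<^sub>R axis i 1 + h *\<^sub>R axis j 1) - F (p + h *\<^sub>R axis i 1) - F (p + h *\<^sub>R axis j 1) + F p
      = h\<^sup>2 * pd j (pd i F) q"
proof -
  let ?P = "\<lambda>s t. p + s *\<^sub>R axis i (1::real) + t *\<^sub>R axis j (1::real)"
  have near: "dist p (?P s t) \<le> s + t" if "0 \<le> s" "0 \<le> t" for s t
  proof -
    have "dist (?P s t) p = norm (s *\<^sub>R axis i (1::real) + t *\<^sub>R axis j (1::real))"
      by (simp add: dist_norm add.assoc)
    also have "\<dots> \<le> norm (s *\<^sub>R axis i (1::real)) + norm (t *\<^sub>R axis j (1::real))"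
      by (rule norm_triangle_ineq)
    finally show ?thesis using that by (simp add: norm_axis_1 dist_commute)
  qed
  have dF: "F differentiable (at (?P s t))" "pd i F differentiable (at (?P s t))"
    if "0 \<le> s" "s \<le> h" "0 \<le> t" "t \<le> h" for s t
  proof -
    have "?P s t \<in> ball p r" using near[of s t] that h by (simp add: mem_ball)
    then show "F differentiable (at (?P s t))" "pd i F differentiable (at (?P s t))"
      using Csmooth_imp_differentiable[OF open_ball] F Csmooth_pd by blast+
  qed
  have 1: "((\<lambda>s. F (?P s t)) has_field_derivative pd i F (?P s t)) (at s)"
    if "0 \<le> s" "s \<le> h" "0 \<le> t" "t \<le> h" for s t
    using has_field_derivative_pd_line[of F "p + t *\<^sub>R axis j 1" s i] dF(1)[OF that]
    by (simp add: algebra_simps)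
  have "\<exists>s>0. s < h \<and> (F (?P h h) - F (?P h 0)) - (F (?P 0 h) - F (?P 0 0))
      = (h - 0) * (pd i F (?P s h) - pd i F (?P s 0))"
    by (rule MVT2[OF h(1)], rule DERIV_diff[OF 1 1]) (use h in auto)
  then obtain s where s: "0 < s" "s < h"
    "(F (?P h h) - F (?P h 0)) - (F (?P 0 h) - F (?P 0 0)) = h * (pd i F (?P s h) - pd i F (?P s 0))"
    by auto
  have "\<exists>t>0. t < h \<and> pd i F (?P s h) - pd i F (?P s 0) = (h - 0) * pd j (pd i F) (?P s t)"
    by (rule MVT2[OF h(1)]) (rule has_field_derivative_pd_line, rule dF(2), use s h in auto)
  then obtain t where t: "0 < t" "t < h"
    "pd i F (?P s h) - pd i F (?P s 0) = h * pd j (pd i F) (?P s t)"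
    by auto
  have "dist p (?P s t) < 2 * h" using near[of s t] s t by simp
  moreover have "F (?P h h) - F (p + h *\<^sub>R axis i 1) - F (p + h *\<^sub>R axis j 1) + F p
      = h\<^sup>2 * pd j (pd i F) (?P s t)"
    using s(3) t(3) by (simp add: power2_eq_square)
  ultimately show ?thesis by blast
qed

lemma pd_commute:
  fixes F :: "real^2 \<Rightarrow> real"
  assumes S: "open S" and p: "p \<in> S" and F: "Csmooth S F"
  shows "pd i (pd j F) p = pd j (pd i F) p"
proof -
  obtain r where r: "0 < r" "ball p r \<subseteq> S" using S p openE by blast
  have FB: "Csmooth (ball p r) F" using Csmooth_subset[OF F r(2)] .
  have cont: "continuous (at p) (pd i (pd j F))" for i j
    using Csmooth_imp_continuous_on[OF Csmooth_pd[OF Csmooth_pd[OF F]]] S p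
    by (simp add: continuous_on_eq_continuous_at)
  have "\<bar>pd i (pd j F) p - pd j (pd i F) p\<bar> \<le> e" if e: "e > 0" for e
  proof -
    obtain d1 where d1: "d1 > 0" "\<And>q. dist q p < d1 \<Longrightarrow> dist (pd i (pd j F) q) (pd i (pd j F) p) < e/2"
      using cont[of i j] e unfolding continuous_at_eps_delta dist_norm
      by (metis half_gt_zero)
    obtain d2 where d2: "d2 > 0" "\<And>q. dist q p < d2 \<Longrightarrow> dist (pd j (pd i F) q) (pd j (pd i F) p) < e/2"
      using cont[of j i] e unfolding continuous_at_eps_delta dist_norm
      by (metis half_gt_zero)
    define h where "h = min r (min d1 d2) / 3"
    have h: "0 < h" "2 * h < r" "2 * h < d1" "2 * h < d2" using r d1 d2 by (auto simp: h_def)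
    obtain q where q: "dist p q < 2 * h" "F (p + h *\<^sub>R axis i 1 + h *\<^sub>R axis j 1)
        - F (p + h *\<^sub>R axis i 1) - F (p + h *\<^sub>R axis j 1) + F p = h\<^sup>2 * pd j (pd i F) q"
      using second_difference[OF FB h(1,2), of i j] by blast
    obtain q' where q': "dist p q' < 2 * h" "F (p + h *\<^sub>R axis j 1 + h *\<^sub>R axis i 1)
        - F (p + h *\<^sub>R axis j 1) - F (p + h *\<^sub>R axis i 1) + F p = h\<^sup>2 * pd i (pd j F) q'"
      using second_difference[OF FB h(1,2), of j i] by blast
    have "h\<^sup>2 * pd j (pd i F) q = h\<^sup>2 * pd i (pd j F) q'"
      using q(2) q'(2) by (simp add: algebra_simps)
    then have "pd j (pd i F) q = pd i (pd j F) q'" using h by simp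
    moreover have "dist (pd i (pd j F) q') (pd i (pd j F) p) < e/2"
      using d1(2)[of q'] q'(1) h by (simp add: dist_commute)
    moreover have "dist (pd j (pd i F) q) (pd j (pd i F) p) < e/2"
      using d2(2)[of q] q(1) h by (simp add: dist_commute)
    ultimately show ?thesis unfolding dist_real_def by linarith
  qed
  then have "\<bar>pd i (pd j F) p - pd j (pd i F) p\<bar> \<le> 0" by (rule field_le_epsilon[of _ 0, simplified])
  then show ?thesis by simp
qed

lemma pd_diff:
  fixes f g :: "real^2 \<Rightarrow> real"
  shows "f differentiable (at p) \<Longrightarrow> g differentiable (at p) \<Longrightarrow>
   pd i (\<lambda>x. f x - g x) p = pd i f p - pd i g p"
  unfolding frechet_derivative_works
  by (rule has_derivative_pd[THEN trans], rule has_derivative_diff) (auto simp: pd_def)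

lemma pd_cmult:
  fixes f :: "real^2 \<Rightarrow> real"
  shows "f differentiable (at p) \<Longrightarrow> pd i (\<lambda>x. c * f x) p = c * pd i f p"
  by (subst pd_mult) auto

text \<open>The planar Piola identity. The rows of the cofactor matrix of \<open>T\<close> are free of divergence, because
  mixed second derivatives commute, so only the derivatives of \<open>V\<close> survive; they combine to the
  Jacobian determinant times the divergence.\<close>

lemma divergence_piola:
  fixes V1 V2 :: "real^2 \<Rightarrow> real" and T :: "real^2 \<Rightarrow> real^2"
  assumes S: "open S" "p \<in> S" and T: "Csmooth S T"
    and V: "V1 differentiable (at (T p))" "V2 differentiable (at (T p))"
  defines "t \<equiv> \<lambda>i q. T q $ i"
  shows "pd 1 (\<lambda>q. pd 2 (t 2) q * V1 (T q) - pd 2 (t 1) q * V2 (T q)) p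
       + pd 2 (\<lambda>q. pd 1 (t 1) q * V2 (T q) - pd 1 (t 2) q * V1 (T q)) p
     = (pd 1 (t 1) p * pd 2 (t 2) p - pd 2 (t 1) p * pd 1 (t 2) p) * (pd 1 V1 (T p) + pd 2 V2 (T p))"
proof -
  have t: "Csmooth S (t i)" for i unfolding t_def by (rule Csmooth_nth[OF S(1) T])
  have dT: "T differentiable (at p)" using Csmooth_imp_differentiable[OF S(1) T S(2)] .
  have pT: "pd i T p $ k = pd i (t k) p" for i k
    unfolding t_def using pd_bounded_linear(2)[OF bounded_linear_vec_nth dT] by simp
  have dt: "pd i (t k) differentiable (at p)" for i k
    using Csmooth_imp_differentiable[OF S(1) Csmooth_pd[OF t] S(2)] .
  have dV: "(\<lambda>q. V1 (T q)) differentiable (at p)" "(\<lambda>q. V2 (T q)) differentiable (at p)"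
    using pd_compose(1)[OF dT] V by blast+
  have c: "pd i (\<lambda>q. V1 (T q)) p = pd i (t 1) p * pd 1 V1 (T p) + pd i (t 2) p * pd 2 V1 (T p)"
    "pd i (\<lambda>q. V2 (T q)) p = pd i (t 1) p * pd 1 V2 (T p) + pd i (t 2) p * pd 2 V2 (T p)" for i
    using pd_compose(2)[OF dT V(1)] pd_compose(2)[OF dT V(2)] by (simp_all add: pT)
  have "pd 1 (pd 2 (t k)) p = pd 2 (pd 1 (t k)) p" for k
    by (rule pd_commute[OF S t])
  then show ?thesis
    by (simp add: pd_diff pd_mult c differentiable_mult dV dt) (simp add: algebra_simps)
qed

section \<open>Bump functions\<close>

text \<open>The family \<open>P(1/t) exp(-1/t)\<close>, extended by zero, is closed under differentiation, whereas the single
  function \<open>exp(-1/t)\<close> is not.\<close>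

definition flat_exp :: "real poly \<Rightarrow> real \<Rightarrow> real" where
  "flat_exp P t = (if t > 0 then poly P (1/t) * exp (- (1/t)) else 0)"

lemma poly_times_exp_minus_tendsto_0: "((\<lambda>s. poly P s * exp (- s)) \<longlongrightarrow> (0::real)) at_top"
proof -
  have "((\<lambda>s::real. \<Sum>k\<le>degree P. coeff P k * (s ^ k / exp s)) \<longlongrightarrow> (\<Sum>k\<le>degree P. coeff P k * 0)) at_top"
    by (intro tendsto_intros tendsto_power_div_exp_0)
  then show ?thesis
    by (simp add: poly_altdef sum_distrib_right exp_minus divide_inverse mult.assoc)
qed

text \<open>At the origin every member of the family vanishes to infinite order, since exponentials beat
  polynomials; elsewhere this is the product rule.\<close>

lemma flat_exp_has_derivative:
  "(flat_exp P has_field_derivative flat_exp (monom 1 2 * (P - pderiv P)) t) (at t)"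
proof -
  consider "t > 0" | "t < 0" | "t = 0" by linarith
  then show ?thesis
  proof cases
    case 1
    have "((\<lambda>t. poly P (1/t) * exp (- (1/t))) has_field_derivative
        flat_exp (monom 1 2 * (P - pderiv P)) t) (at t)"
      using 1 by (auto intro!: derivative_eq_intros
          simp: flat_exp_def poly_monom field_simps power2_eq_square)
    moreover have "\<forall>\<^sub>F x in nhds t. flat_exp P x = poly P (1/x) * exp (- (1/x))"
      by (rule eventually_mono[OF eventually_nhds_in_open[of "{0<..}" t]]) (use 1 in \<open>auto simp: flat_exp_def\<close>)
    ultimately show ?thesis
      by (subst DERIV_cong_ev[OF refl _ refl])
  next
    case 2
    have "\<forall>\<^sub>F x in nhds t. flat_exp P x = 0"
      by (rule eventually_mono[OF eventually_nhds_in_open[of "{..<0}" t]]) (use 2 in \<open>auto simp: flat_exp_def\<close>)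
    moreover have "((\<lambda>t. 0) has_field_derivative flat_exp (monom 1 2 * (P - pderiv P)) t) (at t)"
      using 2 by (simp add: flat_exp_def)
    ultimately show ?thesis
      by (subst DERIV_cong_ev[OF refl _ refl])
  next
    case 3
    have "((\<lambda>h. flat_exp P h / h) \<longlongrightarrow> 0) (at 0)"
    proof (rule filterlim_split_at)
      show "((\<lambda>h. flat_exp P h / h) \<longlongrightarrow> 0) (at_left 0)"
        by (rule tendsto_eventually)
          (auto simp: eventually_at_filter flat_exp_def intro!: always_eventually)
      have "((\<lambda>h. poly (pCons 0 P) (inverse h) * exp (- inverse h)) \<longlongrightarrow> 0) (at_right 0)"
        using filterlim_compose[OF poly_times_exp_minus_tendsto_0 filterlim_inverse_at_top_right] .
      then show "((\<lambda>h. flat_exp P h / h) \<longlongrightarrow> 0) (at_right 0)"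
        by (rule Lim_transform_eventually)
          (auto simp: eventually_at_filter flat_exp_def field_simps intro!: always_eventually)
    qed
    then show ?thesis
      using 3 by (simp add: DERIV_def flat_exp_def)
  qed
qed

definition bump :: "real^2 \<Rightarrow> real \<Rightarrow> real^2 \<Rightarrow> real" where
  "bump a r p = flat_exp 1 (r\<^sup>2 - ((p$1 - a$1)\<^sup>2 + (p$2 - a$2)\<^sup>2))"

lemma Csmooth_bump: "Csmooth UNIV (bump a r)"
proof -
  have 1: "Csmooth UNIV (\<lambda>p::real^2. p $ i)" for i
    by (rule Csmooth_linear[OF bounded_linear_vec_nth])
  have "Csmooth UNIV (\<lambda>p::real^2. r\<^sup>2 - ((p$1 - a$1) * (p$1 - a$1) + (p$2 - a$2) * (p$2 - a$2)))"
    by (intro Csmooth_diff Csmooth_add Csmooth_mult 1 open_UNIV Csmooth_const)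
  then show ?thesis
    unfolding bump_def[abs_def] power2_eq_square[of "_ - _"]
    by (rule Csmooth_family_compose[OF open_UNIV, where I=UNIV and \<Phi>="range flat_exp"])
      (use flat_exp_has_derivative in auto)
qed

lemma bump_nonneg: "0 \<le> bump a r p"
  by (simp add: bump_def flat_exp_def)

lemma bump_pos_iff:
  assumes "r > 0"
  shows "0 < bump a r p \<longleftrightarrow> p \<in> ball a r"
proof -
  have "0 < bump a r p \<longleftrightarrow> (p$1 - a$1)\<^sup>2 + (p$2 - a$2)\<^sup>2 < r\<^sup>2"
    by (simp add: bump_def flat_exp_def)
  also have "\<dots> \<longleftrightarrow> (dist a p)\<^sup>2 < r\<^sup>2"
    by (simp add: dist_norm norm_vec_def L2_set_def sum_2 power2_commute[of "a$_"])
  also have "\<dots> \<longleftrightarrow> p \<in> ball a r"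
    using assms power2_less_imp_less[of "dist a p" r] power_strict_mono[of "dist a p" r 2] by auto
  finally show ?thesis .
qed

lemma bump_eq_0: "r > 0 \<Longrightarrow> p \<notin> ball a r \<Longrightarrow> bump a r p = 0"
  using bump_pos_iff[of r a p] bump_nonneg[of a r p] by linarith

section \<open>Mollification in the plane\<close>

definition conv :: "(real^2 \<Rightarrow> real) \<Rightarrow> (real^2 \<Rightarrow> real) \<Rightarrow> real^2 \<Rightarrow> real" where
  "conv v \<phi> x = (LINT y|lborel. v y * \<phi> (x - y))"

definition mollifier :: "real \<Rightarrow> (real^2 \<Rightarrow> real) \<Rightarrow> bool" where
  "mollifier r \<phi> \<longleftrightarrow> Csmooth UNIV \<phi> \<and> (\<forall>p. 0 \<le> \<phi> p) \<and> (\<forall>p. p \<notin> ball 0 r \<longrightarrow> \<phi> p = 0)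
     \<and> (\<integral>\<^sup>+p. ennreal (\<phi> p) \<partial>lborel) = 1"

lemma lborel_distr_reflect: "distr lborel borel (\<lambda>y::real^2. x - y) = lborel"
proof -
  have "lborel = density (distr lborel borel (\<lambda>y. x + (-1) *\<^sub>R y)) (\<lambda>_. ennreal (\<bar>-1::real\<bar> ^ DIM(real^2)))"
    by (rule lborel_affine) simp
  then show ?thesis by (simp add: density_1)
qed

lemma nn_integral_reflect:
  assumes "f \<in> borel_measurable borel"
  shows "(\<integral>\<^sup>+y. f (x - y) \<partial>lborel) = (\<integral>\<^sup>+y. f (y::real^2) \<partial>lborel)"
  using nn_integral_distr[of "\<lambda>y. x - y" lborel borel f] assms
  by (simp add: lborel_distr_reflect)

lemma mollifier_exists:
  assumes "r > 0"
  shows "\<exists>\<phi>. mollifier r \<phi>"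
proof -
  let ?b = "bump 0 r"
  have cont: "continuous_on UNIV ?b" by (rule Csmooth_imp_continuous_on[OF Csmooth_bump])
  then have meas[measurable]: "?b \<in> borel_measurable borel" by (rule borel_measurable_continuous_onI)
  have "integrable lborel (\<lambda>x. indicator (cball 0 r) x *\<^sub>R ?b x)"
    by (rule borel_integrable_compact) (auto intro: continuous_on_subset[OF cont])
  moreover have "(\<lambda>x. indicator (cball 0 r) x *\<^sub>R ?b x) = ?b"
    using bump_eq_0[OF assms, of _ 0] by (auto simp: indicator_def fun_eq_iff)
  ultimately have int: "integrable lborel ?b" by metis
  define J where "J = (LINT x|lborel. ?b x)"
  have J: "(\<integral>\<^sup>+x. ennreal (?b x) \<partial>lborel) = ennreal J"
    unfolding J_def by (rule nn_integral_eq_integral[OF int]) (simp add: bump_nonneg)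
  have "J \<noteq> 0"
  proof
    assume "J = 0"
    then have "AE x in lborel. ?b x = 0"
      using integral_nonneg_eq_0_iff_AE[OF int] bump_nonneg by (auto simp: J_def)
    then have "AE x in lborel. x \<notin> ball (0::real^2) r"
      by (rule eventually_mono) (metis bump_pos_iff[OF assms] less_irrefl)
    then have "emeasure lborel (ball (0::real^2) r) = 0"
      by (subst (asm) AE_iff_measurable[of "ball 0 r"]) auto
    then show False
      using emeasure_lborel_ball_finite[of 0 r] content_ball_pos[OF assms, of "0::real^2"]
      by (simp add: measure_def)
  qed
  moreover have "J \<ge> 0" unfolding J_def by (simp add: bump_nonneg)
  ultimately have Jp: "J > 0" by simp
  have "mollifier r (\<lambda>x. (1/J) * ?b x)"
    unfolding mollifier_def
  proof (intro conjI allI impI)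
    show "Csmooth UNIV (\<lambda>x. (1/J) * ?b x)"
      by (intro Csmooth_mult open_UNIV Csmooth_const Csmooth_bump)
    have "(\<integral>\<^sup>+p. ennreal ((1/J) * ?b p) \<partial>lborel) = (\<integral>\<^sup>+p. ennreal (1/J) * ennreal (?b p) \<partial>lborel)"
      using Jp by (intro nn_integral_cong ennreal_mult) (auto simp: bump_nonneg)
    also have "\<dots> = ennreal (1/J) * ennreal J"
      by (subst nn_integral_cmult) (simp_all add: J)
    also have "\<dots> = 1" using Jp by (simp add: ennreal_mult'[symmetric])
    finally show "(\<integral>\<^sup>+p. ennreal ((1/J) * ?b p) \<partial>lborel) = 1" .
  qed (use Jp bump_nonneg bump_eq_0[OF assms] in auto)
  then show ?thesis by blast
qed

lemma integrable_mult_continuous: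
  assumes v: "integrable lborel (v :: real^2 \<Rightarrow> real)" and K: "compact K" "\<And>y. y \<notin> K \<Longrightarrow> v y = 0"
    and \<psi>: "continuous_on K \<psi>" "\<psi> \<in> borel_measurable borel"
  shows "integrable lborel (\<lambda>y. v y * \<psi> y)"
proof -
  have "bounded (\<psi> ` K)" by (intro compact_imp_bounded compact_continuous_image \<psi> K)
  then obtain B where B: "\<And>y. y \<in> K \<Longrightarrow> \<bar>\<psi> y\<bar> \<le> B" by (auto simp: bounded_iff)
  have [measurable]: "v \<in> borel_measurable borel" using v by (simp add: borel_measurable_integrable)
  note \<psi>(2)[measurable]
  show ?thesis
  proof (rule Bochner_Integration.integrable_bound[OF integrable_mult_right[of B, OF integrable_abs[OF v]]])
    show "AE y in lborel. norm (v y * \<psi> y) \<le> norm (B * \<bar>v y\<bar>)"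
    proof (rule AE_I2)
      fix y show "norm (v y * \<psi> y) \<le> norm (B * \<bar>v y\<bar>)"
      proof (cases "y \<in> K")
        case True
        have "\<bar>v y\<bar> * \<bar>\<psi> y\<bar> \<le> \<bar>v y\<bar> * \<bar>B\<bar>" by (intro mult_left_mono) (use B[OF True] in auto)
        then show ?thesis by (simp add: abs_mult mult.commute)
      qed (use K(2) in simp)
    qed
  qed auto
qed

lemma integrable_mult_translate:
  assumes v: "integrable lborel (v :: real^2 \<Rightarrow> real)" and K: "compact K" "\<And>y. y \<notin> K \<Longrightarrow> v y = 0"
    and \<psi>: "continuous_on UNIV \<psi>"
  shows "integrable lborel (\<lambda>y. v y * \<psi> (x - y))"
proof (rule integrable_mult_continuous[OF v K])
  have c: "continuous_on UNIV (\<lambda>y. \<psi> (x - y))"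
    by (rule continuous_on_compose2[OF \<psi>]) (auto intro!: continuous_intros)
  then show "continuous_on K (\<lambda>y. \<psi> (x - y))" by (rule continuous_on_subset) simp
  show "(\<lambda>y. \<psi> (x - y)) \<in> borel_measurable borel" by (rule borel_measurable_continuous_onI[OF c])
qed

text \<open>On the compact neighbourhood of radius one of \<open>K\<close> the first derivatives are uniformly continuous, and
  the linearization error is controlled by their oscillation.\<close>

lemma linearization_error_uniform:
  assumes \<phi>: "Csmooth UNIV (\<phi> :: real^2 \<Rightarrow> real)" and K: "compact K" and e: "e > 0"
  shows "\<exists>d>0. \<forall>z\<in>K. \<forall>h. norm h < d \<longrightarrow>
    \<bar>\<phi> (z + h) - \<phi> z - (h$1 * pd 1 \<phi> z + h$2 * pd 2 \<phi> z)\<bar> \<le> e * norm h"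
proof -
  define N where "N = {z + w |z w. z \<in> K \<and> w \<in> cball (0::real^2) 1}"
  have cK: "compact N" unfolding N_def by (rule compact_sums[OF K]) simp
  have uc: "uniformly_continuous_on N (pd i \<phi>)" for i
    using compact_uniformly_continuous[OF continuous_on_subset[OF Csmooth_imp_continuous_on[OF Csmooth_pd[OF \<phi>]]] cK]
    by simp
  have "\<forall>i. \<exists>d. d > 0 \<and> (\<forall>z\<in>N. \<forall>w\<in>N. dist w z < d \<longrightarrow> dist (pd i \<phi> w) (pd i \<phi> z) < e/2)"
    using uc e unfolding uniformly_continuous_on_def by (meson half_gt_zero)
  from choice[OF this] obtain D where D: "\<And>i. D i > 0"
    "\<And>i z w. z \<in> N \<Longrightarrow> w \<in> N \<Longrightarrow> dist w z < D i \<Longrightarrow> dist (pd i \<phi> w) (pd i \<phi> z) < e/2"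
    by blast
  define d where "d = min 1 (min (D 1) (D 2))"
  have d: "d > 0" "d \<le> 1" "d \<le> D 1" "d \<le> D 2" using D(1) by (auto simp: d_def)
  have der: "(\<phi> has_derivative frechet_derivative \<phi> (at x)) (at x within S)" for x S
    using Csmooth_imp_differentiable[OF open_UNIV \<phi>, of x] frechet_derivative_works
      has_derivative_at_withinI by blast
  have fd: "frechet_derivative \<phi> (at x) v = v$1 * pd 1 \<phi> x + v$2 * pd 2 \<phi> x" for x v
    using frechet_derivative_pd[OF Csmooth_imp_differentiable[OF open_UNIV \<phi>, of x]] by simp
  have "\<bar>\<phi> (z + h) - \<phi> z - (h$1 * pd 1 \<phi> z + h$2 * pd 2 \<phi> z)\<bar> \<le> e * norm h"
    if z: "z \<in> K" and h: "norm h < d" for z h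
  proof -
    let ?S = "cball z (norm h)"
    have inK: "x \<in> N \<and> dist x z < D i" if "x \<in> ?S" for x i
    proof -
      have "x = z + (x - z)" by simp
      moreover have "x - z \<in> cball 0 1" using that h d by (auto simp: dist_norm norm_minus_commute)
      ultimately have "x \<in> N" using z unfolding N_def by blast
      moreover have "dist x z < D i" using that h d exhaust_2[of i] by (auto simp: dist_commute)
      ultimately show ?thesis by blast
    qed
    have zK: "z \<in> N" using inK[of z 1] by simp
    have "norm (\<phi> (z + h) - \<phi> z - frechet_derivative \<phi> (at z) ((z + h) - z)) \<le> norm ((z + h) - z) * e"
    proof (rule differentiable_bound_linearization[where S="?S"])
      show "z + t *\<^sub>R (z + h - z) \<in> ?S" if "t \<in> {0..1}" for t
        using that by (auto simp: dist_norm intro: mult_left_le_one_le)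
      show "(\<phi> has_derivative frechet_derivative \<phi> (at x)) (at x within ?S)" for x by (rule der)
      show "onorm (frechet_derivative \<phi> (at x) - frechet_derivative \<phi> (at z)) \<le> e" if x: "x \<in> ?S" for x
      proof (rule onorm_bound)
        fix v :: "real^2"
        have a: "\<bar>pd i \<phi> x - pd i \<phi> z\<bar> \<le> e/2" for i
          using D(2)[OF zK, of x i] inK[OF x, of i] by (auto simp: dist_real_def)
        have "\<bar>v$1 * (pd 1 \<phi> x - pd 1 \<phi> z) + v$2 * (pd 2 \<phi> x - pd 2 \<phi> z)\<bar>
            \<le> \<bar>v$1\<bar> * \<bar>pd 1 \<phi> x - pd 1 \<phi> z\<bar> + \<bar>v$2\<bar> * \<bar>pd 2 \<phi> x - pd 2 \<phi> z\<bar>"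
          by (metis abs_mult abs_triangle_ineq)
        also have "\<dots> \<le> norm v * (e/2) + norm v * (e/2)"
          by (intro add_mono mult_mono a component_le_norm_cart) auto
        finally show "norm ((frechet_derivative \<phi> (at x) - frechet_derivative \<phi> (at z)) v) \<le> e * norm v"
          by (simp add: fd algebra_simps)
      qed (use e in simp)
    qed simp
    then show ?thesis by (simp add: fd mult.commute)
  qed
  then show ?thesis using d(1) by blast
qed

text \<open>The linearization error of the kernel is uniformly small on the support of \<open>v\<close>, and hence small after
  integration against the integrable function \<open>v\<close>.\<close>

lemma conv_has_derivative:
  assumes v: "integrable lborel (v :: real^2 \<Rightarrow> real)" and K: "compact K" "\<And>y. y \<notin> K \<Longrightarrow> v y = 0"
    and \<phi>: "Csmooth UNIV \<phi>"
  shows "(conv v \<phi> has_derivative (\<lambda>h. h$1 * conv v (pd 1 \<phi>) x + h$2 * conv v (pd 2 \<phi>) x)) (at x)"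
proof -
  have cont: "continuous_on UNIV \<phi>" "continuous_on UNIV (pd i \<phi>)" for i
    using Csmooth_imp_continuous_on \<phi> Csmooth_pd by blast+
  note I = integrable_mult_translate[OF v K cont(1)] integrable_mult_translate[OF v K cont(2)]
  let ?D = "\<lambda>h. h$1 * conv v (pd 1 \<phi>) x + h$2 * conv v (pd 2 \<phi>) x"
  define B where "B = (LINT y|lborel. \<bar>v y\<bar>)"
  have B: "B \<ge> 0" by (simp add: B_def)
  show ?thesis
    unfolding has_derivative_at_alt
  proof (intro conjI allI impI)
    have "linear ?D" by (rule linearI) (simp_all add: algebra_simps)
    then show "bounded_linear ?D" by (simp add: linear_conv_bounded_linear)
    fix e :: real assume e: "e > 0"
    define e' where "e' = e / (B + 1)"
    have e': "e' > 0" using e B by (simp add: e'_def)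
    have "compact ((\<lambda>y. x - y) ` K)"
      by (intro compact_continuous_image K continuous_intros)
    then obtain d where d: "d > 0" "\<And>y h. y \<in> K \<Longrightarrow> norm h < d \<Longrightarrow>
        \<bar>\<phi> (x - y + h) - \<phi> (x - y) - (h$1 * pd 1 \<phi> (x - y) + h$2 * pd 2 \<phi> (x - y))\<bar> \<le> e' * norm h"
      using linearization_error_uniform[OF \<phi> _ e', of "(\<lambda>y. x - y) ` K"] by blast
    have "norm (conv v \<phi> y - conv v \<phi> x - ?D (y - x)) \<le> e * norm (y - x)" if y: "norm (y - x) < d" for y
    proof -
      define h where "h = y - x"
      have *: "conv v \<phi> y - conv v \<phi> x - ?D h = (LINT z|lborel. v z * \<phi> (y - z) - v z * \<phi> (x - z)
          - (h$1 * (v z * pd 1 \<phi> (x - z)) + h$2 * (v z * pd 2 \<phi> (x - z))))"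
        unfolding conv_def using I by simp
      have "norm (conv v \<phi> y - conv v \<phi> x - ?D h) \<le> (LINT z|lborel. (e' * norm h) * \<bar>v z\<bar>)"
        unfolding *
      proof (rule order_trans[OF integral_norm_bound integral_mono])
        show "integrable lborel (\<lambda>z. (e' * norm h) * \<bar>v z\<bar>)" using v by simp
        fix z
        have "v z * \<phi> (y - z) - v z * \<phi> (x - z)
          - (h$1 * (v z * pd 1 \<phi> (x - z)) + h$2 * (v z * pd 2 \<phi> (x - z)))
          = v z * (\<phi> (x - z + h) - \<phi> (x - z) - (h$1 * pd 1 \<phi> (x - z) + h$2 * pd 2 \<phi> (x - z)))"
          by (simp add: h_def algebra_simps)
        also have "norm \<dots> \<le> (e' * norm h) * \<bar>v z\<bar>"
        proof (cases "z \<in> K")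
          case True
          then show ?thesis
            using mult_left_mono[OF d(2)[of z h], of "\<bar>v z\<bar>"] y
            by (simp add: h_def abs_mult mult.commute)
        qed (use K(2) e' in simp)
        finally show "norm (v z * \<phi> (y - z) - v z * \<phi> (x - z)
          - (h$1 * (v z * pd 1 \<phi> (x - z)) + h$2 * (v z * pd 2 \<phi> (x - z)))) \<le> (e' * norm h) * \<bar>v z\<bar>" .
      next
        show "integrable lborel (\<lambda>z. norm (v z * \<phi> (y - z) - v z * \<phi> (x - z)
          - (h$1 * (v z * pd 1 \<phi> (x - z)) + h$2 * (v z * pd 2 \<phi> (x - z)))))"
          using I by (intro integrable_norm Bochner_Integration.integrable_diff
              Bochner_Integration.integrable_add integrable_mult_right)
      qed
      also have "\<dots> = e' * B * norm h" by (simp add: B_def)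
      also have "\<dots> \<le> e * norm h"
        using B e by (intro mult_right_mono) (auto simp: e'_def field_simps)
      finally show ?thesis by (simp add: h_def)
    qed
    then show "\<exists>d>0. \<forall>y. norm (y - x) < d \<longrightarrow> norm (conv v \<phi> y - conv v \<phi> x - ?D (y - x)) \<le> e * norm (y - x)"
      using d(1) by blast
  qed
qed

lemma pd_conv:
  assumes "integrable lborel (v :: real^2 \<Rightarrow> real)" "compact K" "\<And>y. y \<notin> K \<Longrightarrow> v y = 0" "Csmooth UNIV \<phi>"
  shows "pd i (conv v \<phi>) x = conv v (pd i \<phi>) x"
  using has_derivative_pd[OF conv_has_derivative[OF assms], of i x] exhaust_2[of i]
  by (auto simp: axis_def)

lemma Csmooth_conv:
  assumes "integrable lborel (v :: real^2 \<Rightarrow> real)" "compact K" "\<And>y. y \<notin> K \<Longrightarrow> v y = 0" "Csmooth UNIV \<phi>"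
  shows "Csmooth UNIV (conv v \<phi>)"
proof -
  have diff: "conv v \<phi> differentiable (at x)" if "Csmooth UNIV \<phi>" for \<phi> x
    using conv_has_derivative[OF assms(1-3) that] unfolding differentiable_def by blast
  have "Ck_on k UNIV (conv v \<phi>)" if "Csmooth UNIV \<phi>" for k
    using that
  proof (induction k arbitrary: \<phi>)
    case 0
    then show ?case
      using diff by (simp add: continuous_on_eq_continuous_at differentiable_imp_continuous_within)
  next
    case (Suc k)
    show ?case
    proof (rule Ck_on_SucI[OF open_UNIV])
      show "pd i (conv v \<phi>) p = conv v (pd i \<phi>) p" for i p
        using pd_conv[OF assms(1-3) Suc.prems] .
      show "Ck_on k UNIV (conv v (pd i \<phi>))" for i
        using Suc.IH Csmooth_pd[OF Suc.prems] by blast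
    qed (use diff[OF Suc.prems] in auto)
  qed
  then show ?thesis using assms(4) by (simp add: Csmooth_def)
qed

lemma conv_eq_0:
  assumes "\<And>y. y \<notin> K \<Longrightarrow> v y = 0" "\<And>p. p \<notin> ball 0 r \<Longrightarrow> \<phi> p = 0" "\<And>y. y \<in> K \<Longrightarrow> r \<le> dist x y"
  shows "conv v \<phi> x = 0"
proof -
  have "v y * \<phi> (x - y) = 0" for y
  proof (cases "y \<in> K")
    case True
    then have "x - y \<notin> ball 0 r" using assms(3)[OF True] by (simp add: dist_norm norm_minus_commute)
    then show ?thesis by (simp add: assms(2))
  qed (simp add: assms(1))
  then have "(\<lambda>y. v y * \<phi> (x - y)) = (\<lambda>_. 0)" by blast
  then show ?thesis unfolding conv_def by (simp only: Bochner_Integration.integral_zero)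
qed

section \<open>Convergence of mollifications in the mean\<close>

text \<open>The bound on the support is part of the predicate since it makes these functions integrable and keeps
  track of the growth of supports under convolution.\<close>

definition planar_L2 :: "real \<Rightarrow> (real^2 \<Rightarrow> real) \<Rightarrow> bool" where
  "planar_L2 R v \<longleftrightarrow> v \<in> borel_measurable borel \<and> integrable lborel (\<lambda>x. (v x)\<^sup>2)
     \<and> (\<forall>x. x \<notin> cball 0 R \<longrightarrow> v x = 0)"

lemma integrable_indicator_cball: "integrable lborel (indicator (cball (a::real^2) R) :: _ \<Rightarrow> real)"
  using emeasure_lborel_cball_finite[of a R] by (simp add: integrable_indicator_iff)

lemma planar_L2_integrable:
  assumes "planar_L2 R v"
  shows "integrable lborel v"
proof (rule Bochner_Integration.integrable_bound)
  show "integrable lborel (\<lambda>x. indicator (cball 0 R) x + (v x)\<^sup>2)"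
    using assms integrable_indicator_cball[of 0 R] by (auto simp: planar_L2_def)
  show "v \<in> borel_measurable lborel" using assms by (simp add: planar_L2_def)
  show "AE x in lborel. norm (v x) \<le> norm (indicator (cball 0 R) x + (v x)\<^sup>2)"
  proof (rule AE_I2)
    fix x
    have "\<bar>v x\<bar> \<le> 1 + (v x)\<^sup>2"
      using zero_le_power2[of "\<bar>v x\<bar> - 1"] zero_le_power2[of "v x"]
      by (simp add: power2_eq_square algebra_simps)
    then show "norm (v x) \<le> norm (indicator (cball 0 R) x + (v x)\<^sup>2)"
      using assms by (cases "x \<in> cball 0 R") (auto simp: planar_L2_def)
  qed
qed

lemma planar_L2_continuous:
  assumes "continuous_on UNIV v" "\<And>x. x \<notin> cball 0 R \<Longrightarrow> v x = 0"
  shows "planar_L2 R v"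
proof -
  have "integrable lborel (\<lambda>x. indicator (cball 0 R) x *\<^sub>R (v x)\<^sup>2)"
    by (rule borel_integrable_compact)
      (auto intro!: continuous_intros continuous_on_subset[OF assms(1)])
  moreover have "(\<lambda>x. indicator (cball 0 R) x *\<^sub>R (v x)\<^sup>2) = (\<lambda>x. (v x)\<^sup>2)"
    using assms(2) by (auto simp: indicator_def fun_eq_iff)
  ultimately have "integrable lborel (\<lambda>x. (v x)\<^sup>2)" by metis
  then show ?thesis
    using assms borel_measurable_continuous_onI by (auto simp: planar_L2_def)
qed

lemma planar_L2_diff:
  assumes "planar_L2 R v" "planar_L2 R w"
  shows "planar_L2 R (\<lambda>x. v x - w x)"
proof -
  have "integrable lborel (\<lambda>x. (v x - w x)\<^sup>2)"
  proof (rule Bochner_Integration.integrable_bound)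
    show "integrable lborel (\<lambda>x. 2 * (v x)\<^sup>2 + 2 * (w x)\<^sup>2)"
      using assms by (auto simp: planar_L2_def)
    show "(\<lambda>x. (v x - w x)\<^sup>2) \<in> borel_measurable lborel"
      using assms by (auto simp: planar_L2_def)
    show "AE x in lborel. norm ((v x - w x)\<^sup>2) \<le> norm (2 * (v x)\<^sup>2 + 2 * (w x)\<^sup>2)"
    proof (rule AE_I2)
      fix x
      have "(v x - w x)\<^sup>2 \<le> 2 * (v x)\<^sup>2 + 2 * (w x)\<^sup>2"
        using zero_le_power2[of "v x + w x"] by (simp add: power2_eq_square algebra_simps)
      then show "norm ((v x - w x)\<^sup>2) \<le> norm (2 * (v x)\<^sup>2 + 2 * (w x)\<^sup>2)" by simp
    qed
  qed
  then show ?thesis using assms by (auto simp: planar_L2_def)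
qed

lemma planar_L2_mono: "planar_L2 R v \<Longrightarrow> R \<le> R' \<Longrightarrow> planar_L2 R' v"
  by (auto simp: planar_L2_def)

lemma mollifier_integral:
  assumes "mollifier r \<phi>"
  shows "integrable lborel (\<lambda>y. \<phi> (x - y))" "(LINT y|lborel. \<phi> (x - y)) = 1"
    "(\<integral>\<^sup>+y. ennreal (\<phi> (y - x)) \<partial>lborel) = 1"
proof -
  have c: "continuous_on UNIV \<phi>" and nn: "\<And>p. 0 \<le> \<phi> p" and 1: "(\<integral>\<^sup>+p. ennreal (\<phi> p) \<partial>lborel) = 1"
    using assms Csmooth_imp_continuous_on by (auto simp: mollifier_def)
  have [measurable]: "\<phi> \<in> borel_measurable borel" by (rule borel_measurable_continuous_onI[OF c])
  have *: "(\<integral>\<^sup>+y. ennreal (\<phi> (x - y)) \<partial>lborel) = 1"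
    using nn_integral_reflect[of "\<lambda>y. ennreal (\<phi> y)" x] 1 by simp
  then show "integrable lborel (\<lambda>y. \<phi> (x - y))"
    by (intro integrableI_bounded) (auto simp: nn)
  show "(LINT y|lborel. \<phi> (x - y)) = 1"
    using integral_eq_nn_integral[of "\<lambda>y. \<phi> (x - y)" lborel] * by (simp add: nn)
  have "(\<integral>\<^sup>+y. ennreal (\<phi> (y - x)) \<partial>lborel) = (\<integral>\<^sup>+y. ennreal (\<phi> ((x - y) - x)) \<partial>lborel)"
    by (rule nn_integral_reflect[of "\<lambda>y. ennreal (\<phi> (y - x))" x, symmetric]) measurable
  also have "\<dots> = (\<integral>\<^sup>+y. ennreal (\<phi> (0 - y)) \<partial>lborel)" by simp
  also have "\<dots> = 1"
    using nn_integral_reflect[of "\<lambda>y. ennreal (\<phi> y)" 0] 1 by simp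
  finally show "(\<integral>\<^sup>+y. ennreal (\<phi> (y - x)) \<partial>lborel) = 1" .
qed

lemma planar_L2_conv:
  assumes "planar_L2 R v" "mollifier r \<phi>"
  shows "planar_L2 (R + r) (conv v \<phi>)"
proof (rule planar_L2_continuous)
  have s: "Csmooth UNIV \<phi>" using assms(2) by (simp add: mollifier_def)
  have v: "integrable lborel v" "\<And>y. y \<notin> cball 0 R \<Longrightarrow> v y = 0"
    using planar_L2_integrable[OF assms(1)] assms(1) by (auto simp: planar_L2_def)
  show "continuous_on UNIV (conv v \<phi>)"
    by (rule Csmooth_imp_continuous_on[OF Csmooth_conv[OF v(1) compact_cball v(2) s]])
  fix x :: "real^2" assume x: "x \<notin> cball 0 (R + r)"
  show "conv v \<phi> x = 0"
  proof (rule conv_eq_0[of "cball 0 R" v r])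
    fix y assume "y \<in> cball (0::real^2) R"
    then show "r \<le> dist x y"
      using x dist_triangle[of 0 x y] by (simp add: dist_commute)
  qed (use v assms(2) in \<open>auto simp: mollifier_def\<close>)
qed

text \<open>The kernel is a probability density around \<open>x\<close>, so pointwise the square of the mean is at most the mean
  of the square (the variance is nonnegative). Integration in \<open>x\<close> and exchange of the integrals remove the
  kernel.\<close>

lemma conv_square_le:
  assumes v: "planar_L2 R v" and \<phi>: "mollifier r \<phi>"
  shows "(LINT x|lborel. (conv v \<phi> x)\<^sup>2) \<le> (LINT x|lborel. (v x)\<^sup>2)"
proof -
  have c: "continuous_on UNIV \<phi>" and nn: "\<And>p. 0 \<le> \<phi> p"
    using \<phi> Csmooth_imp_continuous_on by (auto simp: mollifier_def)
  have [measurable]: "\<phi> \<in> borel_measurable borel" by (rule borel_measurable_continuous_onI[OF c])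
  have [measurable]: "v \<in> borel_measurable borel" using v by (simp add: planar_L2_def)
  have v2: "integrable lborel (\<lambda>x. (v x)\<^sup>2)" and v0: "\<And>y. y \<notin> cball 0 R \<Longrightarrow> v y = 0"
    using v by (auto simp: planar_L2_def)
  have jensen: "(conv v \<phi> x)\<^sup>2 \<le> (LINT y|lborel. (v y)\<^sup>2 * \<phi> (x - y))" for x
  proof -
    define m where "m = conv v \<phi> x"
    have I: "integrable lborel (\<lambda>y. v y * \<phi> (x - y))" "integrable lborel (\<lambda>y. (v y)\<^sup>2 * \<phi> (x - y))"
      by (rule integrable_mult_translate[OF planar_L2_integrable[OF v] compact_cball[of 0 R] v0 c], assumption)
        (rule integrable_mult_translate[OF v2 compact_cball[of 0 R] _ c], simp add: v0)
    have "0 \<le> (LINT y|lborel. (v y - m)\<^sup>2 * \<phi> (x - y))" by (simp add: nn)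
    also have "\<dots> = (LINT y|lborel. (v y)\<^sup>2 * \<phi> (x - y) - 2 * m * (v y * \<phi> (x - y)) + m\<^sup>2 * \<phi> (x - y))"
      by (rule Bochner_Integration.integral_cong) (auto simp: power2_eq_square algebra_simps)
    also have "\<dots> = (LINT y|lborel. (v y)\<^sup>2 * \<phi> (x - y)) - 2 * m * m + m\<^sup>2"
      using I mollifier_integral[OF \<phi>, of x] by (simp add: m_def conv_def)
    finally show ?thesis by (simp add: m_def power2_eq_square)
  qed
  have "(LINT x|lborel. (conv v \<phi> x)\<^sup>2) = enn2real (\<integral>\<^sup>+x. ennreal ((conv v \<phi> x)\<^sup>2) \<partial>lborel)"
    by (rule integral_eq_nn_integral) (use planar_L2_conv[OF v \<phi>] in \<open>auto simp: planar_L2_def\<close>)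
  also have "\<dots> \<le> enn2real (\<integral>\<^sup>+y. ennreal ((v y)\<^sup>2) \<partial>lborel)"
  proof (rule enn2real_mono)
    have "(\<integral>\<^sup>+x. ennreal ((conv v \<phi> x)\<^sup>2) \<partial>lborel)
        \<le> (\<integral>\<^sup>+x. (\<integral>\<^sup>+y. ennreal ((v y)\<^sup>2 * \<phi> (x - y)) \<partial>lborel) \<partial>lborel)"
    proof (rule nn_integral_mono)
      fix x
      have "integrable lborel (\<lambda>y. (v y)\<^sup>2 * \<phi> (x - y))"
        by (rule integrable_mult_translate[OF v2 compact_cball[of 0 R] _ c]) (simp add: v0)
      then have "(\<integral>\<^sup>+y. ennreal ((v y)\<^sup>2 * \<phi> (x - y)) \<partial>lborel) = ennreal (LINT y|lborel. (v y)\<^sup>2 * \<phi> (x - y))"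
        by (rule nn_integral_eq_integral) (simp add: nn)
      then show "ennreal ((conv v \<phi> x)\<^sup>2) \<le> (\<integral>\<^sup>+y. ennreal ((v y)\<^sup>2 * \<phi> (x - y)) \<partial>lborel)"
        using ennreal_leI[OF jensen] by simp
    qed
    also have "\<dots> = (\<integral>\<^sup>+y. (\<integral>\<^sup>+x. ennreal ((v y)\<^sup>2 * \<phi> (x - y)) \<partial>lborel) \<partial>lborel)"
      by (rule lborel_pair.Fubini'[symmetric]) measurable
    also have "\<dots> = (\<integral>\<^sup>+y. ennreal ((v y)\<^sup>2) * (\<integral>\<^sup>+x. ennreal (\<phi> (x - y)) \<partial>lborel) \<partial>lborel)"
      by (subst nn_integral_cmult[symmetric]) (auto simp: ennreal_mult nn)
    also have "\<dots> = (\<integral>\<^sup>+y. ennreal ((v y)\<^sup>2) \<partial>lborel)"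
      using mollifier_integral(3)[OF \<phi>] by simp
    finally show "(\<integral>\<^sup>+x. ennreal ((conv v \<phi> x)\<^sup>2) \<partial>lborel) \<le> (\<integral>\<^sup>+y. ennreal ((v y)\<^sup>2) \<partial>lborel)" .
    show "(\<integral>\<^sup>+y. ennreal ((v y)\<^sup>2) \<partial>lborel) < top"
      using v2 by (simp add: nn_integral_eq_integral)
  qed
  also have "\<dots> = (LINT x|lborel. (v x)\<^sup>2)"
    by (rule integral_eq_nn_integral[symmetric]) auto
  finally show ?thesis .
qed

text \<open>A continuous function of compact support is uniformly continuous, so the convergence is uniform on a
  fixed bounded set.\<close>

lemma conv_continuous_tendsto:
  assumes g: "continuous_on UNIV g" "\<And>x. x \<notin> cball 0 R \<Longrightarrow> g x = 0" and e: "e > 0"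
  shows "\<exists>d>0. \<forall>r \<phi>. r \<le> d \<and> mollifier r \<phi> \<longrightarrow> (LINT x|lborel. (g x - conv g \<phi> x)\<^sup>2) \<le> e"
proof -
  \<comment> \<open>Both functions vanish outside the ball of radius \<open>R + 1\<close>, and the kernel has radius at
    most one.\<close>
  let ?K = "cball (0::real^2) (R + 3)"
  define C where "C = measure lborel ?K + 1"
  have C: "C > 0" by (simp add: C_def add_nonneg_pos)
  have "uniformly_continuous_on ?K g"
    by (rule compact_uniformly_continuous[OF continuous_on_subset[OF g(1)]]) auto
  moreover have "0 < sqrt (e / C)" using C e by simp
  ultimately have "\<exists>d>0. \<forall>x\<in>?K. \<forall>y\<in>?K. dist y x < d \<longrightarrow> dist (g y) (g x) < sqrt (e / C)"
    unfolding uniformly_continuous_on_def by blast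
  then obtain d where d: "d > 0" "\<And>x y. x \<in> ?K \<Longrightarrow> y \<in> ?K \<Longrightarrow> dist y x < d \<Longrightarrow> dist (g y) (g x) < sqrt (e / C)"
    by blast
  have L: "planar_L2 R g" by (rule planar_L2_continuous[OF g])
  have "(LINT x|lborel. (g x - conv g \<phi> x)\<^sup>2) \<le> e" if r: "r \<le> min 1 d" and \<phi>: "mollifier r \<phi>" for r \<phi>
  proof -
    have c: "continuous_on UNIV \<phi>" and nn: "\<And>p. 0 \<le> \<phi> p" and \<phi>0: "\<And>p. p \<notin> ball 0 r \<Longrightarrow> \<phi> p = 0"
      using \<phi> Csmooth_imp_continuous_on by (auto simp: mollifier_def)
    have L': "planar_L2 (R + 1) (conv g \<phi>)" "planar_L2 (R + 1) g"
      using planar_L2_mono[OF planar_L2_conv[OF L \<phi>]] planar_L2_mono[OF L] r by auto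
    have Ld: "planar_L2 (R + 1) (\<lambda>x. g x - conv g \<phi> x)" by (rule planar_L2_diff[OF L'(2,1)])
    have bound: "(g x - conv g \<phi> x)\<^sup>2 \<le> (e / C) * indicator ?K x" for x
    proof (cases "x \<in> cball 0 (R + 1)")
      case False
      then have "g x - conv g \<phi> x = 0" using Ld unfolding planar_L2_def by blast
      then show ?thesis using e C by simp
    next
      case True
      have I: "integrable lborel (\<lambda>y. g y * \<phi> (x - y))"
        by (rule integrable_mult_translate[OF planar_L2_integrable[OF L] compact_cball g(2) c])
      have "g x - conv g \<phi> x = (LINT y|lborel. g x * \<phi> (x - y) - g y * \<phi> (x - y))"
        using I mollifier_integral[OF \<phi>, of x] by (simp add: conv_def)
      also have "\<bar>\<dots>\<bar> \<le> (LINT y|lborel. sqrt (e / C) * \<phi> (x - y))"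
      proof (rule integral_abs_bound_integral)
        show "integrable lborel (\<lambda>y. g x * \<phi> (x - y) - g y * \<phi> (x - y))"
          "integrable lborel (\<lambda>y. sqrt (e / C) * \<phi> (x - y))"
          using I mollifier_integral[OF \<phi>, of x] by auto
        fix y
        have "\<bar>g x - g y\<bar> * \<phi> (x - y) \<le> sqrt (e / C) * \<phi> (x - y)"
        proof (cases "x - y \<in> ball 0 r")
          case in_ball: True
          then have "dist x y < r" by (simp add: dist_norm norm_minus_commute)
          moreover have "y \<in> ?K" "x \<in> ?K"
            using True r \<open>dist x y < r\<close> dist_triangle[of 0 y x] by auto
          ultimately have "dist (g x) (g y) < sqrt (e / C)" using d(2)[of y x] r by auto
          then show ?thesis by (intro mult_right_mono nn) (simp add: dist_real_def)
        qed (simp add: \<phi>0)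
        then show "\<bar>g x * \<phi> (x - y) - g y * \<phi> (x - y)\<bar> \<le> sqrt (e / C) * \<phi> (x - y)"
          by (simp add: left_diff_distrib[symmetric] abs_mult nn)
      qed
      also have "\<dots> = sqrt (e / C)" using mollifier_integral[OF \<phi>, of x] by simp
      finally have "(g x - conv g \<phi> x)\<^sup>2 \<le> (sqrt (e / C))\<^sup>2"
        by (metis abs_ge_zero power2_abs power_mono)
      then show ?thesis using True e C by simp
    qed
    have "(LINT x|lborel. (g x - conv g \<phi> x)\<^sup>2) \<le> (LINT x|lborel. (e / C) * indicator ?K x)"
    proof (rule integral_mono[OF _ _ bound])
      show "integrable lborel (\<lambda>x. (g x - conv g \<phi> x)\<^sup>2)" using Ld by (simp add: planar_L2_def)
      show "integrable lborel (\<lambda>x. (e / C) * indicator ?K x)"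
        by (intro integrable_mult_right integrable_indicator_cball)
    qed
    also have "\<dots> = (e / C) * measure lborel ?K" by simp
    also have "\<dots> \<le> (e / C) * C" using e C by (intro mult_left_mono) (auto simp: C_def)
    also have "\<dots> = e" using C by simp
    finally show ?thesis .
  qed
  then show ?thesis using d(1) by (intro exI[of _ "min 1 d"]) auto
qed

lemma square_add3_le: "(a + b + c)\<^sup>2 \<le> 3 * a\<^sup>2 + 3 * b\<^sup>2 + 3 * (c::real)\<^sup>2"
proof -
  have "0 \<le> (a - b)\<^sup>2 + (b - c)\<^sup>2 + (a - c)\<^sup>2" by simp
  then show ?thesis by (simp add: power2_eq_square algebra_simps)
qed

lemma square_add_le: "(a + b)\<^sup>2 \<le> 2 * a\<^sup>2 + 2 * (b::real)\<^sup>2"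
  using zero_le_power2[of "a - b"] by (simp add: power2_eq_square algebra_simps)

lemma AE_lborel_if_negligible:
  assumes "negligible N" "\<And>x. x \<notin> N \<Longrightarrow> P x"
  shows "AE x in lborel. P x"
proof -
  have "AE x in lebesgue. x \<notin> N"
    using assms(1) by (intro AE_not_in) (simp add: negligible_iff_null_sets)
  then have "AE x in lebesgue. P x" by (rule eventually_mono) (rule assms(2))
  then show ?thesis by (simp add: AE_completion_iff)
qed

text \<open>A measurable function is a limit almost everywhere of continuous functions. Truncation in height
  and a cutoff in space provide dominating functions.\<close>

lemma planar_L2_approx_continuous:
  assumes v: "planar_L2 R v" and e: "e > 0"
  shows "\<exists>g. continuous_on UNIV g \<and> (\<forall>x. x \<notin> cball 0 (R + 1) \<longrightarrow> g x = 0)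
    \<and> (LINT x|lborel. (v x - g x)\<^sup>2) \<le> e"
proof -
  have [measurable]: "v \<in> borel_measurable borel" and v2: "integrable lborel (\<lambda>x. (v x)\<^sup>2)"
    and v0: "\<And>x. x \<notin> cball 0 R \<Longrightarrow> v x = 0"
    using v by (auto simp: planar_L2_def)
  define cl where "cl M t = max (- M) (min M t)" for M t :: real
  have cl: "\<bar>cl M t\<bar> \<le> M" "\<bar>t - cl M t\<bar> \<le> \<bar>t\<bar>" "cl M 0 = 0" "\<bar>t\<bar> \<le> M \<Longrightarrow> cl M t = t"
    if "M \<ge> 0" for M t
    using that by (auto simp: cl_def max_def min_def)
  have [measurable]: "cl M \<in> borel_measurable borel" for M
    unfolding cl_def[abs_def] by measurable
  \<comment> \<open>Truncation at a large height changes little in the mean.\<close>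
  have "(\<lambda>k. LINT x|lborel. (v x - cl (real k) (v x))\<^sup>2) \<longlonglongrightarrow> (LINT x|(lborel :: (real^2) measure). (0::real))"
  proof (rule integral_dominated_convergence[where w="\<lambda>x. (v x)\<^sup>2"
        and f="\<lambda>_. 0" and s="\<lambda>k x. (v x - cl (real k) (v x))\<^sup>2"])
    show "AE x in lborel. (\<lambda>k. (v x - cl (real k) (v x))\<^sup>2) \<longlonglongrightarrow> 0"
    proof (rule AE_I2)
      fix x
      obtain n :: nat where n: "\<bar>v x\<bar> \<le> real n" using real_arch_simple by blast
      show "(\<lambda>k. (v x - cl (real k) (v x))\<^sup>2) \<longlonglongrightarrow> 0"
        by (rule tendsto_eventually, rule eventually_sequentiallyI[of n]) (use n cl(4) in auto)
    qed
    show "AE x in lborel. norm ((v x - cl (real k) (v x))\<^sup>2) \<le> (v x)\<^sup>2" for k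
      using cl(2)[of "real k"] by (auto simp: abs_le_square_iff)
  qed (use v2 in measurable)
  then have "\<forall>\<^sub>F k in sequentially. (LINT x|lborel. (v x - cl (real k) (v x))\<^sup>2) < e / 4"
    using e by (intro order_tendstoD) auto
  then obtain k where k: "(LINT x|lborel. (v x - cl (real k) (v x))\<^sup>2) < e / 4"
    using eventually_happens'[OF sequentially_bot] by blast
  \<comment> \<open>The continuous approximants are truncated at the same height, and cut off outside the ball
    of radius \<open>R + 1\<close>.\<close>
  have "v \<in> borel_measurable lebesgue" by (rule measurable_completion) simp
  then have "v measurable_on UNIV"
    by (intro lebesgue_measurable_imp_measurable_on) auto
  then obtain N h where h: "negligible N" "\<And>n. continuous_on UNIV (h n)"
    "\<And>x. x \<notin> N \<Longrightarrow> (\<lambda>n. h n x) \<longlonglongrightarrow> v x"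
    unfolding measurable_on_def by auto
  define ct where "ct x = max 0 (min 1 (R + 1 - norm x))" for x :: "real^2"
  define g where "g n x = ct x * cl (real k) (h n x)" for n x
  have ct: "0 \<le> ct x" "ct x \<le> 1" "x \<in> cball 0 R \<Longrightarrow> ct x = 1" "x \<notin> cball 0 (R + 1) \<Longrightarrow> ct x = 0" for x
    by (auto simp: ct_def)
  have gc: "continuous_on UNIV (g n)" for n
    unfolding g_def cl_def ct_def by (intro continuous_intros h(2))
  have g0: "g n x = 0" if "x \<notin> cball 0 (R + 1)" for n x using ct(4)[OF that] by (simp add: g_def)
  have Lg: "planar_L2 (R + 1) (g n)" for n by (rule planar_L2_continuous[OF gc g0])
  have [measurable]: "g n \<in> borel_measurable borel" for n by (rule borel_measurable_continuous_onI[OF gc])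
  have "(\<lambda>n. LINT x|lborel. (cl (real k) (v x) - g n x)\<^sup>2) \<longlonglongrightarrow> (LINT x|(lborel :: (real^2) measure). (0::real))"
  proof (rule integral_dominated_convergence[where w="\<lambda>x. (2 * real k)\<^sup>2 * indicator (cball 0 (R + 1)) x"
        and f="\<lambda>_. 0" and s="\<lambda>n x. (cl (real k) (v x) - g n x)\<^sup>2"])
    show "AE x in lborel. (\<lambda>n. (cl (real k) (v x) - g n x)\<^sup>2) \<longlonglongrightarrow> 0"
    proof (rule AE_lborel_if_negligible[OF h(1)])
      fix x assume "x \<notin> N"
      have "(\<lambda>n. (cl (real k) (v x) - ct x * cl (real k) (h n x))\<^sup>2)
          \<longlonglongrightarrow> (cl (real k) (v x) - ct x * cl (real k) (v x))\<^sup>2"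
        unfolding cl_def by (intro tendsto_intros h(3) \<open>x \<notin> N\<close>)
      moreover have "cl (real k) (v x) - ct x * cl (real k) (v x) = 0"
        using ct(3)[of x] v0[of x] cl(3)[of "real k"] by (cases "x \<in> cball 0 R") auto
      ultimately show "(\<lambda>n. (cl (real k) (v x) - g n x)\<^sup>2) \<longlonglongrightarrow> 0" by (simp add: g_def)
    qed
    show "AE x in lborel. norm ((cl (real k) (v x) - g n x)\<^sup>2)
        \<le> (2 * real k)\<^sup>2 * indicator (cball 0 (R + 1)) x" for n
    proof (rule AE_I2)
      fix x
      show "norm ((cl (real k) (v x) - g n x)\<^sup>2) \<le> (2 * real k)\<^sup>2 * indicator (cball 0 (R + 1)) x"
      proof (cases "x \<in> cball 0 (R + 1)")
        case False
        then have "v x = 0" using v0[of x] by auto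
        then show ?thesis using g0[OF False] cl(3)[of "real k"] by simp
      next
        case True
        have "\<bar>g n x\<bar> \<le> 1 * real k"
          unfolding g_def abs_mult using ct[of x] cl(1)[of "real k"] by (intro mult_mono) auto
        then have "\<bar>cl (real k) (v x) - g n x\<bar> \<le> \<bar>2 * real k\<bar>"
          using cl(1)[of "real k" "v x"] by linarith
        then have "(cl (real k) (v x) - g n x)\<^sup>2 \<le> (2 * real k)\<^sup>2"
          by (rule abs_le_square_iff[THEN iffD1])
        then show ?thesis using True by simp
      qed
    qed
    show "integrable lborel (\<lambda>x. (2 * real k)\<^sup>2 * indicator (cball (0::real^2) (R + 1)) x)"
      by (intro integrable_mult_right integrable_indicator_cball)
  qed measurable
  then have "\<forall>\<^sub>F n in sequentially. (LINT x|lborel. (cl (real k) (v x) - g n x)\<^sup>2) < e / 4"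
    using e by (intro order_tendstoD) auto
  then obtain n where n: "(LINT x|lborel. (cl (real k) (v x) - g n x)\<^sup>2) < e / 4"
    using eventually_happens'[OF sequentially_bot] by blast
  have Lcl: "planar_L2 R (\<lambda>x. cl (real k) (v x))"
  proof -
    have "integrable lborel (\<lambda>x. (cl (real k) (v x))\<^sup>2)"
    proof (rule Bochner_Integration.integrable_bound[OF v2])
      have "\<bar>cl (real k) t\<bar> \<le> \<bar>t\<bar>" for t by (auto simp: cl_def)
      then show "AE x in lborel. norm ((cl (real k) (v x))\<^sup>2) \<le> norm ((v x)\<^sup>2)"
        by (auto simp: abs_le_square_iff)
    qed measurable
    then show ?thesis using v0 cl(3)[of "real k"] by (auto simp: planar_L2_def)
  qed
  have I: "integrable lborel (\<lambda>x. (v x - cl (real k) (v x))\<^sup>2)"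
    "integrable lborel (\<lambda>x. (cl (real k) (v x) - g n x)\<^sup>2)"
    "integrable lborel (\<lambda>x. (v x - g n x)\<^sup>2)"
    using planar_L2_diff[OF v Lcl] planar_L2_diff[OF planar_L2_mono[OF Lcl] Lg, of n]
      planar_L2_diff[OF planar_L2_mono[OF v] Lg, of n]
    by (auto simp: planar_L2_def)
  have "(LINT x|lborel. (v x - g n x)\<^sup>2)
      \<le> (LINT x|lborel. 2 * (v x - cl (real k) (v x))\<^sup>2 + 2 * (cl (real k) (v x) - g n x)\<^sup>2)"
  proof (rule integral_mono)
    fix x show "(v x - g n x)\<^sup>2 \<le> 2 * (v x - cl (real k) (v x))\<^sup>2 + 2 * (cl (real k) (v x) - g n x)\<^sup>2"
      using square_add_le[of "v x - cl (real k) (v x)" "cl (real k) (v x) - g n x"] by simp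
  qed (use I in auto)
  also have "\<dots> = 2 * (LINT x|lborel. (v x - cl (real k) (v x))\<^sup>2)
      + 2 * (LINT x|lborel. (cl (real k) (v x) - g n x)\<^sup>2)"
    using I by simp
  also have "\<dots> \<le> e" using k n by simp
  finally show ?thesis using gc g0 by blast
qed

text \<open>Density of the continuous functions, together with the contraction property: with
  \<open>g\<close> continuous and close to \<open>v\<close>, the three terms \<open>v - g\<close>, \<open>g - g * \<phi>\<close> and \<open>(v - g) * \<phi>\<close> are all small.\<close>

lemma conv_tendsto_L2:
  assumes v: "planar_L2 R v" and e: "e > 0"
  shows "\<exists>d>0. \<forall>r \<phi>. r \<le> d \<and> mollifier r \<phi> \<longrightarrow> (LINT x|lborel. (v x - conv v \<phi> x)\<^sup>2) \<le> e"
proof -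
  have "e / 9 > 0" using e by simp
  then obtain g where g: "continuous_on UNIV g" "\<And>x. x \<notin> cball 0 (R + 1) \<Longrightarrow> g x = 0"
    "(LINT x|lborel. (v x - g x)\<^sup>2) \<le> e / 9"
    using planar_L2_approx_continuous[OF v] by blast
  obtain d where d: "d > 0" "\<And>r \<phi>. r \<le> d \<Longrightarrow> mollifier r \<phi> \<Longrightarrow>
      (LINT x|lborel. (g x - conv g \<phi> x)\<^sup>2) \<le> e / 9"
    using conv_continuous_tendsto[OF g(1,2) \<open>e / 9 > 0\<close>] by blast
  have "(LINT x|lborel. (v x - conv v \<phi> x)\<^sup>2) \<le> e" if r: "r \<le> min 1 d" and \<phi>: "mollifier r \<phi>" for r \<phi>
  proof -
    have c: "continuous_on UNIV \<phi>" using \<phi> Csmooth_imp_continuous_on by (auto simp: mollifier_def)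
    have Lg: "planar_L2 (R + 1) g" by (rule planar_L2_continuous[OF g(1,2)])
    have Lv: "planar_L2 (R + 1) v" by (rule planar_L2_mono[OF v]) simp
    note Lw = planar_L2_diff[OF Lv Lg]
    have vg: "v x - conv v \<phi> x = (v x - g x) + (g x - conv g \<phi> x) + - conv (\<lambda>x. v x - g x) \<phi> x" for x
    proof -
      have "integrable lborel (\<lambda>y. w y * \<phi> (x - y))" if "planar_L2 (R + 1) w" for w
        using integrable_mult_translate[OF planar_L2_integrable[OF that] compact_cball[of 0 "R + 1"] _ c] that
        by (auto simp: planar_L2_def)
      then have "conv (\<lambda>x. v x - g x) \<phi> x = conv v \<phi> x - conv g \<phi> x"
        using Lg Lv by (simp add: conv_def left_diff_distrib)
      then show ?thesis by simp
    qed
    have mono: "planar_L2 (R + 2) w" if "planar_L2 (R + 1) w" for w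
      using planar_L2_mono[OF that] by simp
    have cv: "planar_L2 (R + 2) (conv w \<phi>)" if "planar_L2 (R + 1) w" for w
      using planar_L2_mono[OF planar_L2_conv[OF that \<phi>], of "R + 2"] r by simp
    have I: "integrable lborel (\<lambda>x. (v x - g x)\<^sup>2)" "integrable lborel (\<lambda>x. (g x - conv g \<phi> x)\<^sup>2)"
      "integrable lborel (\<lambda>x. (conv (\<lambda>x. v x - g x) \<phi> x)\<^sup>2)" "integrable lborel (\<lambda>x. (v x - conv v \<phi> x)\<^sup>2)"
      using Lw planar_L2_diff[OF mono[OF Lg] cv[OF Lg]] cv[OF Lw] planar_L2_diff[OF mono[OF Lv] cv[OF Lv]]
      by (auto simp: planar_L2_def)
    have "(LINT x|lborel. (v x - conv v \<phi> x)\<^sup>2) \<le> (LINT x|lborel. 3 * (v x - g x)\<^sup>2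
        + 3 * (g x - conv g \<phi> x)\<^sup>2 + 3 * (conv (\<lambda>x. v x - g x) \<phi> x)\<^sup>2)"
    proof (rule integral_mono)
      fix x
      show "(v x - conv v \<phi> x)\<^sup>2 \<le> 3 * (v x - g x)\<^sup>2
        + 3 * (g x - conv g \<phi> x)\<^sup>2 + 3 * (conv (\<lambda>x. v x - g x) \<phi> x)\<^sup>2"
        using square_add3_le[of "v x - g x" "g x - conv g \<phi> x" "- conv (\<lambda>x. v x - g x) \<phi> x"]
        unfolding vg[of x] by simp
    qed (use I in auto)
    also have "\<dots> = 3 * (LINT x|lborel. (v x - g x)\<^sup>2) + 3 * (LINT x|lborel. (g x - conv g \<phi> x)\<^sup>2)
        + 3 * (LINT x|lborel. (conv (\<lambda>x. v x - g x) \<phi> x)\<^sup>2)"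
      using I by simp
    also have "\<dots> \<le> e"
      using g(3) d(2)[of r \<phi>] r \<phi> conv_square_le[OF Lw \<phi>] by simp
    finally show ?thesis .
  qed
  then show ?thesis using d(1) by (intro exI[of _ "min 1 d"]) auto
qed

text \<open>The reflected and translated kernel \<open>\<lambda>y. \<phi> (x - y)\<close> is itself a test function for the weak derivative of
  \<open>u\<close>, and its derivative in \<open>y\<close> is minus that of \<open>\<phi>\<close>.\<close>

lemma pd_conv_weak:
  assumes u: "planar_L2 R u"
    and weak: "\<And>\<psi>. Csmooth UNIV \<psi> \<Longrightarrow> (LINT p|lborel. u p * pd i \<psi> p) = - (LINT p|lborel. G p * \<psi> p)"
    and \<phi>: "Csmooth UNIV \<phi>"
  shows "pd i (conv u \<phi>) x = conv G \<phi> x"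
proof -
  have T: "Csmooth UNIV (\<lambda>y::real^2. x + (- y))"
    by (intro Csmooth_add open_UNIV Csmooth_const Csmooth_linear bounded_linear_minus bounded_linear_ident)
  have dT: "((\<lambda>y::real^2. x - y) has_derivative (\<lambda>h. - h)) (at y)" for y
    by (auto intro!: derivative_eq_intros)
  have \<psi>: "Csmooth UNIV (\<lambda>y. \<phi> (x - y))"
    using Csmooth_compose[OF open_UNIV open_UNIV T \<phi>] by simp
  have p: "pd i (\<lambda>y. \<phi> (x - y)) y = - pd i \<phi> (x - y)" for y
  proof -
    have "pd i (\<lambda>y. x - y) y = - axis i 1" using has_derivative_pd[OF dT] by simp
    moreover have "(\<lambda>y. x - y) differentiable (at y)" using dT unfolding differentiable_def by blast
    ultimately show ?thesis
      using pd_compose(2)[of "\<lambda>y. x - y" y \<phi> i] Csmooth_imp_differentiable[OF open_UNIV \<phi>, of "x - y"]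
        exhaust_2[of i]
      by (auto simp: axis_def)
  qed
  have "pd i (conv u \<phi>) x = conv u (pd i \<phi>) x"
    by (rule pd_conv[OF planar_L2_integrable[OF u] compact_cball _ \<phi>, of 0 R]) (use u in \<open>auto simp: planar_L2_def\<close>)
  also have "\<dots> = - (LINT y|lborel. u y * pd i (\<lambda>y. \<phi> (x - y)) y)" by (simp add: p conv_def)
  also have "\<dots> = conv G \<phi> x" by (simp add: weak[OF \<psi>] conv_def)
  finally show ?thesis .
qed

section \<open>Linear algebra of the metric\<close>

lemma matrix_vector_2: "(B *v w) $ i = B$i$1 * w$1 + B$i$2 * (w$2 :: real)"
  for B :: "real^2^2"
  by (simp add: matrix_vector_mult_def sum_2)

lemma inner_2: "v \<bullet> w = v$1 * w$1 + v$2 * w$2" for v w :: "real^2"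
  by (simp add: inner_vec_def sum_2)

lemma posdef_2:
  fixes B :: "real^2^2"
  assumes "transpose B = B" "\<And>v. v \<noteq> 0 \<Longrightarrow> 0 < v \<bullet> (B *v v)"
  shows "B$2$1 = B$1$2" "0 < B$1$1" "0 < B$2$2" "0 < det B"
proof -
  show s: "B$2$1 = B$1$2"
    using arg_cong[OF assms(1), of "\<lambda>M. M $ 1 $ 2"] by (simp add: transpose_def)
  have v: "0 < B$1$1 * a\<^sup>2 + 2 * B$1$2 * a * b + B$2$2 * b\<^sup>2" if "a \<noteq> 0 \<or> b \<noteq> 0" for a b
  proof -
    have "vector [a, b] \<noteq> (0 :: real^2)"
      using that by (metis vector_2 zero_index)
    from assms(2)[OF this] show ?thesis
      by (simp add: inner_2 matrix_vector_2 vector_2 s power2_eq_square algebra_simps)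
  qed
  show p: "0 < B$1$1" using v[of 1 0] by simp
  show "0 < B$2$2" using v[of 0 1] by simp
  have "0 < B$1$1 * (B$1$1 * B$2$2 - B$1$2 * B$1$2)"
    using v[of "- B$1$2" "B$1$1"] p by (simp add: power2_eq_square algebra_simps)
  then show "0 < det B"
    using p by (simp add: det_2 s zero_less_mult_iff)
qed

lemma matrix_inv_2:
  fixes B :: "real^2^2"
  assumes "det B \<noteq> 0"
  shows "matrix_inv B ** B = mat 1" "B ** matrix_inv B = mat 1"
    "matrix_inv B $ 1 $ 1 = B$2$2 / det B" "matrix_inv B $ 1 $ 2 = - B$1$2 / det B"
    "matrix_inv B $ 2 $ 1 = - B$2$1 / det B" "matrix_inv B $ 2 $ 2 = B$1$1 / det B"
proof -
  define k where "k = inverse (det B)"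
  have k: "B$1$1 * B$2$2 * k - B$1$2 * B$2$1 * k = 1"
    using assms by (simp add: k_def det_2 left_diff_distrib[symmetric])
  define C :: "real^2^2" where "C = vector [vector [B$2$2 * k, - B$1$2 * k],
    vector [- B$2$1 * k, B$1$1 * k]]"
  have C: "B ** C = mat 1" "C ** B = mat 1"
    using k unfolding C_def
    by (simp_all add: vec_eq_iff forall_2 matrix_matrix_mult_def sum_2 mat_def vector_2 algebra_simps)
  have I: "B ** matrix_inv B = mat 1 \<and> matrix_inv B ** B = mat 1"
    unfolding matrix_inv_def by (rule someI[of _ C]) (use C in simp)
  then show "matrix_inv B ** B = mat 1" "B ** matrix_inv B = mat 1" by auto
  have "matrix_inv B = matrix_inv B ** (B ** C)" by (simp add: C)
  also have "\<dots> = C" by (metis I matrix_mul_assoc matrix_mul_lid)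
  finally have "matrix_inv B = C" .
  then show "matrix_inv B $ 1 $ 1 = B$2$2 / det B" "matrix_inv B $ 1 $ 2 = - B$1$2 / det B"
    "matrix_inv B $ 2 $ 1 = - B$2$1 / det B" "matrix_inv B $ 2 $ 2 = B$1$1 / det B"
    by (simp_all add: C_def vector_2 k_def divide_inverse)
qed

section \<open>Interior charts\<close>

lemma open_imp_interior_half_plane:
  assumes "open U" "U \<subseteq> half_plane" "p \<in> U"
  shows "0 < p $ 1"
proof (rule ccontr)
  assume "\<not> 0 < p $ 1"
  obtain e where e: "e > 0" "ball p e \<subseteq> U" using assms openE by blast
  have "p - (e/2) *\<^sub>R axis 1 1 \<in> ball p e"
    using e by (simp add: dist_norm norm_axis_1)
  then have "p - (e/2) *\<^sub>R axis 1 (1::real) \<in> half_plane"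
    using e(2) assms(2) by blast
  then have "0 \<le> (p - (e/2) *\<^sub>R axis 1 (1::real)) $ 1"
    by (simp add: half_plane_def)
  then show False using \<open>\<not> 0 < p $ 1\<close> e by simp
qed

lemma smooth_on_subset:
  assumes "smooth_on S f" "T \<subseteq> S"
  shows "smooth_on T f"
  unfolding smooth_on_def
proof
  fix p assume "p \<in> T"
  then have "p \<in> S" using assms(2) by blast
  from bspec[OF assms(1)[unfolded smooth_on_def] this]
  obtain W F where W: "open W" "p \<in> W" "\<forall>k. Ck_on k W F" "\<forall>q\<in>W \<inter> S. F q = f q"
    by (elim exE conjE)
  have "\<forall>q\<in>W \<inter> T. F q = f q" using W(4) assms(2) by blast
  then show "\<exists>W F. open W \<and> p \<in> W \<and> (\<forall>k. Ck_on k W F) \<and> (\<forall>q\<in>W \<inter> T. F q = f q)"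
    by (intro exI[of _ W] exI[of _ F] conjI W)
qed

text \<open>At a point of the edge of the half plane the derivative within \<open>S\<close> is still unique, because
  each coordinate direction points into \<open>S\<close> at arbitrarily small scales. Hence junk
  values of the differential cannot occur there.\<close>

lemma partial_within_eq_0:
  assumes S: "openin (top_of_set half_plane) S" and p: "p \<in> S"
    and W: "open W" "p \<in> W" and F: "\<And>q. q \<in> W \<inter> S \<Longrightarrow> F q = 0"
  shows "partial_within S i F p = 0"
proof -
  obtain U where U: "open U" "S = half_plane \<inter> U" using S by (auto simp: openin_open)
  obtain r where r: "r > 0" "ball p r \<subseteq> U \<inter> W"
    using U W p by (metis IntD2 IntI open_Int openE)
  have "(F has_derivative (\<lambda>_. 0)) (at p within S)"
  proof (rule has_derivative_transform_within[OF has_derivative_const[of 0] r(1) p])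
    fix q assume "q \<in> S" "dist q p < r"
    then show "0 = F q" using F[of q] r(2) by (auto simp: dist_commute)
  qed
  then have "frechet_derivative F (at p within S) = (\<lambda>_. 0)"
  proof (rule frechet_derivative_unique_within[rotated])
    show "(F has_derivative frechet_derivative F (at p within S)) (at p within S)"
      using \<open>(F has_derivative (\<lambda>_. 0)) (at p within S)\<close> by (metis differentiableI frechet_derivative_works)
    fix b :: "real^2" and e :: real assume b: "b \<in> Basis" "e > 0"
    then obtain j where j: "b = axis j 1" by (auto simp: Basis_vec_def)
    define d where "d = min e r / 2"
    have d: "0 < d" "d < e" "d < r" using b r by (auto simp: d_def)
    have "p + d *\<^sub>R b \<in> half_plane"
      using p U d by (auto simp: j half_plane_def axis_def)
    moreover have "p + d *\<^sub>R b \<in> ball p r" using d by (simp add: j dist_norm norm_axis_1)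
    ultimately have "p + d *\<^sub>R b \<in> S" using U r by blast
    then show "\<exists>d. 0 < \<bar>d\<bar> \<and> \<bar>d\<bar> < e \<and> p + d *\<^sub>R b \<in> S" using d by (intro exI[of _ d]) auto
  qed
  then show ?thesis by (simp add: partial_within_def)
qed

locale surface =
  fixes A :: "'a::{second_countable_topology,t2_space} chart set" and g :: "'a metric"
  assumes riemannian: "riemannian_surface A g"
begin

abbreviation inner_pts :: "'a set" where
  "inner_pts \<equiv> manifold_interior A"

text \<open>In contrast to the whole image of the chart this is an open subset of the plane, so derivatives
  within the image are ordinary derivatives here.\<close>

definition inner_cod :: "'a chart \<Rightarrow> (real^2) set" where
  "inner_cod c = chart_map c ` (chart_dom c \<inter> inner_pts)"

lemma
  assumes "c \<in> A"
  shows chart_open: "open (chart_dom c)"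
    and chart_cod_openin: "openin (top_of_set half_plane) (chart_cod c)"
    and chart_homeomorphism: "homeomorphism (chart_dom c) (chart_cod c) (chart_map c) (chart_inv c)"
  using assms riemannian by (auto simp: riemannian_surface_def smooth_atlas_def is_chart_def)

lemma
  assumes "c \<in> A"
  shows chart_inv_map: "x \<in> chart_dom c \<Longrightarrow> chart_inv c (chart_map c x) = x"
    and chart_map_inv: "p \<in> chart_cod c \<Longrightarrow> chart_map c (chart_inv c p) = p"
    and chart_inv_dom: "p \<in> chart_cod c \<Longrightarrow> chart_inv c p \<in> chart_dom c"
    and chart_map_cont: "continuous_on (chart_dom c) (chart_map c)"
    and chart_inv_cont: "continuous_on (chart_cod c) (chart_inv c)"
  using chart_homeomorphism[OF assms] unfolding homeomorphism_def by auto

lemma chart_inj: "c \<in> A \<Longrightarrow> inj_on (chart_map c) (chart_dom c)"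
  by (rule inj_on_inverseI) (rule chart_inv_map)

lemma chart_at: "chart_at A x \<in> A" "x \<in> chart_dom (chart_at A x)"
proof -
  have "\<exists>c. c \<in> A \<and> x \<in> chart_dom c"
    using riemannian unfolding riemannian_surface_def smooth_atlas_def by blast
  then have "chart_at A x \<in> A \<and> x \<in> chart_dom (chart_at A x)"
    unfolding chart_at_def by (rule someI_ex)
  then show "chart_at A x \<in> A" "x \<in> chart_dom (chart_at A x)" by auto
qed

lemma chart_image_openin:
  assumes "c \<in> A" "open U" "U \<subseteq> chart_dom c"
  shows "openin (top_of_set half_plane) (chart_map c ` U)"
proof -
  have "openin (top_of_set (chart_dom c)) U"
    using assms by (simp add: open_subset)
  then have "openin (top_of_set (chart_cod c)) (chart_map c ` U)"
    using homeomorphism_imp_open_map[OF chart_homeomorphism[OF assms(1)]] by blast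
  then show ?thesis using chart_cod_openin[OF assms(1)] openin_trans by blast
qed

lemma chart_map_preimage_open:
  assumes "c \<in> A" "open W"
  shows "open {x \<in> chart_dom c. chart_map c x \<in> W}"
  using continuous_on_open_vimage[OF chart_open[OF assms(1)], of "chart_map c"] chart_map_cont[OF assms(1)] assms(2)
  by (auto simp: vimage_def Int_def conj_commute)

text \<open>Invariance of domain: near a point that is interior in the chart \<open>b\<close>, the change to the chart \<open>c\<close> maps
  an open set of the plane injectively and continuously into the closed half plane; the image is open and
  misses the edge. So the choice of the chart does not matter in the definition of the interior.\<close>

lemma inner_pts_iff:
  assumes c: "c \<in> A" "x \<in> chart_dom c"
  shows "x \<in> inner_pts \<longleftrightarrow> 0 < chart_map c x $ 1"
proof
  assume "0 < chart_map c x $ 1"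
  then show "x \<in> inner_pts" using c by (auto simp: manifold_interior_def)
next
  assume "x \<in> inner_pts"
  then obtain b where b: "b \<in> A" "x \<in> chart_dom b" "0 < chart_map b x $ 1"
    by (auto simp: manifold_interior_def)
  have op: "open {p::real^2. 0 < p $ 1}"
    by (intro open_Collect_less continuous_intros)
  define U where "U = chart_dom c \<inter> {y \<in> chart_dom b. chart_map b y \<in> {p. 0 < p $ 1}}"
  have U: "open U" "U \<subseteq> chart_dom b" "U \<subseteq> chart_dom c" "x \<in> U"
    using chart_map_preimage_open[OF b(1) op] chart_open[OF c(1)] b c by (auto simp: U_def)
  have oU: "open (chart_map b ` U)"
  proof -
    obtain W where W: "open W" "chart_map b ` U = half_plane \<inter> W"
      using chart_image_openin[OF b(1) U(1,2)] by (auto simp: openin_open)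
    have "chart_map b ` U = {p. 0 < p $ 1} \<inter> W"
    proof -
      have "p \<in> chart_map b ` U \<Longrightarrow> 0 < p $ 1" for p by (auto simp: U_def)
      then show ?thesis using W(2) by (auto simp: half_plane_def)
    qed
    then show ?thesis using op W by auto
  qed
  have "open ((chart_map c \<circ> chart_inv b) ` (chart_map b ` U))"
  proof (rule invariance_of_domain[OF _ oU])
    have sub: "chart_inv b ` chart_map b ` U \<subseteq> U"
      using chart_inv_map[OF b(1)] U(2) by auto
    show "continuous_on (chart_map b ` U) (chart_map c \<circ> chart_inv b)"
    proof (rule continuous_on_compose)
      show "continuous_on (chart_map b ` U) (chart_inv b)"
        by (rule continuous_on_subset[OF chart_inv_cont[OF b(1)] image_mono[OF U(2)]])
      show "continuous_on (chart_inv b ` chart_map b ` U) (chart_map c)"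
        by (rule continuous_on_subset[OF chart_map_cont[OF c(1)]]) (use sub U(3) in blast)
    qed
    show "inj_on (chart_map c \<circ> chart_inv b) (chart_map b ` U)"
    proof (rule inj_onI, clarsimp)
      fix y z assume yz: "y \<in> U" "z \<in> U"
        "chart_map c (chart_inv b (chart_map b y)) = chart_map c (chart_inv b (chart_map b z))"
      have "chart_inv b (chart_map b y) = y" "chart_inv b (chart_map b z) = z"
        using yz U(2) chart_inv_map[OF b(1)] by auto
      then have "y = z" using yz U(3) inj_onD[OF chart_inj[OF c(1)], of y z] by auto
      then show "chart_map b y = chart_map b z" by simp
    qed
  qed
  moreover have "(chart_map c \<circ> chart_inv b) ` (chart_map b ` U) = chart_map c ` U"
    using U chart_inv_map[OF b(1)] by (force simp: image_def)
  ultimately have "open (chart_map c ` U)" by simp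
  moreover have "chart_map c ` U \<subseteq> half_plane"
    using openin_imp_subset[OF chart_cod_openin[OF c(1)]] U by auto
  ultimately show "0 < chart_map c x $ 1"
    using open_imp_interior_half_plane U(4) by blast
qed

lemma open_inner_pts: "open inner_pts"
proof (rule topological_space_class.openI)
  fix x assume "x \<in> inner_pts"
  then obtain b where b: "b \<in> A" "x \<in> chart_dom b" "0 < chart_map b x $ 1"
    by (auto simp: manifold_interior_def)
  have op: "open {p::real^2. 0 < p $ 1}"
    by (intro open_Collect_less continuous_intros)
  show "\<exists>T. open T \<and> x \<in> T \<and> T \<subseteq> inner_pts"
    by (rule exI[of _ "{y \<in> chart_dom b. chart_map b y \<in> {p. 0 < p $ 1}}"])
      (use chart_map_preimage_open[OF b(1) op] b in \<open>auto simp: manifold_interior_def\<close>)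
qed

lemma chart_image_open:
  assumes c: "c \<in> A" and U: "open U" "U \<subseteq> chart_dom c \<inter> inner_pts"
  shows "open (chart_map c ` U)"
proof -
  obtain W where W: "open W" "chart_map c ` U = half_plane \<inter> W"
    using chart_image_openin[OF c U(1)] U(2) by (auto simp: openin_open)
  have "chart_map c ` U = {p. 0 < p $ 1} \<inter> W"
  proof -
    have "0 < chart_map c y $ 1" if "y \<in> U" for y
      using inner_pts_iff[OF c] U(2) that by blast
    then have "p \<in> chart_map c ` U \<Longrightarrow> 0 < p $ 1" for p by auto
    then show ?thesis using W(2) by (auto simp: half_plane_def)
  qed
  moreover have "open {p::real^2. 0 < p $ 1}"
    by (intro open_Collect_less continuous_intros)
  ultimately show ?thesis using W by auto
qed

lemma open_inner_cod: "c \<in> A \<Longrightarrow> open (inner_cod c)"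
  unfolding inner_cod_def by (rule chart_image_open) (auto intro!: open_Int chart_open open_inner_pts)

lemma inner_cod_subset: "inner_cod c \<subseteq> chart_cod c"
  by (auto simp: inner_cod_def)

lemma inner_cod_inv: "c \<in> A \<Longrightarrow> p \<in> inner_cod c \<Longrightarrow> chart_inv c p \<in> chart_dom c \<inter> inner_pts"
  by (auto simp: inner_cod_def chart_inv_map)

lemma inner_cod_map_inv: "c \<in> A \<Longrightarrow> p \<in> inner_cod c \<Longrightarrow> chart_map c (chart_inv c p) = p"
  by (auto simp: inner_cod_def chart_inv_map)

lemma at_within_inner_cod:
  assumes "c \<in> A" "p \<in> inner_cod c"
  shows "at p within chart_cod c = at p"
  using at_within_open_subset[OF assms(2) open_inner_cod[OF assms(1)] inner_cod_subset] .

lemma partial_within_inner_cod: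
  "c \<in> A \<Longrightarrow> p \<in> inner_cod c \<Longrightarrow> partial_within (chart_cod c) i F p = pd i F p"
  by (simp add: partial_within_def pd_def at_within_inner_cod)

lemma differential_inner:
  "c \<in> A \<Longrightarrow> x \<in> chart_dom c \<inter> inner_pts \<Longrightarrow>
    differential f c x $ i = pd i (f \<circ> chart_inv c) (chart_map c x)"
  by (simp add: differential_def partial_within_inner_cod inner_cod_def)

text \<open>The part of the image of \<open>c\<close> on which the transition to \<open>c'\<close> is a diffeomorphism of open sets.\<close>

definition overlap :: "'a chart \<Rightarrow> 'a chart \<Rightarrow> (real^2) set" where
  "overlap c c' = chart_map c ` (chart_dom c \<inter> chart_dom c' \<inter> inner_pts)"

lemma
  assumes c: "c \<in> A" "c' \<in> A"
  shows open_overlap: "open (overlap c c')"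
    and overlap_inner_cod: "overlap c c' \<subseteq> inner_cod c"
    and transition_smooth: "Csmooth (overlap c c') (transition c c')"
    and transition_inner_cod: "p \<in> overlap c c' \<Longrightarrow> transition c c' p \<in> inner_cod c'"
    and transition_inv: "p \<in> overlap c c' \<Longrightarrow> chart_inv c' (transition c c' p) = chart_inv c p"
proof -
  show op: "open (overlap c c')"
    unfolding overlap_def by (rule chart_image_open[OF c(1)])
      (auto intro!: open_Int chart_open c open_inner_pts)
  show "overlap c c' \<subseteq> inner_cod c" by (auto simp: overlap_def inner_cod_def)
  have "smooth_on (chart_map c ` (chart_dom c \<inter> chart_dom c')) (transition c c')"
    using riemannian c unfolding riemannian_surface_def smooth_atlas_def by blast
  then have "smooth_on (overlap c c') (transition c c')"
    by (rule smooth_on_subset) (auto simp: overlap_def)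
  then show "Csmooth (overlap c c') (transition c c')"
    using smooth_on_open_iff[OF op] by blast
  show "p \<in> overlap c c' \<Longrightarrow> transition c c' p \<in> inner_cod c'"
    by (auto simp: overlap_def inner_cod_def transition_def chart_inv_map c)
  show "p \<in> overlap c c' \<Longrightarrow> chart_inv c' (transition c c' p) = chart_inv c p"
    by (auto simp: overlap_def transition_def chart_inv_map c)
qed

lemma jacobian_inner:
  assumes c: "c \<in> A" "c' \<in> A" and x: "x \<in> chart_dom c \<inter> chart_dom c' \<inter> inner_pts"
  shows "jacobian c c' x $ k $ i = pd i (transition c c') (chart_map c x) $ k"
proof -
  have p: "chart_map c x \<in> overlap c c'" using x by (auto simp: overlap_def)
  have "at (chart_map c x) within chart_map c ` (chart_dom c \<inter> chart_dom c') = at (chart_map c x)"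
    by (rule at_within_open_subset[OF p open_overlap[OF c]]) (auto simp: overlap_def)
  then show ?thesis by (simp add: jacobian_def matrix_def pd_def)
qed

lemma metric_posdef:
  assumes "c \<in> A" "x \<in> chart_dom c"
  shows "transpose (g c x) = g c x" "v \<noteq> 0 \<Longrightarrow> 0 < v \<bullet> (g c x *v v)" "0 < det (g c x)"
    "g c x $ 2 $ 1 = g c x $ 1 $ 2" "0 < g c x $ 1 $ 1" "0 < g c x $ 2 $ 2"
proof -
  show s: "transpose (g c x) = g c x" "v \<noteq> 0 \<Longrightarrow> 0 < v \<bullet> (g c x *v v)" for v
    using riemannian assms unfolding riemannian_surface_def riemannian_metric_def by blast+
  show "0 < det (g c x)" "g c x $ 2 $ 1 = g c x $ 1 $ 2" "0 < g c x $ 1 $ 1" "0 < g c x $ 2 $ 2"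
    using posdef_2[OF s] by auto
qed

lemma metric_transform:
  assumes "c \<in> A" "c' \<in> A" "x \<in> chart_dom c \<inter> chart_dom c'"
  shows "g c x = transpose (jacobian c c' x) ** g c' x ** jacobian c c' x"
  using riemannian assms unfolding riemannian_surface_def riemannian_metric_def by blast

lemma det_metric_transform:
  assumes "c \<in> A" "c' \<in> A" "x \<in> chart_dom c \<inter> chart_dom c'"
  shows "det (g c x) = (det (jacobian c c' x))\<^sup>2 * det (g c' x)" "det (jacobian c c' x) \<noteq> 0"
proof -
  show 1: "det (g c x) = (det (jacobian c c' x))\<^sup>2 * det (g c' x)"
    using metric_transform[OF assms] by (simp add: det_mul power2_eq_square)
  show "det (jacobian c c' x) \<noteq> 0"
    using 1 metric_posdef(3)[OF assms(1), of x] assms(3) by auto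
qed

lemma metric_inner_transform:
  assumes c: "c \<in> A" "c' \<in> A" "x \<in> chart_dom c \<inter> chart_dom c'"
    and X: "X c' x = jacobian c c' x *v X c x" and Y: "Y c' x = jacobian c c' x *v Y c x"
  shows "X c x \<bullet> (g c x *v Y c x) = X c' x \<bullet> (g c' x *v Y c' x)"
proof -
  have "X c' x \<bullet> (g c' x *v Y c' x) = (jacobian c c' x *v X c x) \<bullet> (g c' x *v (jacobian c c' x *v Y c x))"
    using X Y by simp
  also have "\<dots> = X c x \<bullet> (transpose (jacobian c c' x) *v (g c' x *v (jacobian c c' x *v Y c x)))"
    by (metis dot_lmul_matrix inner_commute transpose_matrix_vector)
  also have "\<dots> = X c x \<bullet> (g c x *v Y c x)"
    by (simp add: metric_transform[OF c] matrix_vector_mul_assoc[symmetric] del: transpose_matrix_vector)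
  finally show ?thesis by simp
qed

lemma vector_fieldD:
  assumes "vector_field_on A \<Omega> X" "c \<in> A" "c' \<in> A" "x \<in> chart_dom c" "x \<in> chart_dom c'" "x \<in> \<Omega>"
  shows "X c' x = jacobian c c' x *v X c x"
  using assms unfolding vector_field_on_def by blast

lemma metric_inner_chart:
  assumes "vector_field_on A \<Omega> X" "vector_field_on A \<Omega> Y" "c \<in> A" "x \<in> chart_dom c \<inter> \<Omega>"
  shows "metric_inner A g X Y x = X c x \<bullet> (g c x *v Y c x)"
  unfolding metric_inner_def Let_def
proof (rule metric_inner_transform[OF chart_at(1) assms(3)])
  show "x \<in> chart_dom (chart_at A x) \<inter> chart_dom c" using assms(4) chart_at(2) by blast
  show "X c x = jacobian (chart_at A x) c x *v X (chart_at A x) x"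
    using vector_fieldD[OF assms(1) chart_at(1) assms(3) chart_at(2)] assms(4) by blast
  show "Y c x = jacobian (chart_at A x) c x *v Y (chart_at A x) x"
    using vector_fieldD[OF assms(2) chart_at(1) assms(3) chart_at(2)] assms(4) by blast
qed

lemma metric_inner_nonneg: "0 \<le> metric_inner A g X X x"
proof -
  have "0 \<le> v \<bullet> (g (chart_at A x) x *v v)" for v
    using metric_posdef(2)[OF chart_at, of v x] by (cases "v = 0") auto
  then show ?thesis by (simp add: metric_inner_def Let_def)
qed

end

section \<open>Differential operators on test functions\<close>

context surface
begin

lemma test_function_smooth:
  assumes "test_function A \<Omega> f" "c \<in> A"
  shows "Csmooth (inner_cod c) (\<lambda>p. f (chart_inv c p))"
proof -
  have "smooth_on (chart_cod c) (f \<circ> chart_inv c)"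
    using assms unfolding test_function_def smooth_fun_on_def by auto
  then have "smooth_on (inner_cod c) (f \<circ> chart_inv c)" by (rule smooth_on_subset) (rule inner_cod_subset)
  then show ?thesis
    using smooth_on_open_iff[OF open_inner_cod[OF assms(2)], of "f \<circ> chart_inv c"] by (simp add: comp_def)
qed

definition supp :: "('a \<Rightarrow> real) \<Rightarrow> 'a set" where
  "supp f = closure {x. f x \<noteq> 0}"

lemma
  assumes "test_function A \<Omega> f"
  shows test_supp: "compact (supp f)" "supp f \<subseteq> \<Omega>" "supp f \<subseteq> inner_pts" "open (- supp f)"
    and test_supp_0: "x \<notin> supp f \<Longrightarrow> f x = 0"
proof -
  show "compact (supp f)" "supp f \<subseteq> \<Omega>" "supp f \<subseteq> inner_pts" "open (- supp f)"
    using assms by (auto simp: test_function_def supp_def)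
  show "x \<notin> supp f \<Longrightarrow> f x = 0" using closure_subset[of "{x. f x \<noteq> 0}"] by (auto simp: supp_def)
qed

text \<open>Smoothness near the support has to be checked in one chart only, as changes of charts are smooth in the
  interior. Elsewhere, and in particular at the boundary of the surface, the zero function is a smooth
  extension.\<close>

lemma test_functionI:
  assumes K: "compact K" "K \<subseteq> \<Omega> \<inter> inner_pts" "\<And>x. x \<notin> K \<Longrightarrow> f x = 0"
    and sm: "\<And>x. x \<in> K \<Longrightarrow> \<exists>c\<in>A. \<exists>U. x \<in> chart_dom c \<and> open U \<and> chart_map c x \<in> U \<and> U \<subseteq> inner_cod c
      \<and> Csmooth U (\<lambda>p. f (chart_inv c p))"
  shows "test_function A \<Omega> f"
proof -
  have cK: "closed K" using K(1) by (rule compact_imp_closed)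
  have sub: "closure {x. f x \<noteq> 0} \<subseteq> K"
    by (rule closure_minimal[OF _ cK]) (use K(3) in blast)
  have "compact (K \<inter> closure {x. f x \<noteq> 0})" by (rule compact_Int_closed[OF K(1)]) simp
  then have cs: "compact (closure {x. f x \<noteq> 0})" using sub by (simp add: Int_absorb1)
  have "smooth_on (chart_map c ` (chart_dom c \<inter> UNIV)) (f \<circ> chart_inv c)" if c: "c \<in> A" for c
    unfolding smooth_on_def
  proof
    fix p assume "p \<in> chart_map c ` (chart_dom c \<inter> UNIV)"
    then obtain x where x: "x \<in> chart_dom c" "p = chart_map c x" by auto
    show "\<exists>W F. open W \<and> p \<in> W \<and> (\<forall>k. Ck_on k W F)
        \<and> (\<forall>q\<in>W \<inter> chart_map c ` (chart_dom c \<inter> UNIV). F q = (f \<circ> chart_inv c) q)"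
    proof (cases "x \<in> K")
      case False
      have "open (chart_dom c - K)" using chart_open[OF c] cK by blast
      from chart_image_openin[OF c this] obtain W where
        W: "open W" "chart_map c ` (chart_dom c - K) = half_plane \<inter> W"
        by (auto simp: openin_open)
      have pW: "p \<in> W" using W x False by blast
      have "f (chart_inv c q) = 0" if q: "q \<in> W" "q \<in> chart_cod c" for q
      proof -
        have "q \<in> half_plane" using openin_imp_subset[OF chart_cod_openin[OF c]] q by blast
        then have "q \<in> chart_map c ` (chart_dom c - K)" using W q by blast
        then obtain y where "y \<in> chart_dom c - K" "q = chart_map c y" by blast
        then show ?thesis using K(3) chart_inv_map[OF c, of y] by auto
      qed
      then show ?thesis using W(1) pW by (intro exI[of _ W] exI[of _ "\<lambda>_. 0"]) auto
    next
      case True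
      obtain b U where b: "b \<in> A" "x \<in> chart_dom b" and U: "open U" "chart_map b x \<in> U" "U \<subseteq> inner_cod b"
        "Csmooth U (\<lambda>p. f (chart_inv b p))"
        using sm[OF True] by blast
      define W where "W = overlap c b \<inter> transition c b -` U"
      have oW: "open W" unfolding W_def
        by (rule continuous_open_preimage[OF Csmooth_imp_continuous_on[OF transition_smooth[OF c b(1)]]
            open_overlap[OF c b(1)] U(1)])
      have pW: "p \<in> W"
        using x b U K True by (auto simp: W_def overlap_def transition_def chart_inv_map[OF c])
      have "Csmooth W (\<lambda>q. f (chart_inv b (transition c b q)))"
        by (rule Csmooth_compose[OF oW U(1) _ U(4)])
          (use Csmooth_subset[OF transition_smooth[OF c b(1)], of W] in \<open>auto simp: W_def\<close>)
      then have "Csmooth W (f \<circ> chart_inv c)"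
        by (rule Csmooth_cong[OF oW]) (auto simp: W_def transition_inv[OF c b(1)])
      then show ?thesis
        using oW pW by (intro exI[of _ W] exI[of _ "f \<circ> chart_inv c"]) (auto simp: Csmooth_def)
    qed
  qed
  then show ?thesis
    unfolding test_function_def smooth_fun_on_def using cs sub K(2) by blast
qed

lemma test_functionI':
  assumes K: "compact K" "K \<subseteq> \<Omega> \<inter> inner_pts" "\<And>x. x \<notin> K \<Longrightarrow> f x = 0"
    and sm: "\<And>c. c \<in> A \<Longrightarrow> Csmooth (inner_cod c) (\<lambda>p. f (chart_inv c p))"
  shows "test_function A \<Omega> f"
proof (rule test_functionI[OF K])
  fix x assume x: "x \<in> K"
  have "chart_map (chart_at A x) x \<in> inner_cod (chart_at A x)"
    using x K(2) chart_at[of x] by (auto simp: inner_cod_def)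
  then show "\<exists>c\<in>A. \<exists>U. x \<in> chart_dom c \<and> open U \<and> chart_map c x \<in> U \<and> U \<subseteq> inner_cod c
      \<and> Csmooth U (\<lambda>p. f (chart_inv c p))"
    using chart_at[of x] sm[OF chart_at(1)] open_inner_cod[OF chart_at(1)] by blast
qed

lemma test_function_add:
  assumes "test_function A \<Omega> f" "test_function A \<Omega> h"
  shows "test_function A \<Omega> (\<lambda>x. f x + h x)"
  by (rule test_functionI'[of "supp f \<union> supp h"])
    (use test_supp[OF assms(1)] test_supp[OF assms(2)] test_supp_0[OF assms(1)] test_supp_0[OF assms(2)]
      in \<open>auto intro!: Csmooth_add test_function_smooth[OF assms(1)] test_function_smooth[OF assms(2)]
        simp: open_inner_cod\<close>)

lemma test_function_mult:
  assumes "test_function A \<Omega> f" "test_function A \<Omega> h"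
  shows "test_function A \<Omega> (\<lambda>x. f x * h x)"
  by (rule test_functionI'[of "supp f"])
    (use test_supp[OF assms(1)] test_supp_0[OF assms(1)]
      in \<open>auto intro!: Csmooth_mult test_function_smooth[OF assms(1)] test_function_smooth[OF assms(2)]
        simp: open_inner_cod\<close>)

lemma test_function_cmult:
  assumes "test_function A \<Omega> f"
  shows "test_function A \<Omega> (\<lambda>x. a * f x)"
  by (rule test_functionI'[of "supp f"])
    (use test_supp[OF assms(1)] test_supp_0[OF assms(1)]
      in \<open>auto intro!: Csmooth_mult test_function_smooth[OF assms(1)] simp: open_inner_cod\<close>)

lemma test_differentiable:
  assumes "test_function A \<Omega> f" "c \<in> A" "p \<in> inner_cod c"
  shows "(\<lambda>p. f (chart_inv c p)) differentiable (at p)"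
  using Csmooth_imp_differentiable[OF open_inner_cod[OF assms(2)] test_function_smooth[OF assms(1,2)] assms(3)] .

lemma differential_chart:
  "c \<in> A \<Longrightarrow> p \<in> inner_cod c \<Longrightarrow> differential f c (chart_inv c p) $ i = pd i (\<lambda>p. f (chart_inv c p)) p"
  using differential_inner[of c "chart_inv c p" f i] inner_cod_inv[of c p] inner_cod_map_inv[of c p]
  by (simp add: comp_def)

lemma differential_eq_0:
  assumes "c \<in> A" "x \<in> chart_dom c" "open N" "x \<in> N" "\<And>y. y \<in> N \<Longrightarrow> f y = 0"
  shows "differential f c x = 0"
proof -
  have "open (chart_dom c \<inter> N)" using chart_open[OF assms(1)] assms(3) by blast
  from chart_image_openin[OF assms(1) this] obtain W where
    W: "open W" "chart_map c ` (chart_dom c \<inter> N) = half_plane \<inter> W" by (auto simp: openin_open)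
  have "partial_within (chart_cod c) i (f \<circ> chart_inv c) (chart_map c x) = 0" for i
  proof (rule partial_within_eq_0[OF chart_cod_openin[OF assms(1)] _ W(1)])
    show "chart_map c x \<in> chart_cod c" using assms by blast
    show "chart_map c x \<in> W" using assms W by blast
    fix q assume q: "q \<in> W \<inter> chart_cod c"
    have "q \<in> half_plane" using openin_imp_subset[OF chart_cod_openin[OF assms(1)]] q by blast
    then obtain y where "y \<in> chart_dom c \<inter> N" "q = chart_map c y" using W q by blast
    then show "(f \<circ> chart_inv c) q = 0" using assms(5) chart_inv_map[OF assms(1), of y] by auto
  qed
  then show ?thesis by (simp add: differential_def vec_eq_iff)
qed

lemma gradient_eq_0:
  assumes "c \<in> A" "x \<in> chart_dom c" "open N" "x \<in> N" "\<And>y. y \<in> N \<Longrightarrow> f y = 0"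
  shows "gradient g f c x = 0"
  using differential_eq_0[OF assms] by (simp add: gradient_def)

lemma test_gradient_eq_0:
  assumes "test_function A \<Omega> f" "x \<notin> supp f" "c \<in> A" "x \<in> chart_dom c"
  shows "gradient g f c x = 0" "differential f c x = 0"
  using gradient_eq_0[OF assms(3,4) test_supp(4)[OF assms(1)]]
    differential_eq_0[OF assms(3,4) test_supp(4)[OF assms(1)]]
    test_supp_0[OF assms(1)] assms(2) by auto

text \<open>Boundary points of the surface are included: both the gradient near the point and its
  divergence at the point are derivatives within the chart image of functions that vanish nearby.\<close>

lemma test_laplace_eq_0:
  assumes f: "test_function A \<Omega> f" and x: "x \<notin> supp f"
  shows "laplace_beltrami A g f x = 0"
proof -
  define c where "c = chart_at A x"
  have c: "c \<in> A" "x \<in> chart_dom c" using chart_at[of x] by (auto simp: c_def)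
  have "open (chart_dom c - supp f)" using chart_open[OF c(1)] test_supp(4)[OF f] by (simp add: open_Diff closed_def)
  from chart_image_openin[OF c(1) this] obtain W where
    W: "open W" "chart_map c ` (chart_dom c - supp f) = half_plane \<inter> W" by (auto simp: openin_open)
  have "partial_within (chart_cod c) i (\<lambda>p. sqrt (det (g c (chart_inv c p)))
      * gradient g f c (chart_inv c p) $ i) (chart_map c x) = 0" for i
  proof (rule partial_within_eq_0[OF chart_cod_openin[OF c(1)] _ W(1)])
    show "chart_map c x \<in> chart_cod c" using c by blast
    show "chart_map c x \<in> W" using c W x by blast
    fix q assume q: "q \<in> W \<inter> chart_cod c"
    have "q \<in> half_plane" using openin_imp_subset[OF chart_cod_openin[OF c(1)]] q by blast
    then obtain y where y: "y \<in> chart_dom c - supp f" "q = chart_map c y" using W q by blast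
    have "gradient g f c y = 0" using test_gradient_eq_0(1)[OF f _ c(1)] y by blast
    then show "sqrt (det (g c (chart_inv c q))) * gradient g f c (chart_inv c q) $ i = 0"
      using y chart_inv_map[OF c(1), of y] by simp
  qed
  then show ?thesis
    by (simp add: laplace_beltrami_def divergence_def Let_def c_def)
qed

lemma metric_gradient:
  assumes "c \<in> A" "x \<in> chart_dom c"
  shows "g c x *v gradient g f c x = differential f c x"
  using matrix_inv_2(2)[of "g c x"] metric_posdef(3)[OF assms]
  by (simp add: gradient_def matrix_vector_mul_assoc)

lemma gradient_components:
  assumes "c \<in> A" "x \<in> chart_dom c"
  shows "gradient g f c x $ 1 = (g c x $2$2 * differential f c x $ 1 - g c x $1$2 * differential f c x $ 2) / det (g c x)"
    "gradient g f c x $ 2 = (g c x $1$1 * differential f c x $ 2 - g c x $1$2 * differential f c x $ 1) / det (g c x)"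
  using matrix_inv_2(3-6)[of "g c x"] metric_posdef(3,4)[OF assms]
  by (simp_all add: gradient_def matrix_vector_2 diff_divide_distrib)

lemma metric_component_smooth:
  assumes "c \<in> A"
  shows "Csmooth (inner_cod c) (\<lambda>p. g c (chart_inv c p) $ i $ j)"
proof -
  have "smooth_on (chart_cod c) (\<lambda>p. g c (chart_inv c p))"
    using riemannian assms unfolding riemannian_surface_def riemannian_metric_def by blast
  then have "smooth_on (inner_cod c) (\<lambda>p. g c (chart_inv c p))" by (rule smooth_on_subset) (rule inner_cod_subset)
  then have "Csmooth (inner_cod c) (\<lambda>p. g c (chart_inv c p))"
    using smooth_on_open_iff[OF open_inner_cod[OF assms]] by blast
  then show ?thesis
    by (intro Csmooth_nth open_inner_cod assms)
qed

lemma metric_det_smooth: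
  assumes "c \<in> A"
  shows "Csmooth (inner_cod c) (\<lambda>p. det (g c (chart_inv c p)))"
  unfolding det_2
  by (intro Csmooth_diff Csmooth_mult open_inner_cod assms metric_component_smooth)

definition vol_density :: "'a chart \<Rightarrow> real^2 \<Rightarrow> real" where
  "vol_density c p = sqrt (det (g c (chart_inv c p)))"

lemma vol_density_pos: "c \<in> A \<Longrightarrow> p \<in> chart_cod c \<Longrightarrow> 0 < vol_density c p"
  using metric_posdef(3)[OF _ chart_inv_dom] by (simp add: vol_density_def)

lemma vol_density_smooth:
  assumes "c \<in> A"
  shows "Csmooth (inner_cod c) (vol_density c)"
  unfolding vol_density_def[abs_def]
  by (rule Csmooth_sqrt[OF open_inner_cod[OF assms] metric_det_smooth[OF assms]])
    (use metric_posdef(3)[OF assms] inner_cod_inv[OF assms] in blast)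

lemma differential_smooth:
  assumes "test_function A \<Omega> f" "c \<in> A"
  shows "Csmooth (inner_cod c) (\<lambda>p. differential f c (chart_inv c p) $ i)"
  by (rule Csmooth_cong[OF open_inner_cod[OF assms(2)] Csmooth_pd[OF test_function_smooth[OF assms]]])
    (simp add: differential_chart[OF assms(2)])

lemma gradient_smooth:
  assumes f: "test_function A \<Omega> f" and c: "c \<in> A"
  shows "Csmooth (inner_cod c) (\<lambda>p. gradient g f c (chart_inv c p) $ i)"
proof -
  have det: "0 < det (g c (chart_inv c p))" if "p \<in> inner_cod c" for p
    using metric_posdef(3)[OF c] inner_cod_inv[OF c that] by blast
  have "Csmooth (inner_cod c) (\<lambda>p. (g c (chart_inv c p) $k$k * differential f c (chart_inv c p) $ l
      - g c (chart_inv c p) $1$2 * differential f c (chart_inv c p) $ k) / det (g c (chart_inv c p)))" for k l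
    by (intro Csmooth_divide_pos Csmooth_diff Csmooth_mult open_inner_cod c metric_component_smooth
        differential_smooth[OF f] metric_det_smooth det)
  note s = this
  have dom: "chart_inv c p \<in> chart_dom c" if "p \<in> inner_cod c" for p using inner_cod_inv[OF c that] by blast
  show ?thesis
  proof (cases "i = 1")
    case True
    show ?thesis
      by (rule Csmooth_cong[OF open_inner_cod[OF c] s[of 2 1]]) (simp add: True gradient_components[OF c dom])
  next
    case False
    then have "i = 2" using exhaust_2[of i] by blast
    then show ?thesis
      by (intro Csmooth_cong[OF open_inner_cod[OF c] s[of 1 2]]) (simp add: gradient_components[OF c dom])
  qed
qed

lemma differential_transform:
  assumes f: "test_function A \<Omega> f" and c: "c \<in> A" "c' \<in> A" and x: "x \<in> chart_dom c \<inter> chart_dom c' \<inter> inner_pts"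
  shows "differential f c x = transpose (jacobian c c' x) *v differential f c' x"
proof -
  define p where "p = chart_map c x"
  have p: "p \<in> overlap c c'" "transition c c' p = chart_map c' x"
    using x by (auto simp: overlap_def p_def transition_def chart_inv_map[OF c(1)])
  have dT: "transition c c' differentiable (at p)"
    using Csmooth_imp_differentiable[OF open_overlap[OF c] transition_smooth[OF c] p(1)] .
  have d': "(\<lambda>p. f (chart_inv c' p)) differentiable (at (transition c c' p))"
    using test_differentiable[OF f c(2) transition_inner_cod[OF c p(1)]] .
  have "differential f c x $ i = (transpose (jacobian c c' x) *v differential f c' x) $ i" for i
  proof -
    have "differential f c x $ i = pd i (\<lambda>p. f (chart_inv c p)) p"
      using differential_inner[OF c(1), of x f i] x by (simp add: p_def comp_def)
    also have "\<dots> = pd i (\<lambda>p. f (chart_inv c' (transition c c' p))) p"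
      by (rule pd_cong[OF open_overlap[OF c] p(1)]) (simp add: transition_inv[OF c])
    also have "\<dots> = (pd i (transition c c') p)$1 * differential f c' x $ 1
        + (pd i (transition c c') p)$2 * differential f c' x $ 2"
      using pd_compose(2)[OF dT d', of i] differential_inner[OF c(2), of x f] x p(2)
      by (simp add: comp_def)
    finally show ?thesis
      unfolding matrix_vector_2 transpose_def using jacobian_inner[OF c x] by (simp add: p_def)
  qed
  then show ?thesis by (simp add: vec_eq_iff)
qed

text \<open>Covectors pull back with the transposed Jacobian and the metric with the Jacobian on both sides. Both
  sides of the claim therefore have the same image under the injective map \<open>J\<^sup>T g'\<close>, where \<open>g'\<close> is
  the metric in the chart \<open>c'\<close>.\<close>

lemma gradient_transform:
  assumes f: "test_function A \<Omega> f" and c: "c \<in> A" "c' \<in> A" and x: "x \<in> chart_dom c \<inter> chart_dom c' \<inter> inner_pts"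
  shows "gradient g f c' x = jacobian c c' x *v gradient g f c x"
proof -
  let ?J = "jacobian c c' x"
  have xx: "x \<in> chart_dom c" "x \<in> chart_dom c'" "x \<in> chart_dom c \<inter> chart_dom c'" using x by auto
  have "transpose ?J *v (g c' x *v (?J *v gradient g f c x)) = g c x *v gradient g f c x"
    by (simp add: metric_transform[OF c xx(3)] matrix_vector_mul_assoc[symmetric] del: transpose_matrix_vector)
  also have "\<dots> = transpose ?J *v (g c' x *v gradient g f c' x)"
    by (simp only: metric_gradient[OF c(1) xx(1)] metric_gradient[OF c(2) xx(2)] differential_transform[OF f c x])
  finally have "g c' x *v (?J *v gradient g f c x) = g c' x *v gradient g f c' x"
    using inj_matrix_vector_mult[of "transpose ?J"] det_metric_transform(2)[OF c xx(3)]
    by (simp add: invertible_det_nz inj_eq del: transpose_matrix_vector)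
  then show ?thesis
    using inj_matrix_vector_mult[of "g c' x"] metric_posdef(3)[OF c(2) xx(2)]
    by (simp add: invertible_det_nz inj_eq)
qed

lemma gradient_vector_field:
  assumes f: "test_function A \<Omega> f"
  shows "vector_field_on A S (gradient g f)"
  unfolding vector_field_on_def
proof (intro ballI)
  fix c c' x assume c: "c \<in> A" "c' \<in> A" and x: "x \<in> chart_dom c \<inter> chart_dom c' \<inter> S"
  show "gradient g f c' x = jacobian c c' x *v gradient g f c x"
  proof (cases "x \<in> supp f")
    case True
    then show ?thesis using gradient_transform[OF f c] x test_supp(3)[OF f] by blast
  next
    case False
    then show ?thesis using test_gradient_eq_0(1)[OF f False] c x by simp
  qed
qed

lemma metric_inner_gradient:
  assumes f: "test_function A \<Omega> f" "test_function A \<Omega>' h" and c: "c \<in> A" "x \<in> chart_dom c"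
  shows "metric_inner A g (gradient g f) (gradient g h) x = gradient g f c x \<bullet> differential h c x"
  using metric_inner_chart[OF gradient_vector_field[OF f(1), of UNIV] gradient_vector_field[OF f(2)] c(1), of x]
    metric_gradient[OF c] c by simp

text \<open>Turns chart-independent quantities into globally continuous functions, although their
  definition picks an arbitrary chart at each point.\<close>

lemma continuous_if_compact_support:
  fixes h :: "'a \<Rightarrow> real"
  assumes K: "compact K" "K \<subseteq> inner_pts" "\<And>x. x \<notin> K \<Longrightarrow> h x = 0"
    and cont: "\<And>c. c \<in> A \<Longrightarrow> continuous_on (inner_cod c) (\<lambda>p. h (chart_inv c p))"
  shows "continuous_on UNIV h"
proof -
  have oK: "open (- K)" using compact_imp_closed[OF K(1)] by blast
  have c0: "continuous_on (- K) h"
    using continuous_on_cong[of "- K" "- K" h "\<lambda>_. 0"] K(3) by simp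
  have "continuous (at x) h" if "x \<in> inner_pts" for x
  proof -
    define c where "c = chart_at A x"
    have c: "c \<in> A" "x \<in> chart_dom c" using chart_at[of x] by (auto simp: c_def)
    let ?N = "chart_dom c \<inter> inner_pts"
    have "continuous_on ?N (\<lambda>y. h (chart_inv c (chart_map c y)))"
      by (rule continuous_on_compose2[OF cont[OF c(1)] continuous_on_subset[OF chart_map_cont[OF c(1)]]])
        (auto simp: inner_cod_def)
    then have "continuous_on ?N h"
      using continuous_on_cong[of ?N ?N h "\<lambda>y. h (chart_inv c (chart_map c y))"] chart_inv_map[OF c(1)] by simp
    then show ?thesis
      using c that by (simp add: continuous_on_eq_continuous_at open_Int chart_open open_inner_pts)
  qed
  then have "continuous_on inner_pts h"
    by (simp add: continuous_at_imp_continuous_on)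
  then have "continuous_on (inner_pts \<union> - K) h"
    using continuous_on_open_Un[OF open_inner_pts oK _ c0] by blast
  moreover have "inner_pts \<union> - K = UNIV" using K(2) by blast
  ultimately show ?thesis by simp
qed

lemma test_continuous:
  assumes f: "test_function A \<Omega> f"
  shows "continuous_on UNIV f"
  by (rule continuous_if_compact_support[OF test_supp(1,3)[OF f] test_supp_0[OF f]])
    (auto intro: Csmooth_imp_continuous_on test_function_smooth[OF f])

lemma metric_inner_gradient_eq_0:
  assumes f: "test_function A \<Omega> f" and x: "x \<notin> supp f"
  shows "metric_inner A g (gradient g f) X x = 0"
  using test_gradient_eq_0(1)[OF f x chart_at] by (simp add: metric_inner_def Let_def)

lemma metric_inner_gradient_continuous:
  assumes f: "test_function A \<Omega> f" "test_function A \<Omega>' h"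
  shows "continuous_on UNIV (metric_inner A g (gradient g f) (gradient g h))"
proof (rule continuous_if_compact_support[OF test_supp(1,3)[OF f(1)] metric_inner_gradient_eq_0[OF f(1)]])
  fix c assume c: "c \<in> A"
  have "continuous_on (inner_cod c) (\<lambda>p. gradient g f c (chart_inv c p) $ 1 * differential h c (chart_inv c p) $ 1
      + gradient g f c (chart_inv c p) $ 2 * differential h c (chart_inv c p) $ 2)"
    by (intro continuous_intros Csmooth_imp_continuous_on[OF gradient_smooth[OF f(1) c]]
        Csmooth_imp_continuous_on[OF differential_smooth[OF f(2) c]])
  then show "continuous_on (inner_cod c) (\<lambda>p. metric_inner A g (gradient g f) (gradient g h) (chart_inv c p))"
    using continuous_on_cong[of "inner_cod c" "inner_cod c"
        "\<lambda>p. metric_inner A g (gradient g f) (gradient g h) (chart_inv c p)"]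
      metric_inner_gradient[OF f c] inner_cod_inv[OF c] by (simp add: inner_2)
qed

text \<open>Passing to another chart multiplies the densitized field by the cofactor matrix of the transition, up to
  the sign of the Jacobian determinant, which is locally constant. The Piola identity then compares
  the two coordinate expressions of the divergence.\<close>

lemma divergence_transform:
  assumes c: "c \<in> A" "c' \<in> A" and x: "x \<in> chart_dom c \<inter> chart_dom c' \<inter> inner_pts"
    and X: "vector_field_on A inner_pts X"
    and sm: "\<And>k. Csmooth (inner_cod c') (\<lambda>p. X c' (chart_inv c' p) $ k)"
  shows "(\<Sum>i\<in>UNIV. pd i (\<lambda>p. vol_density c p * X c (chart_inv c p) $ i) (chart_map c x))
      / vol_density c (chart_map c x)
    = (\<Sum>i\<in>UNIV. pd i (\<lambda>p. vol_density c' p * X c' (chart_inv c' p) $ i) (chart_map c' x))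
      / vol_density c' (chart_map c' x)"
proof -
  define T where "T = transition c c'"
  define V where "V k = (\<lambda>p. vol_density c' p * X c' (chart_inv c' p) $ k)" for k
  define p where "p = chart_map c x"
  define t where "t i q = T q $ i" for i q
  define dJ where "dJ q = pd 1 (t 1) q * pd 2 (t 2) q - pd 2 (t 1) q * pd 1 (t 2) q" for q
  define s where "s = sgn (dJ p)"
  let ?O = "overlap c c'"
  have oO: "open ?O" and sT: "Csmooth ?O T" and sub: "?O \<subseteq> inner_cod c"
    using open_overlap[OF c] transition_smooth[OF c] overlap_inner_cod[OF c] by (auto simp: T_def)
  have p: "p \<in> ?O" "T p = chart_map c' x"
    using x by (auto simp: overlap_def p_def T_def transition_def chart_inv_map[OF c(1)])
  have st: "Csmooth ?O (t i)" for i
    unfolding t_def[abs_def] by (rule Csmooth_nth[OF oO sT])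
  have sV: "Csmooth (inner_cod c') (V k)" for k
    unfolding V_def by (intro Csmooth_mult open_inner_cod c vol_density_smooth sm)
  have dV: "V k differentiable (at (T q))" if "q \<in> ?O" for k q
    using Csmooth_imp_differentiable[OF open_inner_cod[OF c(2)] sV] transition_inner_cod[OF c that] by (simp add: T_def)
  have dT: "T differentiable (at q)" if "q \<in> ?O" for q
    using Csmooth_imp_differentiable[OF oO sT that] .
  have J: "jacobian c c' (chart_inv c q) $ k $ i = pd i (t k) q" if q: "q \<in> ?O" for q k i
  proof -
    have "chart_inv c q \<in> chart_dom c \<inter> chart_dom c' \<inter> inner_pts" "chart_map c (chart_inv c q) = q"
      using q by (auto simp: overlap_def chart_inv_map[OF c(1)])
    then have "jacobian c c' (chart_inv c q) $ k $ i = pd i T q $ k"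
      using jacobian_inner[OF c, of "chart_inv c q" k i] by (simp add: T_def)
    also have "\<dots> = pd i (t k) q"
      unfolding t_def[abs_def] using pd_bounded_linear(2)[OF bounded_linear_vec_nth dT[OF q]] by simp
    finally show ?thesis .
  qed
  have key: "vol_density c q = \<bar>dJ q\<bar> * vol_density c' (T q)" "dJ q \<noteq> 0"
    "vol_density c q * X c (chart_inv c q) $ 1
      = sgn (dJ q) * (pd 2 (t 2) q * V 1 (T q) - pd 2 (t 1) q * V 2 (T q))"
    "vol_density c q * X c (chart_inv c q) $ 2
      = sgn (dJ q) * (pd 1 (t 1) q * V 2 (T q) - pd 1 (t 2) q * V 1 (T q))"
    if q: "q \<in> ?O" for q
  proof -
    define y where "y = chart_inv c q"
    have y: "y \<in> chart_dom c" "y \<in> chart_dom c'" "y \<in> inner_pts" "y \<in> chart_dom c \<inter> chart_dom c'"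
      using q by (auto simp: y_def overlap_def chart_inv_map[OF c(1)])
    have y': "chart_inv c' (T q) = y" using transition_inv[OF c q] by (simp add: T_def y_def)
    have d: "det (jacobian c c' y) = dJ q" using J[OF q] by (simp add: det_2 dJ_def y_def)
    then show "dJ q \<noteq> 0" using det_metric_transform(2)[OF c y(4)] by simp
    show v: "vol_density c q = \<bar>dJ q\<bar> * vol_density c' (T q)"
      using det_metric_transform(1)[OF c y(4)] d
      by (simp add: vol_density_def y' y_def[symmetric] real_sqrt_mult)
    have X': "X c' y $ k = pd 1 (t k) q * X c y $ 1 + pd 2 (t k) q * X c y $ 2" for k
      using vector_fieldD[OF X c y(1,2,3)] J[OF q] by (simp add: matrix_vector_2 y_def)
    \<comment> \<open>Cramer's rule for the inverse of the Jacobian.\<close>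
    have "\<bar>dJ q\<bar> = sgn (dJ q) * dJ q" by (simp add: abs_sgn)
    moreover have "dJ q * X c y $ 1 = pd 2 (t 2) q * X c' y $ 1 - pd 2 (t 1) q * X c' y $ 2"
      "dJ q * X c y $ 2 = pd 1 (t 1) q * X c' y $ 2 - pd 1 (t 2) q * X c' y $ 1"
      by (simp_all add: X' dJ_def algebra_simps)
    ultimately have *: "\<bar>dJ q\<bar> * X c y $ 1 = sgn (dJ q) * (pd 2 (t 2) q * X c' y $ 1 - pd 2 (t 1) q * X c' y $ 2)"
      "\<bar>dJ q\<bar> * X c y $ 2 = sgn (dJ q) * (pd 1 (t 1) q * X c' y $ 2 - pd 1 (t 2) q * X c' y $ 1)"
      by simp_all
    show "vol_density c q * X c (chart_inv c q) $ 1
      = sgn (dJ q) * (pd 2 (t 2) q * V 1 (T q) - pd 2 (t 1) q * V 2 (T q))"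
      using arg_cong[OF *(1), of "\<lambda>z. vol_density c' (T q) * z"] v y'
      by (simp add: V_def y_def[symmetric] algebra_simps)
    show "vol_density c q * X c (chart_inv c q) $ 2
      = sgn (dJ q) * (pd 1 (t 1) q * V 2 (T q) - pd 1 (t 2) q * V 1 (T q))"
      using arg_cong[OF *(2), of "\<lambda>z. vol_density c' (T q) * z"] v y'
      by (simp add: V_def y_def[symmetric] algebra_simps)
  qed
  have sdJ: "Csmooth ?O dJ"
    unfolding dJ_def[abs_def] by (intro Csmooth_diff Csmooth_mult oO Csmooth_pd st)
  \<comment> \<open>A neighbourhood on which the Jacobian determinant has constant sign.\<close>
  define N where "N = ?O \<inter> (\<lambda>q. s * dJ q) -` {0<..}"
  have oN: "open N" unfolding N_def
    by (rule continuous_open_preimage[OF _ oO])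
      (auto intro!: continuous_intros Csmooth_imp_continuous_on[OF sdJ])
  have pN: "p \<in> N" using p(1) key(2)[OF p(1)] by (auto simp: N_def s_def sgn_mult_self_eq sgn_if)
  have sN: "sgn (dJ q) = s" if "q \<in> N" for q
    using that key(2)[OF p(1)] by (auto simp: N_def s_def sgn_if zero_less_mult_iff split: if_splits)
  have dA: "(\<lambda>q. pd i (t k) q * V l (T q)) differentiable (at p)" for i k l
    by (rule differentiable_mult[OF Csmooth_imp_differentiable[OF oO Csmooth_pd[OF st] p(1)]
        pd_compose(1)[OF dT[OF p(1)] dV[OF p(1)]]])
  have e1: "pd 1 (\<lambda>q. vol_density c q * X c (chart_inv c q) $ 1) p
      = s * pd 1 (\<lambda>q. pd 2 (t 2) q * V 1 (T q) - pd 2 (t 1) q * V 2 (T q)) p"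
  proof -
    have "pd 1 (\<lambda>q. vol_density c q * X c (chart_inv c q) $ 1) p
      = pd 1 (\<lambda>q. s * (pd 2 (t 2) q * V 1 (T q) - pd 2 (t 1) q * V 2 (T q))) p"
      by (rule pd_cong[OF oN pN]) (use key(3) sN in \<open>auto simp: N_def\<close>)
    also have "\<dots> = s * pd 1 (\<lambda>q. pd 2 (t 2) q * V 1 (T q) - pd 2 (t 1) q * V 2 (T q)) p"
      by (intro pd_cmult differentiable_diff dA)
    finally show ?thesis .
  qed
  have e2: "pd 2 (\<lambda>q. vol_density c q * X c (chart_inv c q) $ 2) p
      = s * pd 2 (\<lambda>q. pd 1 (t 1) q * V 2 (T q) - pd 1 (t 2) q * V 1 (T q)) p"
  proof -
    have "pd 2 (\<lambda>q. vol_density c q * X c (chart_inv c q) $ 2) p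
      = pd 2 (\<lambda>q. s * (pd 1 (t 1) q * V 2 (T q) - pd 1 (t 2) q * V 1 (T q))) p"
      by (rule pd_cong[OF oN pN]) (use key(4) sN in \<open>auto simp: N_def\<close>)
    also have "\<dots> = s * pd 2 (\<lambda>q. pd 1 (t 1) q * V 2 (T q) - pd 1 (t 2) q * V 1 (T q)) p"
      by (intro pd_cmult differentiable_diff dA)
    finally show ?thesis .
  qed
  have "pd 1 (\<lambda>q. vol_density c q * X c (chart_inv c q) $ 1) p
      + pd 2 (\<lambda>q. vol_density c q * X c (chart_inv c q) $ 2) p
    = s * dJ p * (pd 1 (V 1) (T p) + pd 2 (V 2) (T p))"
    using divergence_piola[OF oO p(1) sT dV[OF p(1)] dV[OF p(1)], of 1 2]
    unfolding e1 e2 by (simp add: t_def[abs_def] dJ_def distrib_left[symmetric])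
  moreover have "s * dJ p = \<bar>dJ p\<bar>" by (simp add: s_def abs_sgn mult.commute)
  ultimately have "(pd 1 (\<lambda>q. vol_density c q * X c (chart_inv c q) $ 1) p
      + pd 2 (\<lambda>q. vol_density c q * X c (chart_inv c q) $ 2) p) / vol_density c p
    = (pd 1 (V 1) (T p) + pd 2 (V 2) (T p)) / vol_density c' (T p)"
    using key(1,2)[OF p(1)] by simp
  then show ?thesis by (simp only: sum_2 p(2) V_def p_def[symmetric])
qed

lemma laplace_beltrami_chart:
  assumes f: "test_function A \<Omega> f" and c: "c \<in> A" and p: "p \<in> inner_cod c"
  shows "laplace_beltrami A g f (chart_inv c p)
    = (\<Sum>i\<in>UNIV. pd i (\<lambda>q. vol_density c q * gradient g f c (chart_inv c q) $ i) p) / vol_density c p"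
proof -
  define x where "x = chart_inv c p"
  have x: "x \<in> chart_dom c" "x \<in> inner_pts" "chart_map c x = p"
    using inner_cod_inv[OF c p] inner_cod_map_inv[OF c p] by (auto simp: x_def)
  define b where "b = chart_at A x"
  have b: "b \<in> A" "x \<in> chart_dom b" using chart_at[of x] by (auto simp: b_def)
  have q: "chart_map b x \<in> inner_cod b" using b x by (auto simp: inner_cod_def)
  have "laplace_beltrami A g f x
      = (\<Sum>i\<in>UNIV. pd i (\<lambda>q. vol_density b q * gradient g f b (chart_inv b q) $ i) (chart_map b x))
        / vol_density b (chart_map b x)"
    unfolding laplace_beltrami_def divergence_def Let_def b_def[symmetric]
    by (simp add: partial_within_inner_cod[OF b(1) q] vol_density_def chart_inv_map[OF b])
  also have "\<dots> = (\<Sum>i\<in>UNIV. pd i (\<lambda>q. vol_density c q * gradient g f c (chart_inv c q) $ i) (chart_map c x))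
        / vol_density c (chart_map c x)"
    by (rule divergence_transform[OF b(1) c _ gradient_vector_field[OF f] gradient_smooth[OF f c]])
      (use x b in blast)
  finally show ?thesis unfolding x(3) by (simp only: x_def)
qed

lemma laplace_continuous:
  assumes f: "test_function A \<Omega> f"
  shows "continuous_on UNIV (laplace_beltrami A g f)"
proof (rule continuous_if_compact_support[OF test_supp(1,3)[OF f] test_laplace_eq_0[OF f]])
  fix c assume c: "c \<in> A"
  have "continuous_on (inner_cod c) (\<lambda>p. (\<Sum>i\<in>UNIV.
      pd i (\<lambda>q. vol_density c q * gradient g f c (chart_inv c q) $ i) p) / vol_density c p)"
    by (intro Csmooth_imp_continuous_on Csmooth_divide_pos Csmooth_sum Csmooth_pd Csmooth_mult open_inner_cod c
        vol_density_smooth gradient_smooth[OF f] vol_density_pos) (use inner_cod_subset in blast)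
  then show "continuous_on (inner_cod c) (\<lambda>p. laplace_beltrami A g f (chart_inv c p))"
    using continuous_on_cong[of "inner_cod c" "inner_cod c" "\<lambda>p. laplace_beltrami A g f (chart_inv c p)"]
      laplace_beltrami_chart[OF f c] by simp
qed

lemma gradient_lincomb:
  assumes f: "test_function A \<Omega> f" and h: "test_function A \<Omega> h" and c: "c \<in> A" "x \<in> chart_dom c"
  shows "gradient g (\<lambda>x. f x + a * h x) c x = gradient g f c x + a *\<^sub>R gradient g h c x"
proof -
  have "differential (\<lambda>x. f x + a * h x) c x = differential f c x + a *\<^sub>R differential h c x"
  proof (cases "x \<in> supp f \<union> supp h")
    case True
    then have x: "x \<in> chart_dom c \<inter> inner_pts" using test_supp(3) f h c by blast
    then have p: "chart_map c x \<in> inner_cod c" by (simp add: inner_cod_def)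
    note d = test_differentiable[OF f c(1) p] test_differentiable[OF h c(1) p]
    show ?thesis
      using d by (simp add: vec_eq_iff differential_inner[OF c(1) x] comp_def pd_add pd_cmult differentiable_mult)
  next
    case False
    have "differential (\<lambda>x. f x + a * h x) c x = 0"
      by (rule differential_eq_0[OF c, of "- supp f \<inter> - supp h"])
        (use False test_supp(4)[OF f] test_supp(4)[OF h] test_supp_0[OF f] test_supp_0[OF h] in auto)
    then show ?thesis using test_gradient_eq_0(2)[OF f _ c] test_gradient_eq_0(2)[OF h _ c] False by simp
  qed
  then show ?thesis
    by (simp add: gradient_def matrix_vector_right_distrib matrix_vector_mult_scaleR)
qed

lemma gradient_mult:
  assumes f: "test_function A \<Omega> f" and h: "test_function A \<Omega>' h" and c: "c \<in> A" "x \<in> chart_dom c"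
  shows "gradient g (\<lambda>x. f x * h x) c x = f x *\<^sub>R gradient g h c x + h x *\<^sub>R gradient g f c x"
proof -
  have "differential (\<lambda>x. f x * h x) c x = f x *\<^sub>R differential h c x + h x *\<^sub>R differential f c x"
  proof (cases "x \<in> supp f")
    case True
    then have x: "x \<in> chart_dom c \<inter> inner_pts" using test_supp(3) f c by blast
    then have p: "chart_map c x \<in> inner_cod c" by (simp add: inner_cod_def)
    note d = test_differentiable[OF f c(1) p] test_differentiable[OF h c(1) p]
    show ?thesis
      using d by (simp add: vec_eq_iff differential_inner[OF c(1) x] comp_def pd_mult chart_inv_map[OF c])
  next
    case False
    have "differential (\<lambda>x. f x * h x) c x = 0"
      by (rule differential_eq_0[OF c, of "- supp f"])
        (use False test_supp(4)[OF f] test_supp_0[OF f] in auto)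
    then show ?thesis using test_gradient_eq_0(2)[OF f False c] test_supp_0[OF f False] by simp
  qed
  then show ?thesis
    by (simp add: gradient_def matrix_vector_right_distrib matrix_vector_mult_scaleR)
qed

text \<open>The product rule for the divergence, applied to \<open>\<nabla>(f\<^sup>2) = 2 f \<nabla>f\<close>. It holds chart by chart, and in
  particular in the chart in which the Laplacian is evaluated.\<close>

lemma laplace_square:
  assumes f: "test_function A \<Omega> f"
  shows "laplace_beltrami A g (\<lambda>x. f x * f x) x
    = 2 * f x * laplace_beltrami A g f x + 2 * metric_inner A g (gradient g f) (gradient g f) x"
proof (cases "x \<in> supp f")
  case False
  have "supp (\<lambda>x. f x * f x) = supp f" by (simp add: supp_def)
  then show ?thesis
    using False test_laplace_eq_0[OF f False] test_laplace_eq_0[OF test_function_mult[OF f f]]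
      metric_inner_gradient_eq_0[OF f False] by simp
next
  case True
  define c where "c = chart_at A x"
  have c: "c \<in> A" "x \<in> chart_dom c" using chart_at[of x] by (auto simp: c_def)
  define p where "p = chart_map c x"
  have p: "p \<in> inner_cod c" "chart_inv c p = x"
    using c True test_supp(3)[OF f] by (auto simp: inner_cod_def p_def chart_inv_map)
  define F where "F q = f (chart_inv c q)" for q
  define V where "V i q = vol_density c q * gradient g f c (chart_inv c q) $ i" for i q
  have sF: "Csmooth (inner_cod c) F" unfolding F_def[abs_def] by (rule test_function_smooth[OF f c(1)])
  have sV: "Csmooth (inner_cod c) (V i)" for i unfolding V_def[abs_def]
    by (intro Csmooth_mult open_inner_cod c vol_density_smooth gradient_smooth[OF f])
  note d = Csmooth_imp_differentiable[OF open_inner_cod[OF c(1)] sF p(1)]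
    Csmooth_imp_differentiable[OF open_inner_cod[OF c(1)] sV p(1)]
  have e: "pd i (\<lambda>q. vol_density c q * gradient g (\<lambda>x. f x * f x) c (chart_inv c q) $ i) p
      = 2 * F p * pd i (V i) p + 2 * pd i F p * V i p" for i
  proof -
    have "pd i (\<lambda>q. vol_density c q * gradient g (\<lambda>x. f x * f x) c (chart_inv c q) $ i) p
        = pd i (\<lambda>q. (2 * F q) * V i q) p"
    proof (rule pd_cong[OF open_inner_cod[OF c(1)] p(1)])
      fix q assume "q \<in> inner_cod c"
      then have "chart_inv c q \<in> chart_dom c" using inner_cod_inv[OF c(1)] by blast
      then show "vol_density c q * gradient g (\<lambda>x. f x * f x) c (chart_inv c q) $ i = 2 * F q * V i q"
        by (simp add: gradient_mult[OF f f c(1)] F_def V_def)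
    qed
    also have "\<dots> = 2 * F p * pd i (V i) p + 2 * pd i F p * V i p"
      using d by (simp add: pd_mult pd_cmult differentiable_mult)
    finally show ?thesis .
  qed
  have dens: "vol_density c p > 0" using vol_density_pos[OF c(1)] inner_cod_subset p(1) by blast
  have inner: "metric_inner A g (gradient g f) (gradient g f) x * vol_density c p = pd 1 F p * V 1 p + pd 2 F p * V 2 p"
    using metric_inner_gradient[OF f f c] differential_chart[OF c(1) p(1), of f] p(2)
    by (simp add: inner_2 F_def[abs_def] V_def algebra_simps)
  have lap: "laplace_beltrami A g f x * vol_density c p = pd 1 (V 1) p + pd 2 (V 2) p"
    using laplace_beltrami_chart[OF f c(1) p(1)] dens p(2) by (simp add: sum_2 V_def[abs_def])
  have "laplace_beltrami A g (\<lambda>x. f x * f x) x * vol_density c p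
      = pd 1 (\<lambda>q. vol_density c q * gradient g (\<lambda>x. f x * f x) c (chart_inv c q) $ 1) p
      + pd 2 (\<lambda>q. vol_density c q * gradient g (\<lambda>x. f x * f x) c (chart_inv c q) $ 2) p"
    using laplace_beltrami_chart[OF test_function_mult[OF f f] c(1) p(1)] dens p(2) by (simp add: sum_2)
  also have "\<dots> = 2 * F p * (pd 1 (V 1) p + pd 2 (V 2) p) + 2 * (pd 1 F p * V 1 p + pd 2 F p * V 2 p)"
    unfolding e by (simp add: algebra_simps)
  also have "\<dots> = (2 * f x * laplace_beltrami A g f x
      + 2 * metric_inner A g (gradient g f) (gradient g f) x) * vol_density c p"
    unfolding inner[symmetric] lap[symmetric] by (simp add: F_def p(2) algebra_simps)
  finally show ?thesis using dens by simp
qed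

end

section \<open>The Riemannian measure\<close>

lemma smooth_on_imp_continuous_on:
  assumes "smooth_on S f"
  shows "continuous_on S f"
proof -
  have "continuous (at p within S) f" if "p \<in> S" for p
  proof -
    from bspec[OF assms[unfolded smooth_on_def] that]
    obtain W F where W: "open W" "p \<in> W" "\<forall>k. Ck_on k W F" "\<forall>q\<in>W \<inter> S. F q = f q"
      by (elim exE conjE)
    have "continuous_on W F" using W(3) by (metis Ck_on.simps(1))
    then have "continuous_on (S \<inter> W) f"
      using continuous_on_cong[of "S \<inter> W" "S \<inter> W" f F] W(4) continuous_on_subset[of W F "S \<inter> W"] by auto
    then have "continuous (at p within S \<inter> W) f"
      using W(2) that by (simp add: continuous_on_eq_continuous_within)
    then show ?thesis
      using at_within_nhd[OF W(2,1), of "S \<inter> W" S] by (simp add: Int_commute Int_left_commute Int_assoc)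
  qed
  then show ?thesis by (simp add: continuous_on_eq_continuous_within)
qed

text \<open>By the theorem of Cayley and Hamilton, \<open>B\<^sup>2 = tr(B) B - det(B)\<close>. Pairing with \<open>v\<close>, respectively with
  \<open>B v\<close>, and dropping a term of known sign yields the two bounds.\<close>

lemma posdef_2_norm_bounds:
  fixes B :: "real^2^2"
  assumes "B$2$1 = B$1$2" "\<And>w. 0 \<le> w \<bullet> (B *v w)" "0 < det B"
  shows "(norm (B *v v))\<^sup>2 \<le> (B$1$1 + B$2$2) * (v \<bullet> (B *v v))"
    "det B * (v \<bullet> (B *v v)) \<le> (B$1$1 + B$2$2) * (norm (B *v v))\<^sup>2"
proof -
  have 1: "(norm (B *v v))\<^sup>2 = (B$1$1 + B$2$2) * (v \<bullet> (B *v v)) - det B * (norm v)\<^sup>2" for v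
    unfolding power2_norm_eq_inner inner_2 matrix_vector_2 det_2 assms(1)
    by (simp add: algebra_simps)
  show "(norm (B *v v))\<^sup>2 \<le> (B$1$1 + B$2$2) * (v \<bullet> (B *v v))"
    using 1[of v] assms(3) by simp
  have "det B * (v \<bullet> (B *v v)) = (B$1$1 + B$2$2) * (norm (B *v v))\<^sup>2 - (B *v v) \<bullet> (B *v (B *v v))"
    unfolding power2_norm_eq_inner inner_2 matrix_vector_2 det_2 assms(1)
    by (simp add: algebra_simps)
  then show "det B * (v \<bullet> (B *v v)) \<le> (B$1$1 + B$2$2) * (norm (B *v v))\<^sup>2"
    using assms(2)[of "B *v v"] by simp
qed

locale measured_surface = surface A g
  for A :: "'a::{second_countable_topology,t2_space} chart set" and g +
  fixes vol :: "'a measure"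
  assumes volume: "riemannian_volume A g vol"
begin

lemma sets_vol [measurable_cong, simp]: "sets vol = sets borel"
  using volume by (simp add: riemannian_volume_def)

lemma space_vol [simp]: "space vol = UNIV"
  using sets_eq_imp_space_eq[OF sets_vol] by simp

lemma borel_measurable_vol [simp]: "borel_measurable vol = borel_measurable borel"
  by (rule measurable_cong_sets) auto

lemma metric_continuous:
  assumes c: "c \<in> A"
  shows "continuous_on (chart_cod c) (\<lambda>p. g c (chart_inv c p))"
    "continuous_on (chart_dom c) (g c)" "continuous_on (chart_cod c) (vol_density c)"
proof -
  have "smooth_on (chart_cod c) (\<lambda>p. g c (chart_inv c p))"
    using riemannian c unfolding riemannian_surface_def riemannian_metric_def by blast
  then show 1: "continuous_on (chart_cod c) (\<lambda>p. g c (chart_inv c p))" by (rule smooth_on_imp_continuous_on)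
  have "continuous_on (chart_dom c) (\<lambda>x. g c (chart_inv c (chart_map c x)))"
    by (rule continuous_on_compose2[OF 1 chart_map_cont[OF c]]) auto
  then show "continuous_on (chart_dom c) (g c)"
    by (rule continuous_on_eq) (simp only: chart_inv_map[OF c])
  show "continuous_on (chart_cod c) (vol_density c)"
    unfolding vol_density_def[abs_def] det_2 by (intro continuous_intros 1)
qed

lemma half_plane_borel [measurable]: "half_plane \<in> sets borel"
proof -
  have "closed half_plane"
    unfolding half_plane_def by (intro closed_Collect_le continuous_intros)
  then show ?thesis by simp
qed

lemma chart_cod_borel: "c \<in> A \<Longrightarrow> chart_cod c \<in> sets borel"
  using chart_cod_openin[of c] half_plane_borel by (auto simp: openin_open)

text \<open>The constant value outside the chart image makes this map globally Borel measurable; the density of the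
  measure vanishes there.\<close>

definition total_inv :: "'a chart \<Rightarrow> real^2 \<Rightarrow> 'a" where
  "total_inv c p = (if p \<in> chart_cod c then chart_inv c p else undefined)"

lemma total_inv_measurable:
  assumes c: "c \<in> A"
  shows "total_inv c \<in> borel_measurable borel"
proof -
  have "(\<lambda>p. if p \<in> chart_cod c then chart_inv c p else undefined) \<in> borel_measurable borel"
    by (rule borel_measurable_continuous_on_if[OF chart_cod_borel[OF c] chart_inv_cont[OF c]]) simp
  then show ?thesis by (simp add: total_inv_def[abs_def])
qed

lemma density_measurable:
  assumes c: "c \<in> A"
  shows "(\<lambda>p. indicator (chart_cod c) p * ennreal (vol_density c p)) \<in> borel_measurable borel"
proof -
  have "(\<lambda>p. if p \<in> chart_cod c then vol_density c p else 0) \<in> borel_measurable borel"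
    by (rule borel_measurable_continuous_on_if[OF chart_cod_borel[OF c] metric_continuous(3)[OF c]]) simp
  then have "(\<lambda>p. ennreal (if p \<in> chart_cod c then vol_density c p else 0)) \<in> borel_measurable borel"
    by measurable
  also have "(\<lambda>p. ennreal (if p \<in> chart_cod c then vol_density c p else 0))
      = (\<lambda>p. indicator (chart_cod c) p * ennreal (vol_density c p))"
    by (auto simp: indicator_def)
  finally show ?thesis .
qed

lemma image_chart_iff:
  assumes "c \<in> A" "E \<subseteq> chart_dom c"
  shows "p \<in> chart_map c ` E \<longleftrightarrow> p \<in> chart_cod c \<and> chart_inv c p \<in> E"
proof
  assume "p \<in> chart_map c ` E"
  then show "p \<in> chart_cod c \<and> chart_inv c p \<in> E" using assms chart_inv_map[OF assms(1)] by auto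
next
  assume "p \<in> chart_cod c \<and> chart_inv c p \<in> E"
  then show "p \<in> chart_map c ` E" using chart_map_inv[OF assms(1), of p] by (metis imageI)
qed

text \<open>The defining property of the Riemannian measure, read as an identity of measures, which then extends to
  integrals.\<close>

lemma chart_measure_eq:
  assumes c: "c \<in> A"
  shows "density vol (indicator (chart_dom c))
    = distr (density lborel (\<lambda>p. indicator (chart_cod c) p * ennreal (vol_density c p))) borel (total_inv c)"
proof (rule measure_eqI)
  have dom: "chart_dom c \<in> sets borel" using chart_open[OF c] by simp
  note [measurable] = total_inv_measurable[OF c] density_measurable[OF c] dom
  fix E assume "E \<in> sets (density vol (indicator (chart_dom c)))"
  then have E[measurable]: "E \<in> sets borel" by simp
  have "emeasure (density vol (indicator (chart_dom c))) E = emeasure vol (E \<inter> chart_dom c)"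
    by (subst emeasure_density) (auto simp: indicator_inter_arith[symmetric] Int_commute simp flip: nn_integral_indicator)
  also have "\<dots> = (\<integral>\<^sup>+p\<in>chart_map c ` (E \<inter> chart_dom c). ennreal (vol_density c p) \<partial>lborel)"
    using volume c dom E unfolding riemannian_volume_def vol_density_def by auto
  also have "\<dots> = (\<integral>\<^sup>+p. indicator (chart_cod c) p * ennreal (vol_density c p) * indicator (total_inv c -` E) p \<partial>lborel)"
  proof (rule nn_integral_cong)
    fix p
    have "p \<in> chart_map c ` (E \<inter> chart_dom c) \<longleftrightarrow> p \<in> chart_cod c \<and> total_inv c p \<in> E"
      using image_chart_iff[OF c, of "E \<inter> chart_dom c" p] chart_inv_dom[OF c, of p] by (auto simp: total_inv_def)
    then show "ennreal (vol_density c p) * indicator (chart_map c ` (E \<inter> chart_dom c)) p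
      = indicator (chart_cod c) p * ennreal (vol_density c p) * indicator (total_inv c -` E) p"
      by (auto simp: indicator_def)
  qed
  also have "\<dots> = emeasure (distr (density lborel (\<lambda>p. indicator (chart_cod c) p * ennreal (vol_density c p)))
      borel (total_inv c)) E"
    using measurable_sets_borel[OF total_inv_measurable[OF c] E]
    by (subst emeasure_distr, simp_all, subst emeasure_density, auto)
  finally show "emeasure (density vol (indicator (chart_dom c))) E
    = emeasure (distr (density lborel (\<lambda>p. indicator (chart_cod c) p * ennreal (vol_density c p)))
      borel (total_inv c)) E" .
qed simp

lemma chart_change_of_variables:
  assumes c: "c \<in> A" and N: "N \<in> sets borel" "N \<subseteq> chart_dom c"
    and h: "(\<lambda>x. h x * indicator N x) \<in> borel_measurable borel"
  shows "(\<integral>\<^sup>+x\<in>N. h x \<partial>vol) = (\<integral>\<^sup>+p\<in>chart_map c ` N. ennreal (vol_density c p) * h (chart_inv c p) \<partial>lborel)"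
proof -
  have dom: "chart_dom c \<in> sets borel" using chart_open[OF c] by simp
  note [measurable] = total_inv_measurable[OF c] density_measurable[OF c] dom N(1) h
  have "(\<integral>\<^sup>+x\<in>N. h x \<partial>vol) = (\<integral>\<^sup>+x. indicator (chart_dom c) x * (h x * indicator N x) \<partial>vol)"
    using N(2) by (intro nn_integral_cong) (auto simp: indicator_def)
  also have "\<dots> = (\<integral>\<^sup>+x. h x * indicator N x \<partial>density vol (indicator (chart_dom c)))"
    by (rule nn_integral_density[symmetric]) auto
  also have "\<dots> = (\<integral>\<^sup>+p. indicator (chart_cod c) p * ennreal (vol_density c p)
      * (h (total_inv c p) * indicator N (total_inv c p)) \<partial>lborel)"
    unfolding chart_measure_eq[OF c]
    by (subst nn_integral_distr, simp_all, subst nn_integral_density) auto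
  also have "\<dots> = (\<integral>\<^sup>+p\<in>chart_map c ` N. ennreal (vol_density c p) * h (chart_inv c p) \<partial>lborel)"
    using image_chart_iff[OF c N(2)]
    by (intro nn_integral_cong) (auto simp: indicator_def total_inv_def)
  finally show ?thesis .
qed

text \<open>On compact sets of a chart, coordinate and Riemannian quantities are comparable. The constant is obtained
  from the density, its inverse, and the trace of the metric matrix with and without division by the
  determinant, all of which are continuous.\<close>

lemma chart_compact_bounds:
  assumes c: "c \<in> A" and P: "compact P" "P \<subseteq> chart_cod c"
  obtains C where "C > 0"
    "\<And>p. p \<in> P \<Longrightarrow> vol_density c p \<le> C" "\<And>p. p \<in> P \<Longrightarrow> 1 \<le> C * vol_density c p"
    "\<And>p v. p \<in> P \<Longrightarrow> (norm (g c (chart_inv c p) *v v))\<^sup>2 \<le> C * (v \<bullet> (g c (chart_inv c p) *v v))"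
    "\<And>p v. p \<in> P \<Longrightarrow> v \<bullet> (g c (chart_inv c p) *v v) \<le> C * (norm (g c (chart_inv c p) *v v))\<^sup>2"
proof -
  define G where "G p = g c (chart_inv c p)" for p
  have Gc: "continuous_on P G" and dc: "continuous_on P (vol_density c)"
    unfolding G_def[abs_def] using metric_continuous[OF c] P(2) continuous_on_subset by blast+
  have pos: "0 < vol_density c p" "0 < det (G p)" if "p \<in> P" for p
    using vol_density_pos[OF c] metric_posdef(3)[OF c chart_inv_dom[OF c]] P(2) that by (auto simp: G_def)
  have bdd: "\<exists>C>0. \<forall>p\<in>P. h p \<le> C" if "continuous_on P h" for h :: "real^2 \<Rightarrow> real"
  proof -
    have "bounded (h ` P)" by (intro compact_imp_bounded compact_continuous_image that P)
    then obtain C where C: "C > 0" "\<forall>y\<in>h ` P. norm y \<le> C" by (auto simp: bounded_pos)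
    have "\<forall>p\<in>P. h p \<le> C" using C(2) by (auto simp: abs_le_iff)
    then show ?thesis using C(1) by blast
  qed
  obtain C1 where C1: "C1 > 0" "\<forall>p\<in>P. vol_density c p \<le> C1" using bdd[OF dc] by blast
  have "continuous_on P (\<lambda>p. 1 / vol_density c p)"
    using pos(1) by (intro continuous_intros dc) (auto simp: less_le)
  then obtain C2 where C2: "C2 > 0" "\<forall>p\<in>P. 1 / vol_density c p \<le> C2" using bdd by blast
  have "continuous_on P (\<lambda>p. G p $1$1 + G p $2$2)" by (intro continuous_intros Gc)
  then obtain C3 where C3: "C3 > 0" "\<forall>p\<in>P. G p $1$1 + G p $2$2 \<le> C3" using bdd by blast
  have "continuous_on P (\<lambda>p. (G p $1$1 + G p $2$2) / det (G p))"
    unfolding det_2 by (intro continuous_intros Gc) (use pos(2) in \<open>auto simp: det_2 less_le\<close>)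
  then obtain C4 where C4: "C4 > 0" "\<forall>p\<in>P. (G p $1$1 + G p $2$2) / det (G p) \<le> C4" using bdd by blast
  define C where "C = C1 + C2 + C3 + C4"
  have C: "C > 0" "C1 \<le> C" "C2 \<le> C" "C3 \<le> C" "C4 \<le> C" using C1 C2 C3 C4 by (auto simp: C_def)
  show thesis
  proof (rule that[OF C(1)])
    fix p assume p: "p \<in> P"
    show "vol_density c p \<le> C" using C1 C p by force
    have "1 / vol_density c p \<le> C" using C2 C p by force
    then show "1 \<le> C * vol_density c p" using pos(1)[OF p] by (simp add: divide_le_eq)
    fix v
    have d: "chart_inv c p \<in> chart_dom c" using chart_inv_dom[OF c] P(2) p by blast
    have nn: "0 \<le> w \<bullet> (G p *v w)" for w
      using metric_posdef(2)[OF c d, of w] by (cases "w = 0") (auto simp: G_def)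
    have sym: "G p $2$1 = G p $1$2" using metric_posdef(4)[OF c d] by (simp add: G_def)
    note b = posdef_2_norm_bounds[OF sym nn pos(2)[OF p], of v]
    have "(G p $1$1 + G p $2$2) * (v \<bullet> (G p *v v)) \<le> C * (v \<bullet> (G p *v v))"
      using C3 C p by (intro mult_right_mono nn) force
    then show "(norm (g c (chart_inv c p) *v v))\<^sup>2 \<le> C * (v \<bullet> (g c (chart_inv c p) *v v))"
      using b(1) by (simp add: G_def)
    have "v \<bullet> (G p *v v) \<le> (G p $1$1 + G p $2$2) / det (G p) * (norm (G p *v v))\<^sup>2"
      using b(2) pos(2)[OF p] by (simp add: field_simps)
    also have "\<dots> \<le> C * (norm (G p *v v))\<^sup>2"
      using C4 C p by (intro mult_right_mono) force+
    finally show "v \<bullet> (g c (chart_inv c p) *v v) \<le> C * (norm (g c (chart_inv c p) *v v))\<^sup>2"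
      by (simp add: G_def)
  qed
qed

lemma vol_compact_chart_finite:
  assumes c: "c \<in> A" and P: "compact P" "P \<subseteq> chart_cod c"
  shows "emeasure vol (chart_inv c ` P) < \<infinity>"
proof -
  have cK: "compact (chart_inv c ` P)"
    by (intro compact_continuous_image P continuous_on_subset[OF chart_inv_cont[OF c] P(2)])
  have sub: "chart_inv c ` P \<subseteq> chart_dom c" using P(2) chart_inv_dom[OF c] by blast
  have im: "chart_map c ` (chart_inv c ` P) = P"
    using P(2) chart_map_inv[OF c] by (force simp: image_def)
  obtain C where C: "C > 0" "\<And>p. p \<in> P \<Longrightarrow> vol_density c p \<le> C"
    using chart_compact_bounds[OF c P] by metis
  have "emeasure vol (chart_inv c ` P) = (\<integral>\<^sup>+p\<in>P. ennreal (vol_density c p) \<partial>lborel)"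
    using volume c sub cK im unfolding riemannian_volume_def vol_density_def
    by (auto dest!: compact_imp_closed)
  also have "\<dots> \<le> (\<integral>\<^sup>+p\<in>P. ennreal C \<partial>lborel)"
    using C(2) by (intro nn_integral_mono) (auto simp: indicator_def ennreal_leI)
  also have "\<dots> = ennreal C * emeasure lborel P"
    using P(1) by (intro nn_integral_cmult_indicator) (simp add: compact_imp_closed)
  also have "\<dots> < \<infinity>"
    using emeasure_compact_finite[OF P(1)] by (simp add: ennreal_mult_less_top)
  finally show ?thesis .
qed

lemma chart_ball_exists:
  assumes "x \<in> S" "open S" "S \<subseteq> inner_pts"
  shows "\<exists>c r. c \<in> A \<and> x \<in> chart_dom c \<and> 0 < r \<and> cball (chart_map c x) r \<subseteq> inner_cod c
    \<and> chart_inv c ` cball (chart_map c x) r \<subseteq> S \<and> open (chart_inv c ` ball (chart_map c x) r)"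
proof -
  define c where "c = chart_at A x"
  have c: "c \<in> A" "x \<in> chart_dom c" using chart_at[of x] by (auto simp: c_def)
  have "open (chart_map c ` (chart_dom c \<inter> S))"
    by (rule chart_image_open[OF c(1)]) (use assms chart_open[OF c(1)] in auto)
  moreover have "chart_map c x \<in> chart_map c ` (chart_dom c \<inter> S)" using c assms by blast
  ultimately obtain r where r: "r > 0" "cball (chart_map c x) r \<subseteq> chart_map c ` (chart_dom c \<inter> S)"
    using open_contains_cball by blast
  have sub: "chart_map c ` (chart_dom c \<inter> S) \<subseteq> inner_cod c" using assms(3) by (auto simp: inner_cod_def)
  have inv: "chart_inv c ` chart_map c ` (chart_dom c \<inter> S) \<subseteq> chart_dom c \<inter> S"
    using chart_inv_map[OF c(1)] by auto
  have "chart_inv c ` ball (chart_map c x) r = {y \<in> chart_dom c. chart_map c y \<in> ball (chart_map c x) r}"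
    (is "?L = ?R")
  proof
    show "?L \<subseteq> ?R"
    proof
      fix y assume "y \<in> ?L"
      then obtain p where p: "p \<in> ball (chart_map c x) r" "y = chart_inv c p" by blast
      then have "p \<in> inner_cod c" using r(2) sub by (meson ball_subset_cball subsetD)
      then show "y \<in> ?R" using p inner_cod_inv[OF c(1)] inner_cod_map_inv[OF c(1)] by auto
    qed
    show "?R \<subseteq> ?L" using chart_inv_map[OF c(1)] by (force simp: image_def)
  qed
  then have "open (chart_inv c ` ball (chart_map c x) r)"
    using chart_map_preimage_open[OF c(1) open_ball] by simp
  then show ?thesis
    using c r sub inv by (intro exI[of _ c] exI[of _ r]) blast
qed

lemma vol_compact_finite:
  assumes K: "compact K" "K \<subseteq> inner_pts"
  shows "emeasure vol K < \<infinity>"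
proof -
  define \<B> where "\<B> = {chart_inv c ` ball p r |c p r. c \<in> A \<and> cball p r \<subseteq> inner_cod c \<and> open (chart_inv c ` ball p r)}"
  have "K \<subseteq> \<Union>\<B>"
  proof
    fix x assume "x \<in> K"
    then have "x \<in> inner_pts" using K(2) by blast
    then obtain c r where c: "c \<in> A" "x \<in> chart_dom c" "0 < r" "cball (chart_map c x) r \<subseteq> inner_cod c"
      "open (chart_inv c ` ball (chart_map c x) r)"
      using chart_ball_exists[OF _ open_inner_pts] by blast
    have "x \<in> chart_inv c ` ball (chart_map c x) r"
      using chart_inv_map[OF c(1,2)] c(3) by (metis centre_in_ball imageI)
    then show "x \<in> \<Union>\<B>" using c unfolding \<B>_def by blast
  qed
  moreover have "\<And>B. B \<in> \<B> \<Longrightarrow> open B" by (auto simp: \<B>_def)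
  ultimately obtain F where F: "F \<subseteq> \<B>" "finite F" "K \<subseteq> \<Union>F"
    using compactE[OF K(1), of \<B>] by blast
  have fin: "emeasure vol B < \<infinity>" if B: "B \<in> F" for B
  proof -
    obtain c p r where c: "B = chart_inv c ` ball p r" "c \<in> A" "cball p r \<subseteq> inner_cod c"
      using B F(1) unfolding \<B>_def by blast
    have sub: "cball p r \<subseteq> chart_cod c" using c(3) inner_cod_subset by blast
    have "compact (chart_inv c ` cball p r)"
      by (intro compact_continuous_image compact_cball continuous_on_subset[OF chart_inv_cont[OF c(2)] sub])
    then have "emeasure vol B \<le> emeasure vol (chart_inv c ` cball p r)"
      unfolding c(1) by (intro emeasure_mono image_mono ball_subset_cball) (simp add: compact_imp_closed)
    also have "\<dots> < \<infinity>" by (rule vol_compact_chart_finite[OF c(2) compact_cball sub])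
    finally show ?thesis .
  qed
  have meas: "F \<subseteq> sets vol" using F(1) by (auto simp: \<B>_def)
  have "emeasure vol K \<le> emeasure vol (\<Union>F)"
    using F(2,3) meas by (intro emeasure_mono sets.finite_Union) auto
  also have "\<dots> \<le> (\<Sum>B\<in>F. emeasure vol B)"
    using emeasure_subadditive_finite[OF F(2), of "\<lambda>B. B"] meas by auto
  also have "\<dots> < \<infinity>" using fin F(2) by (simp add: less_top)
  finally show ?thesis .
qed

lemma bounded_if_compact_support:
  fixes h :: "'a \<Rightarrow> real"
  assumes "continuous_on UNIV h" "compact K" "\<And>x. x \<notin> K \<Longrightarrow> h x = 0"
  shows "\<exists>B>0. \<forall>x. \<bar>h x\<bar> \<le> B"
proof -
  have "bounded (h ` K)"
    by (intro compact_imp_bounded compact_continuous_image continuous_on_subset[OF assms(1)] assms(2)) auto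
  then obtain B where B: "B > 0" "\<forall>y\<in>h ` K. norm y \<le> B" by (auto simp: bounded_pos)
  have "\<bar>h x\<bar> \<le> B" for x using B assms(3)[of x] by (cases "x \<in> K") auto
  then show ?thesis using B(1) by blast
qed

lemma integrable_continuous_compact:
  fixes h :: "'a \<Rightarrow> real"
  assumes h: "continuous_on UNIV h" and K: "compact K" "K \<subseteq> inner_pts" "\<And>x. x \<notin> K \<Longrightarrow> h x = 0"
  shows "integrable vol h"
proof -
  obtain B where B: "B > 0" "\<And>x. \<bar>h x\<bar> \<le> B" using bounded_if_compact_support[OF h K(1,3)] by blast
  show ?thesis
  proof (rule Bochner_Integration.integrable_bound)
    show "integrable vol (\<lambda>x. B * indicator K x)"
      using vol_compact_finite[OF K(1,2)] K(1)
      by (intro integrable_mult_right) (simp add: integrable_indicator_iff compact_imp_closed)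
    show "AE x in vol. norm (h x) \<le> norm (B * indicator K x)"
      using B K(3) by (intro AE_I2) (auto simp: indicator_def)
    show "h \<in> borel_measurable vol" using borel_measurable_continuous_onI[OF h] by simp
  qed
qed

lemma set_integrable_mult_continuous:
  fixes h w :: "'a \<Rightarrow> real"
  assumes h: "continuous_on UNIV h" and K: "compact K" "\<And>x. x \<notin> K \<Longrightarrow> h x = 0"
    and w: "set_integrable vol S w"
  shows "set_integrable vol S (\<lambda>x. w x * h x)"
proof -
  obtain B where B: "B > 0" "\<And>x. \<bar>h x\<bar> \<le> B" using bounded_if_compact_support[OF h K] by blast
  have w': "integrable vol (\<lambda>x. indicator S x *\<^sub>R w x)" using w by (simp add: set_integrable_def)
  have hm: "h \<in> borel_measurable borel" by (rule borel_measurable_continuous_onI[OF h])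
  have wm: "(\<lambda>x. indicator S x *\<^sub>R w x) \<in> borel_measurable borel"
    using borel_measurable_integrable[OF w'] by simp
  have "integrable vol (\<lambda>x. (indicator S x *\<^sub>R w x) * h x)"
  proof (rule Bochner_Integration.integrable_bound)
    show "integrable vol (\<lambda>x. B * (indicator S x *\<^sub>R w x))" using w' by (rule integrable_mult_right)
    show "AE x in vol. norm ((indicator S x *\<^sub>R w x) * h x) \<le> norm (B * (indicator S x *\<^sub>R w x))"
    proof (rule AE_I2)
      fix x
      have "\<bar>h x\<bar> * \<bar>indicator S x *\<^sub>R w x\<bar> \<le> B * \<bar>indicator S x *\<^sub>R w x\<bar>"
        by (rule mult_right_mono[OF B(2)]) simp
      then show "norm ((indicator S x *\<^sub>R w x) * h x) \<le> norm (B * (indicator S x *\<^sub>R w x))"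
        using B(1) by (simp add: abs_mult mult_ac)
    qed
    show "(\<lambda>x. (indicator S x *\<^sub>R w x) * h x) \<in> borel_measurable vol"
      using borel_measurable_times[OF wm hm] by simp
  qed
  then show ?thesis by (simp add: set_integrable_def mult.assoc)
qed

text \<open>By the Lindeloef property countably many charts suffice, whatever the cardinality of the atlas.\<close>

lemma set_measurable_local:
  fixes h :: "'a \<Rightarrow> 'b::real_normed_vector"
  assumes "open \<Omega>" "\<And>c. c \<in> A \<Longrightarrow> set_borel_measurable borel (chart_dom c \<inter> \<Omega>) h"
  shows "set_borel_measurable borel \<Omega> h"
proof -
  have "\<And>S. S \<in> chart_dom ` A \<Longrightarrow> open S" using chart_open by auto
  then obtain F where F: "F \<subseteq> chart_dom ` A" "countable F" "\<Union>F = \<Union>(chart_dom ` A)"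
    using Lindelof[of "chart_dom ` A"] by blast
  have cover: "\<Union>F = UNIV" using F(3) chart_at by blast
  show ?thesis
    unfolding set_borel_measurable_def
  proof (rule measurable_piecewise_restrict[OF F(2)])
    show "S \<inter> space borel \<in> sets borel" if "S \<in> F" for S using that F(1) chart_open by auto
    show "space borel \<subseteq> \<Union>F" using cover by simp
    fix S assume "S \<in> F"
    then obtain c where c: "c \<in> A" "S = chart_dom c" using F(1) by blast
    have S: "S \<inter> space borel \<in> sets borel" using chart_open[OF c(1)] c(2) by simp
    have "(\<lambda>x. indicator S x *\<^sub>R (indicator \<Omega> x *\<^sub>R h x)) \<in> borel_measurable borel"
      using assms(2)[OF c(1)] unfolding set_borel_measurable_def c(2) by (simp add: indicator_inter_arith)
    then show "(\<lambda>x. indicator \<Omega> x *\<^sub>R h x) \<in> borel_measurable (restrict_space borel S)"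
      using borel_measurable_restrict_space_iff[OF S] by blast
  qed
qed

end

section \<open>Square integrable functions and fields\<close>

context measured_surface
begin

text \<open>The part of \<open>W12\<close> that concerns the field only; with it the weak gradient can be treated separately.\<close>

definition L2_field :: "'a set \<Rightarrow> 'a vfield \<Rightarrow> bool" where
  "L2_field \<Omega> X \<longleftrightarrow> vector_field_on A \<Omega> X
     \<and> (\<forall>c\<in>A. set_borel_measurable borel (chart_dom c \<inter> \<Omega>) (X c))
     \<and> set_integrable vol \<Omega> (metric_inner A g X X)"

lemma nth_measurable:
  "f \<in> borel_measurable M \<Longrightarrow> (\<lambda>x. f x $ i) \<in> borel_measurable M" for f :: "_ \<Rightarrow> 'b::euclidean_space^2"
  by (rule measurable_compose[of f M borel "\<lambda>v. v $ i"])
    (auto intro!: borel_measurable_continuous_onI continuous_intros)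

text \<open>The inner product of fields is evaluated in an arbitrarily chosen chart at each point. It is measurable
  because for vector fields it does not depend on the chart.\<close>

lemma metric_inner_measurable:
  assumes \<Omega>: "open \<Omega>" and X: "vector_field_on A \<Omega> X" "vector_field_on A \<Omega> Y"
    and m: "\<And>c. c \<in> A \<Longrightarrow> set_borel_measurable borel (chart_dom c \<inter> \<Omega>) (X c)"
      "\<And>c. c \<in> A \<Longrightarrow> set_borel_measurable borel (chart_dom c \<inter> \<Omega>) (Y c)"
  shows "set_borel_measurable borel \<Omega> (metric_inner A g X Y)"
proof (rule set_measurable_local[OF \<Omega>])
  fix c assume c: "c \<in> A"
  let ?S = "chart_dom c \<inter> \<Omega>"
  have S: "?S \<in> sets borel" using chart_open[OF c] \<Omega> by (simp add: open_Int)
  have "(\<lambda>x. indicator ?S x *\<^sub>R g c x) \<in> borel_measurable borel"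
    by (rule borel_measurable_continuous_on_indicator[OF S])
      (rule continuous_on_subset[OF metric_continuous(2)[OF c]], simp)
  note nm = nth_measurable[OF nth_measurable[OF this]] nth_measurable[OF m(1)[OF c, unfolded set_borel_measurable_def]]
    nth_measurable[OF m(2)[OF c, unfolded set_borel_measurable_def]]
  have "(\<lambda>x. \<Sum>i\<in>UNIV. \<Sum>j\<in>UNIV. (indicator ?S x *\<^sub>R X c x) $ i * ((indicator ?S x *\<^sub>R g c x) $ i $ j
      * (indicator ?S x *\<^sub>R Y c x) $ j)) \<in> borel_measurable borel"
    by (intro borel_measurable_sum borel_measurable_times nm)
  also have "(\<lambda>x. \<Sum>i\<in>UNIV. \<Sum>j\<in>UNIV. (indicator ?S x *\<^sub>R X c x) $ i * ((indicator ?S x *\<^sub>R g c x) $ i $ j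
      * (indicator ?S x *\<^sub>R Y c x) $ j)) = (\<lambda>x. indicator ?S x *\<^sub>R metric_inner A g X Y x)"
  proof
    fix x
    show "(\<Sum>i\<in>UNIV. \<Sum>j\<in>UNIV. (indicator ?S x *\<^sub>R X c x) $ i * ((indicator ?S x *\<^sub>R g c x) $ i $ j
      * (indicator ?S x *\<^sub>R Y c x) $ j)) = indicator ?S x *\<^sub>R metric_inner A g X Y x"
    proof (cases "x \<in> ?S")
      case True
      then show ?thesis
        using metric_inner_chart[OF X c, of x]
        by (simp add: sum_2 inner_2 matrix_vector_2 distrib_left)
    qed simp
  qed
  finally show "set_borel_measurable borel ?S (metric_inner A g X Y)"
    by (simp add: set_borel_measurable_def)
qed

lemma metric_inner_sym: "metric_inner A g X Y x = metric_inner A g Y X x"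
  using metric_posdef(4)[OF chart_at]
  by (simp add: metric_inner_def Let_def inner_2 matrix_vector_2 algebra_simps)

lemma metric_inner_lincomb:
  "metric_inner A g (\<lambda>c x. X c x + t *\<^sub>R Y c x) (\<lambda>c x. X c x + t *\<^sub>R Y c x) x
    = metric_inner A g X X x + 2 * t * metric_inner A g X Y x + t\<^sup>2 * metric_inner A g Y Y x"
proof -
  have "metric_inner A g (\<lambda>c x. X c x + t *\<^sub>R Y c x) (\<lambda>c x. X c x + t *\<^sub>R Y c x) x
    = metric_inner A g X X x + t * metric_inner A g X Y x + t * metric_inner A g Y X x + t\<^sup>2 * metric_inner A g Y Y x"
    by (simp add: metric_inner_def Let_def matrix_vector_right_distrib matrix_vector_mult_scaleR
        inner_add_left inner_add_right power2_eq_square algebra_simps)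
  then show ?thesis using metric_inner_sym[of Y X x] by simp
qed

lemma metric_inner_abs_le:
  "\<bar>metric_inner A g X Y x\<bar> \<le> (1/2) * (metric_inner A g X X x + metric_inner A g Y Y x)"
  using metric_inner_nonneg[of "\<lambda>c x. X c x + 1 *\<^sub>R Y c x" x]
    metric_inner_nonneg[of "\<lambda>c x. X c x + (-1) *\<^sub>R Y c x" x]
  unfolding metric_inner_lincomb by (simp add: abs_le_iff)

lemma metric_inner_lincomb_le:
  "metric_inner A g (\<lambda>c x. X c x + t *\<^sub>R Y c x) (\<lambda>c x. X c x + t *\<^sub>R Y c x) x
    \<le> 2 * metric_inner A g X X x + 2 * t\<^sup>2 * metric_inner A g Y Y x"
  using metric_inner_nonneg[of "\<lambda>c x. X c x + (-t) *\<^sub>R Y c x" x]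
  unfolding metric_inner_lincomb by simp

lemma set_integrable_bound:
  fixes f :: "'a \<Rightarrow> real"
  assumes "set_integrable vol \<Omega> h" "set_borel_measurable borel \<Omega> f" "\<And>x. \<bar>f x\<bar> \<le> (h x :: real)"
  shows "set_integrable vol \<Omega> f"
  unfolding set_integrable_def
proof (rule Bochner_Integration.integrable_bound[OF assms(1)[unfolded set_integrable_def]])
  show "AE x in vol. norm (indicator \<Omega> x *\<^sub>R f x) \<le> norm (indicator \<Omega> x *\<^sub>R h x)"
  proof (rule AE_I2)
    fix x show "norm (indicator \<Omega> x *\<^sub>R f x) \<le> norm (indicator \<Omega> x *\<^sub>R h x)"
      using assms(3)[of x] by (simp add: indicator_def)
  qed
  show "(\<lambda>x. indicator \<Omega> x *\<^sub>R f x) \<in> borel_measurable vol"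
    using assms(2) by (simp add: set_borel_measurable_def)
qed

lemma L2_field_inner_integrable:
  assumes "open \<Omega>" "L2_field \<Omega> X" "L2_field \<Omega> Y"
  shows "set_integrable vol \<Omega> (metric_inner A g X Y)"
proof (rule set_integrable_bound)
  have "set_integrable vol \<Omega> (metric_inner A g X X)" "set_integrable vol \<Omega> (metric_inner A g Y Y)"
    using assms by (auto simp: L2_field_def)
  then show "set_integrable vol \<Omega> (\<lambda>x. (1/2) * (metric_inner A g X X x + metric_inner A g Y Y x))"
    by (intro set_integrable_mult_right set_integral_add)
  show "set_borel_measurable borel \<Omega> (metric_inner A g X Y)"
    by (rule metric_inner_measurable) (use assms in \<open>auto simp: L2_field_def\<close>)
qed (rule metric_inner_abs_le)

lemma set_borel_measurable_lincomb:
  fixes f h :: "'a \<Rightarrow> 'b::euclidean_space"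
  assumes "set_borel_measurable borel \<Omega> f" "set_borel_measurable borel \<Omega> h"
  shows "set_borel_measurable borel \<Omega> (\<lambda>x. f x + t *\<^sub>R h x)"
proof -
  have "(\<lambda>x. indicator \<Omega> x *\<^sub>R f x + t *\<^sub>R (indicator \<Omega> x *\<^sub>R h x)) \<in> borel_measurable borel"
    using assms unfolding set_borel_measurable_def
    by (intro borel_measurable_add borel_measurable_scaleR[OF borel_measurable_const])
  then show ?thesis by (simp add: set_borel_measurable_def scaleR_add_right mult.commute)
qed

lemma L2_field_lincomb:
  assumes \<Omega>: "open \<Omega>" and X: "L2_field \<Omega> X" and Y: "L2_field \<Omega> Y"
  shows "L2_field \<Omega> (\<lambda>c x. X c x + t *\<^sub>R Y c x)"
  unfolding L2_field_def
proof (intro conjI ballI)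
  show "vector_field_on A \<Omega> (\<lambda>c x. X c x + t *\<^sub>R Y c x)"
    unfolding vector_field_on_def
  proof (intro ballI)
    fix c c' x assume c: "c \<in> A" "c' \<in> A" and x: "x \<in> chart_dom c \<inter> chart_dom c' \<inter> \<Omega>"
    have "X c' x = jacobian c c' x *v X c x" "Y c' x = jacobian c c' x *v Y c x"
      using vector_fieldD[of \<Omega> X c c' x] vector_fieldD[of \<Omega> Y c c' x] X Y c x by (auto simp: L2_field_def)
    then show "X c' x + t *\<^sub>R Y c' x = jacobian c c' x *v (X c x + t *\<^sub>R Y c x)"
      by (simp add: matrix_vector_right_distrib matrix_vector_mult_scaleR)
  qed
  show "set_borel_measurable borel (chart_dom c \<inter> \<Omega>) (\<lambda>x. X c x + t *\<^sub>R Y c x)" if "c \<in> A" for c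
    by (rule set_borel_measurable_lincomb) (use X Y that in \<open>auto simp: L2_field_def\<close>)
  show "set_integrable vol \<Omega> (metric_inner A g (\<lambda>c x. X c x + t *\<^sub>R Y c x) (\<lambda>c x. X c x + t *\<^sub>R Y c x))"
    unfolding metric_inner_lincomb
    by (intro set_integral_add set_integrable_mult_right L2_field_inner_integrable \<Omega> X Y)
qed

lemma L2_on_mult_integrable:
  assumes "L2_on vol \<Omega> u" "L2_on vol \<Omega> v"
  shows "set_integrable vol \<Omega> (\<lambda>x. u x * v x)"
proof (rule set_integrable_bound)
  have "set_integrable vol \<Omega> (\<lambda>x. (u x)\<^sup>2)" "set_integrable vol \<Omega> (\<lambda>x. (v x)\<^sup>2)"
    using assms by (auto simp: L2_on_def)
  then show "set_integrable vol \<Omega> (\<lambda>x. (1/2) * ((u x)\<^sup>2 + (v x)\<^sup>2))"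
    by (intro set_integrable_mult_right set_integral_add)
  have "(\<lambda>x. (indicator \<Omega> x *\<^sub>R u x) * (indicator \<Omega> x *\<^sub>R v x)) \<in> borel_measurable borel"
    using assms unfolding L2_on_def set_borel_measurable_def by (intro borel_measurable_times) auto
  also have "(\<lambda>x. (indicator \<Omega> x *\<^sub>R u x) * (indicator \<Omega> x *\<^sub>R v x)) = (\<lambda>x. indicator \<Omega> x *\<^sub>R (u x * v x))"
    by (auto simp: indicator_def)
  finally show "set_borel_measurable borel \<Omega> (\<lambda>x. u x * v x)" by (simp add: set_borel_measurable_def)
  fix x
  show "\<bar>u x * v x\<bar> \<le> (1/2) * ((u x)\<^sup>2 + (v x)\<^sup>2)"
    using zero_le_power2[of "u x - v x"] zero_le_power2[of "u x + v x"]
    by (simp add: abs_le_iff power2_eq_square algebra_simps)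
qed

lemma square_lincomb: "(a + t * b)\<^sup>2 = a\<^sup>2 + 2 * t * (a * b) + t\<^sup>2 * (b::real)\<^sup>2"
  by (simp add: power2_eq_square algebra_simps)

lemma L2_on_lincomb:
  assumes "L2_on vol \<Omega> u" "L2_on vol \<Omega> v"
  shows "L2_on vol \<Omega> (\<lambda>x. u x + t * v x)"
  unfolding L2_on_def
proof
  show "set_borel_measurable borel \<Omega> (\<lambda>x. u x + t * v x)"
    using set_borel_measurable_lincomb[of \<Omega> u v t] assms by (simp add: L2_on_def)
  show "set_integrable vol \<Omega> (\<lambda>x. (u x + t * v x)\<^sup>2)"
    unfolding square_lincomb using assms L2_on_mult_integrable[OF assms]
    by (intro set_integral_add set_integrable_mult_right) (auto simp: L2_on_def)
qed

lemma gradient_continuous: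
  assumes f: "test_function A \<Omega> f" and c: "c \<in> A"
  shows "continuous_on (chart_dom c) (gradient g f c)"
proof -
  have o: "open (chart_dom c \<inter> inner_pts)" "open (chart_dom c - supp f)"
    using chart_open[OF c] open_inner_pts test_supp(4)[OF f] by (auto simp: open_Diff closed_def)
  have 1: "continuous_on (chart_dom c - supp f) (gradient g f c)"
    by (rule continuous_on_eq[OF continuous_on_const[of _ 0]]) (use test_gradient_eq_0(1)[OF f _ c] in auto)
  have "continuous_on (inner_cod c) (\<lambda>p. \<chi> i. gradient g f c (chart_inv c p) $ i)"
    by (intro continuous_on_vec_lambda Csmooth_imp_continuous_on gradient_smooth[OF f c])
  then have "continuous_on (inner_cod c) (\<lambda>p. gradient g f c (chart_inv c p))" by simp
  then have "continuous_on (chart_dom c \<inter> inner_pts) (\<lambda>x. gradient g f c (chart_inv c (chart_map c x)))"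
    by (rule continuous_on_compose2[OF _ continuous_on_subset[OF chart_map_cont[OF c]]]) (auto simp: inner_cod_def)
  then have 2: "continuous_on (chart_dom c \<inter> inner_pts) (gradient g f c)"
    by (rule continuous_on_eq) (simp add: chart_inv_map[OF c])
  have "continuous_on ((chart_dom c \<inter> inner_pts) \<union> (chart_dom c - supp f)) (gradient g f c)"
    by (rule continuous_on_open_Un[OF o 2 1])
  moreover have "(chart_dom c \<inter> inner_pts) \<union> (chart_dom c - supp f) = chart_dom c"
    using test_supp(3)[OF f] by blast
  ultimately show ?thesis by simp
qed

lemma set_integrable_if_integrable:
  fixes h :: "'a \<Rightarrow> real"
  shows "integrable vol h \<Longrightarrow> open \<Omega> \<Longrightarrow> set_integrable vol \<Omega> h"
  unfolding set_integrable_def by (rule integrable_mult_indicator) simp_all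

lemma L2_field_gradient:
  assumes \<Omega>: "open \<Omega>" and f: "test_function A \<Omega>' f"
  shows "L2_field \<Omega> (gradient g f)"
  unfolding L2_field_def
proof (intro conjI ballI)
  show "vector_field_on A \<Omega> (gradient g f)" by (rule gradient_vector_field[OF f])
  show "set_borel_measurable borel (chart_dom c \<inter> \<Omega>) (gradient g f c)" if c: "c \<in> A" for c
    unfolding set_borel_measurable_def
    by (rule borel_measurable_continuous_on_indicator)
      (use chart_open[OF c] \<Omega> continuous_on_subset[OF gradient_continuous[OF f c]] in auto)
  show "set_integrable vol \<Omega> (metric_inner A g (gradient g f) (gradient g f))"
    by (rule set_integrable_if_integrable[OF _ \<Omega>], rule integrable_continuous_compact[OF
          metric_inner_gradient_continuous[OF f f] test_supp(1,3)[OF f] metric_inner_gradient_eq_0[OF f]])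
qed

lemma L2_on_continuous_compact:
  assumes \<Omega>: "open \<Omega>" and f: "continuous_on UNIV f" "compact K" "K \<subseteq> inner_pts" "\<And>x. x \<notin> K \<Longrightarrow> f x = 0"
  shows "L2_on vol \<Omega> f"
  unfolding L2_on_def
proof
  show "set_borel_measurable borel \<Omega> f"
    unfolding set_borel_measurable_def
    by (rule borel_measurable_continuous_on_indicator) (use \<Omega> continuous_on_subset[OF f(1)] in auto)
  have "continuous_on UNIV (\<lambda>x. (f x)\<^sup>2)" by (intro continuous_intros f(1))
  then have "integrable vol (\<lambda>x. (f x)\<^sup>2)"
    by (rule integrable_continuous_compact[OF _ f(2,3)]) (simp add: f(4))
  then show "set_integrable vol \<Omega> (\<lambda>x. (f x)\<^sup>2)" by (rule set_integrable_if_integrable[OF _ \<Omega>])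
qed

lemma L2_on_test:
  assumes "open \<Omega>" "test_function A \<Omega>' f"
  shows "L2_on vol \<Omega> f"
  by (rule L2_on_continuous_compact[OF assms(1) test_continuous[OF assms(2)] test_supp(1,3)[OF assms(2)]
        test_supp_0[OF assms(2)]])

section \<open>Sobolev functions in a chart\<close>

text \<open>Coordinate expressions of a function and of the covector of a field. The cutoff outside \<open>P\<close> makes them
  globally defined functions on the plane, to which mollification applies.\<close>

definition pull_fun :: "'a chart \<Rightarrow> (real^2) set \<Rightarrow> ('a \<Rightarrow> real) \<Rightarrow> real^2 \<Rightarrow> real" where
  "pull_fun c P u p = (if p \<in> P then u (chart_inv c p) else 0)"

definition pull_covec :: "'a chart \<Rightarrow> (real^2) set \<Rightarrow> 'a vfield \<Rightarrow> 2 \<Rightarrow> real^2 \<Rightarrow> real" where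
  "pull_covec c P X i p = (if p \<in> P then (g c (chart_inv c p) *v X c (chart_inv c p)) $ i else 0)"

lemma measurable_pull:
  fixes h :: "'a \<Rightarrow> 'b::euclidean_space"
  assumes c: "c \<in> A" and P: "compact P" "P \<subseteq> chart_map c ` (chart_dom c \<inter> S)"
    and h: "set_borel_measurable borel (chart_dom c \<inter> S) h"
  shows "(\<lambda>p. indicator P p *\<^sub>R h (chart_inv c p)) \<in> borel_measurable borel"
proof -
  have Pm: "P \<in> sets borel" using P(1) by (simp add: compact_imp_closed)
  have "(\<lambda>p. indicator P p *\<^sub>R (indicator (chart_dom c \<inter> S) (total_inv c p) *\<^sub>R h (total_inv c p))) \<in> borel_measurable borel"
    by (intro borel_measurable_scaleR borel_measurable_indicator Pm
        measurable_compose[OF total_inv_measurable[OF c] h[unfolded set_borel_measurable_def]])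
  also have "(\<lambda>p. indicator P p *\<^sub>R (indicator (chart_dom c \<inter> S) (total_inv c p) *\<^sub>R h (total_inv c p)))
      = (\<lambda>p. indicator P p *\<^sub>R h (chart_inv c p))"
  proof
    fix p
    show "indicator P p *\<^sub>R (indicator (chart_dom c \<inter> S) (total_inv c p) *\<^sub>R h (total_inv c p))
      = indicator P p *\<^sub>R h (chart_inv c p)"
    proof (cases "p \<in> P")
      case True
      then obtain x where "x \<in> chart_dom c \<inter> S" "p = chart_map c x" using P(2) by blast
      then show ?thesis using chart_inv_map[OF c, of x] by (auto simp: total_inv_def)
    qed simp
  qed
  finally show ?thesis .
qed

text \<open>The density of the measure is bounded below on \<open>P\<close>, so planar integrals are dominated by integrals over
  the surface.\<close>

lemma pull_nn_integral_le:
  assumes c: "c \<in> A" and P: "compact P" "P \<subseteq> chart_map c ` (chart_dom c \<inter> S)"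
    and h: "set_borel_measurable borel S h" "\<And>x. 0 \<le> h x" and C: "C > 0" "\<And>p. p \<in> P \<Longrightarrow> 1 \<le> C * vol_density c p"
  shows "(\<integral>\<^sup>+p\<in>P. ennreal (h (chart_inv c p)) \<partial>lborel) \<le> ennreal C * (\<integral>\<^sup>+x\<in>S. ennreal (h x) \<partial>vol)"
proof -
  let ?N = "chart_inv c ` P"
  have sub: "?N \<subseteq> chart_dom c" "?N \<subseteq> S" using P(2) chart_inv_map[OF c] by auto
  have im: "chart_map c ` ?N = P" using P(2) chart_inv_map[OF c] by (force simp: image_def)
  have Pcod: "P \<subseteq> chart_cod c" using P(2) by blast
  have "compact ?N"
    by (intro compact_continuous_image P continuous_on_subset[OF chart_inv_cont[OF c] Pcod])
  then have N: "?N \<in> sets borel" by (simp add: compact_imp_closed)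
  have "(\<lambda>x. ennreal (indicator S x *\<^sub>R h x) * indicator ?N x) \<in> borel_measurable borel"
    using h(1) N unfolding set_borel_measurable_def by (intro borel_measurable_times_ennreal) auto
  also have "(\<lambda>x. ennreal (indicator S x *\<^sub>R h x) * indicator ?N x) = (\<lambda>x. ennreal (h x) * indicator ?N x)"
    using sub(2) by (auto simp: fun_eq_iff indicator_def of_bool_def)
  finally have m: "(\<lambda>x. ennreal (h x) * indicator ?N x) \<in> borel_measurable borel" .
  have "(\<lambda>x. ennreal (indicator S x *\<^sub>R h x)) \<in> borel_measurable borel"
    using h(1) unfolding set_borel_measurable_def by measurable
  also have "(\<lambda>x. ennreal (indicator S x *\<^sub>R h x)) = (\<lambda>x. ennreal (h x) * indicator S x)"
    by (auto simp: fun_eq_iff indicator_def of_bool_def)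
  finally have m': "(\<lambda>x. ennreal (h x) * indicator S x) \<in> borel_measurable vol" by simp
  have "(\<integral>\<^sup>+p\<in>P. ennreal (h (chart_inv c p)) \<partial>lborel)
      \<le> (\<integral>\<^sup>+p. ennreal C * (ennreal (vol_density c p) * ennreal (h (chart_inv c p)) * indicator P p) \<partial>lborel)"
  proof (rule nn_integral_mono)
    fix p
    show "ennreal (h (chart_inv c p)) * indicator P p
      \<le> ennreal C * (ennreal (vol_density c p) * ennreal (h (chart_inv c p)) * indicator P p)"
    proof (cases "p \<in> P")
      case True
      have d: "0 \<le> vol_density c p" using vol_density_pos[OF c] Pcod True by force
      have "1 * h (chart_inv c p) \<le> (C * vol_density c p) * h (chart_inv c p)"
        by (intro mult_right_mono C(2) True h(2))
      then have "ennreal (h (chart_inv c p)) \<le> ennreal (C * (vol_density c p * h (chart_inv c p)))"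
        by (intro ennreal_leI) (simp add: mult.assoc)
      also have "\<dots> = ennreal C * (ennreal (vol_density c p) * ennreal (h (chart_inv c p)))"
        using C(1) d h(2) by (simp add: ennreal_mult)
      finally show ?thesis using True by simp
    qed simp
  qed
  also have "\<dots> = ennreal C * (\<integral>\<^sup>+p\<in>chart_map c ` ?N. ennreal (vol_density c p) * ennreal (h (chart_inv c p)) \<partial>lborel)"
    unfolding im
  proof (rule nn_integral_cmult)
    have "(\<lambda>p. (indicator (chart_cod c) p * ennreal (vol_density c p))
        * ennreal (indicator P p *\<^sub>R h (chart_inv c p))) \<in> borel_measurable borel"
    proof (rule borel_measurable_times_ennreal[OF density_measurable[OF c]])
      have "set_borel_measurable borel ?N h"
        by (rule set_borel_measurable_subset[OF h(1) _ sub(2)]) (use N in simp)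
      then have "(\<lambda>p. indicator P p *\<^sub>R h (chart_inv c p)) \<in> borel_measurable borel"
        using sub(1) im by (intro measurable_pull[OF c P(1), of ?N]) (auto simp: Int_absorb1)
      then show "(\<lambda>p. ennreal (indicator P p *\<^sub>R h (chart_inv c p))) \<in> borel_measurable borel" by measurable
    qed
    also have "(\<lambda>p. (indicator (chart_cod c) p * ennreal (vol_density c p))
        * ennreal (indicator P p *\<^sub>R h (chart_inv c p)))
      = (\<lambda>p. ennreal (vol_density c p) * ennreal (h (chart_inv c p)) * indicator P p)"
      using Pcod by (auto simp: fun_eq_iff indicator_def of_bool_def)
    finally show "(\<lambda>p. ennreal (vol_density c p) * ennreal (h (chart_inv c p)) * indicator P p) \<in> borel_measurable lborel"
      by simp
  qed
  also have "\<dots> = ennreal C * (\<integral>\<^sup>+x\<in>?N. ennreal (h x) \<partial>vol)"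
    by (subst chart_change_of_variables[OF c N sub(1) m]) simp
  also have "\<dots> \<le> ennreal C * (\<integral>\<^sup>+x\<in>S. ennreal (h x) \<partial>vol)"
    using sub(2) by (intro mult_left_mono nn_integral_mono) (auto simp: indicator_def)
  finally show ?thesis .
qed

lemma pull_fun_L2:
  assumes c: "c \<in> A" and P: "compact P" "P \<subseteq> chart_map c ` (chart_dom c \<inter> \<Omega>)" and u: "L2_on vol \<Omega> u"
    and \<Omega>: "open \<Omega>" and R: "P \<subseteq> cball 0 R"
  shows "planar_L2 R (pull_fun c P u)"
proof -
  have Pcod: "P \<subseteq> chart_cod c" using P(2) by blast
  obtain C where C: "C > 0" "\<And>p. p \<in> P \<Longrightarrow> 1 \<le> C * vol_density c p"
    using chart_compact_bounds[OF c P(1) Pcod] by metis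
  have u': "set_borel_measurable borel \<Omega> u" and u2: "set_integrable vol \<Omega> (\<lambda>x. (u x)\<^sup>2)"
    using u by (auto simp: L2_on_def)
  have ms: "set_borel_measurable borel (chart_dom c \<inter> \<Omega>) u"
    by (rule set_borel_measurable_subset[OF u']) (use chart_open[OF c] \<Omega> in \<open>auto intro!: borel_open open_Int\<close>)
  have e: "pull_fun c P u = (\<lambda>p. indicator P p *\<^sub>R u (chart_inv c p))"
    by (auto simp: pull_fun_def indicator_def fun_eq_iff)
  have m: "pull_fun c P u \<in> borel_measurable borel"
    unfolding e by (rule measurable_pull[OF c P ms])
  have u2m: "set_borel_measurable borel \<Omega> (\<lambda>x. (u x)\<^sup>2)"
    using borel_measurable_integrable[OF u2[unfolded set_integrable_def]] by (simp add: set_borel_measurable_def)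
  have "(\<integral>\<^sup>+p. ennreal ((pull_fun c P u p)\<^sup>2) \<partial>lborel) = (\<integral>\<^sup>+p\<in>P. ennreal ((u (chart_inv c p))\<^sup>2) \<partial>lborel)"
    by (intro nn_integral_cong) (auto simp: pull_fun_def indicator_def)
  also have "\<dots> \<le> ennreal C * (\<integral>\<^sup>+x\<in>\<Omega>. ennreal ((u x)\<^sup>2) \<partial>vol)"
    by (rule pull_nn_integral_le[OF c P u2m _ C]) simp
  also have "\<dots> < \<infinity>"
  proof -
    have "(\<integral>\<^sup>+x\<in>\<Omega>. ennreal ((u x)\<^sup>2) \<partial>vol) = (\<integral>\<^sup>+x. ennreal (norm (indicator \<Omega> x *\<^sub>R (u x)\<^sup>2)) \<partial>vol)"
      by (intro nn_integral_cong) (auto simp: indicator_def)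
    also have "\<dots> < \<infinity>" using u2 unfolding set_integrable_def integrable_iff_bounded by blast
    finally show ?thesis by (simp add: ennreal_mult_less_top)
  qed
  finally have "integrable lborel (\<lambda>p. (pull_fun c P u p)\<^sup>2)"
    using m by (intro integrableI_bounded) auto
  then show ?thesis using m R by (auto simp: planar_L2_def pull_fun_def)
qed

lemma pull_covec_L2:
  assumes c: "c \<in> A" and P: "compact P" "P \<subseteq> chart_map c ` (chart_dom c \<inter> \<Omega>)" and X: "L2_field \<Omega> X"
    and \<Omega>: "open \<Omega>" and R: "P \<subseteq> cball 0 R"
  shows "planar_L2 R (pull_covec c P X i)"
proof -
  have Pcod: "P \<subseteq> chart_cod c" using P(2) by blast
  obtain C where C: "C > 0" "\<And>p. p \<in> P \<Longrightarrow> 1 \<le> C * vol_density c p"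
    "\<And>p v. p \<in> P \<Longrightarrow> (norm (g c (chart_inv c p) *v v))\<^sup>2 \<le> C * (v \<bullet> (g c (chart_inv c p) *v v))"
    using chart_compact_bounds[OF c P(1) Pcod] by metis
  let ?Q = "metric_inner A g X X"
  have Q: "set_integrable vol \<Omega> ?Q" and vX: "vector_field_on A \<Omega> X"
    and mX: "set_borel_measurable borel (chart_dom c \<inter> \<Omega>) (X c)"
    using X c by (auto simp: L2_field_def)
  have Qm: "set_borel_measurable borel \<Omega> ?Q"
    using borel_measurable_integrable[OF Q[unfolded set_integrable_def]] by (simp add: set_borel_measurable_def)
  have Pm: "P \<in> sets borel" using P(1) by (simp add: compact_imp_closed)
  have gm: "(\<lambda>p. indicator P p *\<^sub>R g c (chart_inv c p)) \<in> borel_measurable borel"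
    by (rule borel_measurable_continuous_on_indicator[OF Pm continuous_on_subset[OF metric_continuous(1)[OF c] Pcod]])
  note nm = nth_measurable[OF nth_measurable[OF gm]] nth_measurable[OF measurable_pull[OF c P mX]]
  have "(\<lambda>p. \<Sum>j\<in>UNIV. (indicator P p *\<^sub>R g c (chart_inv c p)) $ i $ j * (indicator P p *\<^sub>R X c (chart_inv c p)) $ j)
      \<in> borel_measurable borel"
    by (intro borel_measurable_sum borel_measurable_times nm)
  also have "(\<lambda>p. \<Sum>j\<in>UNIV. (indicator P p *\<^sub>R g c (chart_inv c p)) $ i $ j * (indicator P p *\<^sub>R X c (chart_inv c p)) $ j)
      = pull_covec c P X i"
    by (auto simp: fun_eq_iff pull_covec_def sum_2 matrix_vector_2 indicator_def)
  finally have m: "pull_covec c P X i \<in> borel_measurable borel" .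
  have "(\<integral>\<^sup>+p. ennreal ((pull_covec c P X i p)\<^sup>2) \<partial>lborel)
      \<le> (\<integral>\<^sup>+p. ennreal C * (ennreal (?Q (chart_inv c p)) * indicator P p) \<partial>lborel)"
  proof (rule nn_integral_mono)
    fix p
    show "ennreal ((pull_covec c P X i p)\<^sup>2) \<le> ennreal C * (ennreal (?Q (chart_inv c p)) * indicator P p)"
    proof (cases "p \<in> P")
      case True
      let ?x = "chart_inv c p"
      have x: "?x \<in> chart_dom c \<inter> \<Omega>" using True P(2) chart_inv_map[OF c] by auto
      have "\<bar>(g c ?x *v X c ?x) $ i\<bar> \<le> norm (g c ?x *v X c ?x)" by (rule component_le_norm_cart)
      then have "((g c ?x *v X c ?x) $ i)\<^sup>2 \<le> (norm (g c ?x *v X c ?x))\<^sup>2"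
        by (metis abs_ge_zero power2_abs power_mono)
      also have "\<dots> \<le> C * ?Q ?x"
        using C(3)[OF True] metric_inner_chart[OF vX vX c x] by simp
      finally show ?thesis
        using True C(1) metric_inner_nonneg by (simp add: pull_covec_def ennreal_mult[symmetric] ennreal_leI)
    qed (simp add: pull_covec_def)
  qed
  also have "\<dots> = ennreal C * (\<integral>\<^sup>+p\<in>P. ennreal (?Q (chart_inv c p)) \<partial>lborel)"
  proof (rule nn_integral_cmult)
    have "set_borel_measurable borel (chart_dom c \<inter> \<Omega>) ?Q"
      by (rule set_borel_measurable_subset[OF Qm]) (use chart_open[OF c] \<Omega> in \<open>auto intro!: borel_open open_Int\<close>)
    from measurable_pull[OF c P this]
    have "(\<lambda>p. ennreal (indicator P p *\<^sub>R ?Q (chart_inv c p))) \<in> borel_measurable borel" by measurable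
    also have "(\<lambda>p. ennreal (indicator P p *\<^sub>R ?Q (chart_inv c p))) = (\<lambda>p. ennreal (?Q (chart_inv c p)) * indicator P p)"
      by (auto simp: fun_eq_iff indicator_def)
    finally show "(\<lambda>p. ennreal (?Q (chart_inv c p)) * indicator P p) \<in> borel_measurable lborel" by simp
  qed
  also have "\<dots> \<le> ennreal C * (ennreal C * (\<integral>\<^sup>+x\<in>\<Omega>. ennreal (?Q x) \<partial>vol))"
    by (intro mult_left_mono pull_nn_integral_le[OF c P Qm _ C(1,2)] metric_inner_nonneg) auto
  also have "\<dots> < \<infinity>"
  proof -
    have "(\<integral>\<^sup>+x\<in>\<Omega>. ennreal (?Q x) \<partial>vol) = (\<integral>\<^sup>+x. ennreal (norm (indicator \<Omega> x *\<^sub>R ?Q x)) \<partial>vol)"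
      by (intro nn_integral_cong) (auto simp: indicator_def metric_inner_nonneg)
    also have "\<dots> < \<infinity>" using Q unfolding set_integrable_def integrable_iff_bounded by blast
    finally show ?thesis by (simp add: ennreal_mult_less_top)
  qed
  finally have "integrable lborel (\<lambda>p. (pull_covec c P X i p)\<^sup>2)"
    using m by (intro integrableI_bounded) auto
  then show ?thesis using m R by (auto simp: planar_L2_def pull_covec_def)
qed

lemma compact_subset_cball_0: "compact (P :: (real^2) set) \<Longrightarrow> \<exists>R. P \<subseteq> cball 0 R"
  using compact_imp_bounded[of P] by (auto simp: bounded_iff subset_iff)

lemma planar_mult_integrable:
  assumes "planar_L2 R w" "continuous_on UNIV \<psi>"
  shows "integrable lborel (\<lambda>p. w p * \<psi> p)"
  by (rule integrable_mult_continuous[OF planar_L2_integrable[OF assms(1)] compact_cball[of 0 R]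
        _ continuous_on_subset[OF assms(2)] borel_measurable_continuous_onI[OF assms(2)]])
    (use assms(1) in \<open>auto simp: planar_L2_def\<close>)

lemma
  assumes "P \<subseteq> V" "\<And>p. p \<notin> P \<Longrightarrow> \<psi> p = 0"
  shows chart_integral_fun:
      "(LINT p:V|lborel. u (chart_inv c p) * \<psi> p) = (LINT p|lborel. pull_fun c P u p * \<psi> p)"
    and chart_integral_covec:
      "(LINT p:V|lborel. (g c (chart_inv c p) *v X c (chart_inv c p)) $ i * \<psi> p)
        = (LINT p|lborel. pull_covec c P X i p * \<psi> p)"
proof -
  have "(\<lambda>p. indicator V p *\<^sub>R (u (chart_inv c p) * \<psi> p)) = (\<lambda>p. pull_fun c P u p * \<psi> p)"
    using assms by (auto simp: fun_eq_iff indicator_def pull_fun_def)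
  then show "(LINT p:V|lborel. u (chart_inv c p) * \<psi> p) = (LINT p|lborel. pull_fun c P u p * \<psi> p)"
    by (simp add: set_lebesgue_integral_def)
  have "(\<lambda>p. indicator V p *\<^sub>R ((g c (chart_inv c p) *v X c (chart_inv c p)) $ i * \<psi> p))
      = (\<lambda>p. pull_covec c P X i p * \<psi> p)"
    using assms by (auto simp: fun_eq_iff indicator_def pull_covec_def)
  then show "(LINT p:V|lborel. (g c (chart_inv c p) *v X c (chart_inv c p)) $ i * \<psi> p)
        = (LINT p|lborel. pull_covec c P X i p * \<psi> p)"
    by (simp add: set_lebesgue_integral_def)
qed

lemma partial_within_UNIV: "partial_within UNIV i \<psi> p = pd i \<psi> p"
  by (simp add: partial_within_def pd_def)

lemma pd_eq_0_off:
  assumes "closed P" "\<And>p. p \<notin> P \<Longrightarrow> \<psi> p = (0::real)" "p \<notin> P"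
  shows "pd i \<psi> p = 0"
  using pd_cong[of "- P" p \<psi> "\<lambda>_. 0" i] assms by (simp add: open_Compl)

text \<open>For square integrable data both sides of the defining identity are integrals over the whole plane of
  integrable functions, which may be split and combined.\<close>

lemma weak_gradient_iff:
  assumes \<Omega>: "open \<Omega>" and u: "L2_on vol \<Omega> u" and X: "L2_field \<Omega> X"
  shows "weak_gradient A g \<Omega> u X \<longleftrightarrow> (\<forall>c\<in>A. \<forall>i P \<psi>. compact P \<and> P \<subseteq> chart_map c ` (chart_dom c \<inter> \<Omega> \<inter> inner_pts)
      \<and> Csmooth UNIV \<psi> \<and> (\<forall>p. p \<notin> P \<longrightarrow> \<psi> p = 0) \<longrightarrow>
      (LINT p|lborel. pull_fun c P u p * pd i \<psi> p) = - (LINT p|lborel. pull_covec c P X i p * \<psi> p))"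
    (is "?L \<longleftrightarrow> ?R")
proof
  assume L: ?L
  show ?R
  proof (intro ballI allI impI)
    fix c i P \<psi> assume c: "c \<in> A" and H: "compact P \<and> P \<subseteq> chart_map c ` (chart_dom c \<inter> \<Omega> \<inter> inner_pts)
      \<and> Csmooth UNIV (\<psi> :: real^2 \<Rightarrow> real) \<and> (\<forall>p. p \<notin> P \<longrightarrow> \<psi> p = 0)"
    let ?V = "chart_map c ` (chart_dom c \<inter> \<Omega> \<inter> inner_pts)"
    have cP: "closed P" using H by (simp add: compact_imp_closed)
    have sub: "closure {p. \<psi> p \<noteq> 0} \<subseteq> P" by (rule closure_minimal[OF _ cP]) (use H in blast)
    then have "compact (closure {p. \<psi> p \<noteq> 0})"
      using H by (metis closed_closure compact_Int_closed inf.absorb_iff2)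
    then have "(LINT p:?V|lborel. u (chart_inv c p) * partial_within UNIV i \<psi> p)
      = - (LINT p:?V|lborel. (g c (chart_inv c p) *v X c (chart_inv c p)) $ i * \<psi> p)"
      using L c H sub unfolding weak_gradient_def Let_def smooth_on_open_iff[OF open_UNIV] by blast
    then show "(LINT p|lborel. pull_fun c P u p * pd i \<psi> p) = - (LINT p|lborel. pull_covec c P X i p * \<psi> p)"
      using chart_integral_fun[of P ?V "pd i \<psi>" u c] chart_integral_covec[of P ?V \<psi> c X i]
        H pd_eq_0_off[OF cP, of \<psi>] by (simp add: partial_within_UNIV)
  qed
next
  assume R: ?R
  show ?L
    unfolding weak_gradient_def Let_def smooth_on_open_iff[OF open_UNIV]
  proof (intro conjI ballI allI impI)
    show "vector_field_on A \<Omega> X" using X by (simp add: L2_field_def)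
    show "set_borel_measurable borel (chart_dom c \<inter> \<Omega>) (X c)" if "c \<in> A" for c
      using X that by (simp add: L2_field_def)
    fix c i and \<psi> :: "real^2 \<Rightarrow> real"
    let ?V = "chart_map c ` (chart_dom c \<inter> \<Omega> \<inter> inner_pts)"
    let ?P = "closure {p. \<psi> p \<noteq> 0}"
    assume c: "c \<in> A" and H: "Csmooth UNIV \<psi> \<and> compact ?P \<and> ?P \<subseteq> ?V"
    have 0: "\<psi> p = 0" if "p \<notin> ?P" for p using that closure_subset[of "{p. \<psi> p \<noteq> 0}"] by auto
    have e: "(LINT p|lborel. pull_fun c ?P u p * pd i \<psi> p) = - (LINT p|lborel. pull_covec c ?P X i p * \<psi> p)"
      using R c H 0 by blast
    have z': "pd i \<psi> p = 0" if "p \<notin> ?P" for p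
      by (rule pd_eq_0_off[OF closed_closure 0 that])
    have sub: "?P \<subseteq> ?V" using H by blast
    show "(LINT p:?V|lborel. u (chart_inv c p) * partial_within UNIV i \<psi> p)
      = - (LINT p:?V|lborel. (g c (chart_inv c p) *v X c (chart_inv c p)) $ i * \<psi> p)"
      unfolding partial_within_UNIV
      by (subst chart_integral_fun[OF sub], erule z', subst chart_integral_covec[OF sub], erule 0, rule e)
  qed
qed

lemma W12_iff:
  "W12 A g vol \<Omega> u X \<longleftrightarrow> L2_on vol \<Omega> u \<and> L2_field \<Omega> X \<and> weak_gradient A g \<Omega> u X"
  by (auto simp: W12_def L2_field_def weak_gradient_def)

lemma W12_lincomb:
  assumes \<Omega>: "open \<Omega>" and u: "W12 A g vol \<Omega> u X" and v: "W12 A g vol \<Omega> v Y"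
  shows "W12 A g vol \<Omega> (\<lambda>x. u x + t * v x) (\<lambda>c x. X c x + t *\<^sub>R Y c x)"
proof -
  have u': "L2_on vol \<Omega> u" "L2_field \<Omega> X" "weak_gradient A g \<Omega> u X"
    and v': "L2_on vol \<Omega> v" "L2_field \<Omega> Y" "weak_gradient A g \<Omega> v Y"
    using u v by (auto simp: W12_iff)
  note L = L2_on_lincomb[OF u'(1) v'(1), of t] L2_field_lincomb[OF \<Omega> u'(2) v'(2), of t]
  have "weak_gradient A g \<Omega> (\<lambda>x. u x + t * v x) (\<lambda>c x. X c x + t *\<^sub>R Y c x)"
    unfolding weak_gradient_iff[OF \<Omega> L]
  proof (intro ballI allI impI)
    fix c i P \<psi> assume c: "c \<in> A" and H: "compact P \<and> P \<subseteq> chart_map c ` (chart_dom c \<inter> \<Omega> \<inter> inner_pts)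
      \<and> Csmooth UNIV (\<psi> :: real^2 \<Rightarrow> real) \<and> (\<forall>p. p \<notin> P \<longrightarrow> \<psi> p = 0)"
    have P: "compact P" "P \<subseteq> chart_map c ` (chart_dom c \<inter> \<Omega>)" using H by auto
    obtain R where R: "P \<subseteq> cball 0 R" using compact_subset_cball_0[OF P(1)] by blast
    have cont: "continuous_on UNIV \<psi>" "continuous_on UNIV (pd i \<psi>)"
      using H Csmooth_imp_continuous_on Csmooth_pd by blast+
    note I = planar_mult_integrable[OF pull_fun_L2[OF c P u'(1) \<Omega> R] cont(2)]
      planar_mult_integrable[OF pull_fun_L2[OF c P v'(1) \<Omega> R] cont(2)]
      planar_mult_integrable[OF pull_covec_L2[OF c P u'(2) \<Omega> R, of i] cont(1)]
      planar_mult_integrable[OF pull_covec_L2[OF c P v'(2) \<Omega> R, of i] cont(1)]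
    have e: "(LINT p|lborel. pull_fun c P u p * pd i \<psi> p) = - (LINT p|lborel. pull_covec c P X i p * \<psi> p)"
      "(LINT p|lborel. pull_fun c P v p * pd i \<psi> p) = - (LINT p|lborel. pull_covec c P Y i p * \<psi> p)"
      using u'(3)[unfolded weak_gradient_iff[OF \<Omega> u'(1,2)]] v'(3)[unfolded weak_gradient_iff[OF \<Omega> v'(1,2)]] c H
      by blast+
    have "(LINT p|lborel. pull_fun c P (\<lambda>x. u x + t * v x) p * pd i \<psi> p)
        = (LINT p|lborel. pull_fun c P u p * pd i \<psi> p + t * (pull_fun c P v p * pd i \<psi> p))"
      by (intro Bochner_Integration.integral_cong) (auto simp: pull_fun_def algebra_simps)
    also have "\<dots> = (LINT p|lborel. pull_fun c P u p * pd i \<psi> p) + t * (LINT p|lborel. pull_fun c P v p * pd i \<psi> p)"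
      using I by simp
    also have "\<dots> = - ((LINT p|lborel. pull_covec c P X i p * \<psi> p) + t * (LINT p|lborel. pull_covec c P Y i p * \<psi> p))"
      unfolding e by simp
    also have "\<dots> = - (LINT p|lborel. pull_covec c P X i p * \<psi> p + t * (pull_covec c P Y i p * \<psi> p))"
      using I by simp
    also have "\<dots> = - (LINT p|lborel. pull_covec c P (\<lambda>c x. X c x + t *\<^sub>R Y c x) i p * \<psi> p)"
      by (intro arg_cong[of _ _ uminus] Bochner_Integration.integral_cong)
        (auto simp: pull_covec_def matrix_vector_right_distrib matrix_vector_mult_scaleR algebra_simps)
    finally show "(LINT p|lborel. pull_fun c P (\<lambda>x. u x + t * v x) p * pd i \<psi> p)
      = - (LINT p|lborel. pull_covec c P (\<lambda>c x. X c x + t *\<^sub>R Y c x) i p * \<psi> p)" .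
  qed
  then show ?thesis using L by (simp add: W12_iff)
qed

lemma set_integral_mono_all:
  fixes f h :: "'a \<Rightarrow> real"
  assumes "set_integrable vol \<Omega> f" "set_integrable vol \<Omega> h" "\<And>x. f x \<le> h x"
  shows "(LINT x:\<Omega>|vol. f x) \<le> (LINT x:\<Omega>|vol. h x)"
  by (rule set_integral_mono[OF assms(1,2)]) (rule assms(3))

lemma set_integral_nonneg_all: "(\<And>x. 0 \<le> f x) \<Longrightarrow> 0 \<le> (LINT x:\<Omega>|vol. (f x :: real))"
  unfolding set_lebesgue_integral_def by (rule Bochner_Integration.integral_nonneg) (simp add: indicator_def)

text \<open>The approximating test functions are combined linearly as well, and both errors are
  estimated by \<open>(a + b)\<^sup>2 \<le> 2 a\<^sup>2 + 2 b\<^sup>2\<close>.\<close>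

lemma W12_zero_lincomb:
  assumes \<Omega>: "open \<Omega>" and u: "W12_zero A g vol \<Omega> u X" and v: "W12_zero A g vol \<Omega> v Y"
  shows "W12_zero A g vol \<Omega> (\<lambda>x. u x + t * v x) (\<lambda>c x. X c x + t *\<^sub>R Y c x)"
proof -
  obtain \<phi> where \<phi>: "\<And>n. test_function A \<Omega> (\<phi> n)" "(\<lambda>n. LINT x:\<Omega>|vol. (u x - \<phi> n x)\<^sup>2) \<longlonglongrightarrow> 0"
    "(\<lambda>n. LINT x:\<Omega>|vol. metric_inner A g (\<lambda>c y. X c y - gradient g (\<phi> n) c y) (\<lambda>c y. X c y - gradient g (\<phi> n) c y) x) \<longlonglongrightarrow> 0"
    using u unfolding W12_zero_def Let_def by blast
  obtain \<psi> where \<psi>: "\<And>n. test_function A \<Omega> (\<psi> n)" "(\<lambda>n. LINT x:\<Omega>|vol. (v x - \<psi> n x)\<^sup>2) \<longlonglongrightarrow> 0"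
    "(\<lambda>n. LINT x:\<Omega>|vol. metric_inner A g (\<lambda>c y. Y c y - gradient g (\<psi> n) c y) (\<lambda>c y. Y c y - gradient g (\<psi> n) c y) x) \<longlonglongrightarrow> 0"
    using v unfolding W12_zero_def Let_def by blast
  have W: "W12 A g vol \<Omega> u X" "W12 A g vol \<Omega> v Y" using u v by (auto simp: W12_zero_def)
  have L: "L2_on vol \<Omega> u" "L2_field \<Omega> X" "L2_on vol \<Omega> v" "L2_field \<Omega> Y" using W by (auto simp: W12_iff)
  define \<chi>' where "\<chi>' n x = \<phi> n x + t * \<psi> n x" for n x
  have t\<chi>: "test_function A \<Omega> (\<chi>' n)" for n
    unfolding \<chi>'_def[abs_def] by (rule test_function_add[OF \<phi>(1) test_function_cmult[OF \<psi>(1)]])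
  have Lu: "L2_on vol \<Omega> (\<lambda>x. u x - \<phi> n x)" for n
    using L2_on_lincomb[OF L(1) L2_on_test[OF \<Omega> \<phi>(1)], of "-1" n] by simp
  have Lv: "L2_on vol \<Omega> (\<lambda>x. v x - \<psi> n x)" for n
    using L2_on_lincomb[OF L(3) L2_on_test[OF \<Omega> \<psi>(1)], of "-1" n] by simp
  have LX: "L2_field \<Omega> (\<lambda>c x. X c x - gradient g (\<phi> n) c x)" for n
    using L2_field_lincomb[OF \<Omega> L(2) L2_field_gradient[OF \<Omega> \<phi>(1)], of "-1" n] by simp
  have LY: "L2_field \<Omega> (\<lambda>c x. Y c x - gradient g (\<psi> n) c x)" for n
    using L2_field_lincomb[OF \<Omega> L(4) L2_field_gradient[OF \<Omega> \<psi>(1)], of "-1" n] by simp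
  have sq: "u x + t * v x - \<chi>' n x = (u x - \<phi> n x) + t * (v x - \<psi> n x)" for n x
    by (simp add: \<chi>'_def algebra_simps)
  have 1: "(\<lambda>n. LINT x:\<Omega>|vol. (u x + t * v x - \<chi>' n x)\<^sup>2) \<longlonglongrightarrow> 0"
  proof (rule tendsto_sandwich[OF always_eventually always_eventually tendsto_const])
    show "\<forall>n. 0 \<le> (LINT x:\<Omega>|vol. (u x + t * v x - \<chi>' n x)\<^sup>2)"
      by (intro allI set_integral_nonneg_all) simp
    show "\<forall>n. (LINT x:\<Omega>|vol. (u x + t * v x - \<chi>' n x)\<^sup>2)
      \<le> 2 * (LINT x:\<Omega>|vol. (u x - \<phi> n x)\<^sup>2) + 2 * t\<^sup>2 * (LINT x:\<Omega>|vol. (v x - \<psi> n x)\<^sup>2)"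
    proof
      fix n
      have i: "set_integrable vol \<Omega> (\<lambda>x. (u x - \<phi> n x)\<^sup>2)" "set_integrable vol \<Omega> (\<lambda>x. (v x - \<psi> n x)\<^sup>2)"
        "set_integrable vol \<Omega> (\<lambda>x. ((u x - \<phi> n x) + t * (v x - \<psi> n x))\<^sup>2)"
        using Lu[of n] Lv[of n] L2_on_lincomb[OF Lu[of n] Lv[of n], of t] by (auto simp: L2_on_def)
      have "(LINT x:\<Omega>|vol. (u x + t * v x - \<chi>' n x)\<^sup>2)
          \<le> (LINT x:\<Omega>|vol. 2 * (u x - \<phi> n x)\<^sup>2 + 2 * t\<^sup>2 * (v x - \<psi> n x)\<^sup>2)"
        unfolding sq
      proof (rule set_integral_mono_all)
        show "((u x - \<phi> n x) + t * (v x - \<psi> n x))\<^sup>2 \<le> 2 * (u x - \<phi> n x)\<^sup>2 + 2 * t\<^sup>2 * (v x - \<psi> n x)\<^sup>2" for x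
          using square_add_le[of "u x - \<phi> n x" "t * (v x - \<psi> n x)"] by (simp add: power_mult_distrib)
      qed (use i in \<open>auto intro!: set_integral_add set_integrable_mult_right\<close>)
      also have "\<dots> = 2 * (LINT x:\<Omega>|vol. (u x - \<phi> n x)\<^sup>2) + 2 * t\<^sup>2 * (LINT x:\<Omega>|vol. (v x - \<psi> n x)\<^sup>2)"
        using i by (subst set_integral_add) auto
      finally show "(LINT x:\<Omega>|vol. (u x + t * v x - \<chi>' n x)\<^sup>2)
        \<le> 2 * (LINT x:\<Omega>|vol. (u x - \<phi> n x)\<^sup>2) + 2 * t\<^sup>2 * (LINT x:\<Omega>|vol. (v x - \<psi> n x)\<^sup>2)" .
    qed
    show "(\<lambda>n. 2 * (LINT x:\<Omega>|vol. (u x - \<phi> n x)\<^sup>2) + 2 * t\<^sup>2 * (LINT x:\<Omega>|vol. (v x - \<psi> n x)\<^sup>2)) \<longlonglongrightarrow> 0"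
      using tendsto_add[OF tendsto_mult_left[OF \<phi>(2), of 2] tendsto_mult_left[OF \<psi>(2), of "2 * t\<^sup>2"]] by simp
  qed
  define Z where "Z n c y = (X c y - gradient g (\<phi> n) c y) + t *\<^sub>R (Y c y - gradient g (\<psi> n) c y)" for n c y
  have mz: "metric_inner A g (\<lambda>c y. X c y + t *\<^sub>R Y c y - gradient g (\<chi>' n) c y)
      (\<lambda>c y. X c y + t *\<^sub>R Y c y - gradient g (\<chi>' n) c y) x = metric_inner A g (Z n) (Z n) x" for n x
  proof -
    have "gradient g (\<chi>' n) (chart_at A x) x
        = gradient g (\<phi> n) (chart_at A x) x + t *\<^sub>R gradient g (\<psi> n) (chart_at A x) x"
      unfolding \<chi>'_def[abs_def] by (rule gradient_lincomb[OF \<phi>(1) \<psi>(1) chart_at])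
    then show ?thesis by (simp add: metric_inner_def Let_def Z_def algebra_simps)
  qed
  have 2: "(\<lambda>n. LINT x:\<Omega>|vol. metric_inner A g (\<lambda>c y. X c y + t *\<^sub>R Y c y - gradient g (\<chi>' n) c y)
      (\<lambda>c y. X c y + t *\<^sub>R Y c y - gradient g (\<chi>' n) c y) x) \<longlonglongrightarrow> 0"
    unfolding mz
  proof (rule tendsto_sandwich[OF always_eventually always_eventually tendsto_const])
    let ?x = "\<lambda>n. LINT x:\<Omega>|vol. metric_inner A g (\<lambda>c y. X c y - gradient g (\<phi> n) c y) (\<lambda>c y. X c y - gradient g (\<phi> n) c y) x"
    let ?y = "\<lambda>n. LINT x:\<Omega>|vol. metric_inner A g (\<lambda>c y. Y c y - gradient g (\<psi> n) c y) (\<lambda>c y. Y c y - gradient g (\<psi> n) c y) x"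
    show "\<forall>n. 0 \<le> (LINT x:\<Omega>|vol. metric_inner A g (Z n) (Z n) x)"
      by (intro allI set_integral_nonneg_all metric_inner_nonneg)
    show "\<forall>n. (LINT x:\<Omega>|vol. metric_inner A g (Z n) (Z n) x) \<le> 2 * ?x n + 2 * t\<^sup>2 * ?y n"
    proof
      fix n
      have i: "set_integrable vol \<Omega> (metric_inner A g (\<lambda>c y. X c y - gradient g (\<phi> n) c y) (\<lambda>c y. X c y - gradient g (\<phi> n) c y))"
        "set_integrable vol \<Omega> (metric_inner A g (\<lambda>c y. Y c y - gradient g (\<psi> n) c y) (\<lambda>c y. Y c y - gradient g (\<psi> n) c y))"
        "set_integrable vol \<Omega> (metric_inner A g (Z n) (Z n))"
        using LX[of n] LY[of n] L2_field_lincomb[OF \<Omega> LX[of n] LY[of n], of t]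
        by (auto simp: L2_field_def Z_def[abs_def])
      have "(LINT x:\<Omega>|vol. metric_inner A g (Z n) (Z n) x)
        \<le> (LINT x:\<Omega>|vol. 2 * metric_inner A g (\<lambda>c y. X c y - gradient g (\<phi> n) c y) (\<lambda>c y. X c y - gradient g (\<phi> n) c y) x
          + 2 * t\<^sup>2 * metric_inner A g (\<lambda>c y. Y c y - gradient g (\<psi> n) c y) (\<lambda>c y. Y c y - gradient g (\<psi> n) c y) x)"
      proof (rule set_integral_mono_all)
        show "metric_inner A g (Z n) (Z n) x \<le> 2 * metric_inner A g (\<lambda>c y. X c y - gradient g (\<phi> n) c y) (\<lambda>c y. X c y - gradient g (\<phi> n) c y) x
          + 2 * t\<^sup>2 * metric_inner A g (\<lambda>c y. Y c y - gradient g (\<psi> n) c y) (\<lambda>c y. Y c y - gradient g (\<psi> n) c y) x" for x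
          unfolding Z_def[abs_def] by (rule metric_inner_lincomb_le)
      qed (use i in \<open>auto intro!: set_integral_add set_integrable_mult_right\<close>)
      also have "\<dots> = 2 * ?x n + 2 * t\<^sup>2 * ?y n"
        using i by (subst set_integral_add) auto
      finally show "(LINT x:\<Omega>|vol. metric_inner A g (Z n) (Z n) x) \<le> 2 * ?x n + 2 * t\<^sup>2 * ?y n" .
    qed
    show "(\<lambda>n. 2 * ?x n + 2 * t\<^sup>2 * ?y n) \<longlonglongrightarrow> 0"
      using tendsto_add[OF tendsto_mult_left[OF \<phi>(3), of 2] tendsto_mult_left[OF \<psi>(3), of "2 * t\<^sup>2"]] by simp
  qed
  show ?thesis
    unfolding W12_zero_def Let_def
    using W12_lincomb[OF \<Omega> W] t\<chi> 1 2 by blast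
qed

section \<open>The variational characterization of the first eigenvalue\<close>

lemma dirichlet_energy_lincomb:
  assumes "open \<Omega>" "L2_field \<Omega> X" "L2_field \<Omega> Y"
  shows "(LINT x:\<Omega>|vol. metric_inner A g (\<lambda>c x. X c x + t *\<^sub>R Y c x) (\<lambda>c x. X c x + t *\<^sub>R Y c x) x)
    = (LINT x:\<Omega>|vol. metric_inner A g X X x) + 2 * t * (LINT x:\<Omega>|vol. metric_inner A g X Y x)
      + t\<^sup>2 * (LINT x:\<Omega>|vol. metric_inner A g Y Y x)"
proof -
  note i = L2_field_inner_integrable[OF assms(1,2,2)] L2_field_inner_integrable[OF assms]
    L2_field_inner_integrable[OF assms(1,3,3)]
  show ?thesis
    unfolding metric_inner_lincomb
    by (subst set_integral_add; (intro set_integral_add set_integrable_mult_right i)?)+ simp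
qed

lemma L2_norm_lincomb:
  assumes "L2_on vol \<Omega> u" "L2_on vol \<Omega> v"
  shows "(LINT x:\<Omega>|vol. (u x + t * v x)\<^sup>2) = (LINT x:\<Omega>|vol. (u x)\<^sup>2) + 2 * t * (LINT x:\<Omega>|vol. u x * v x)
      + t\<^sup>2 * (LINT x:\<Omega>|vol. (v x)\<^sup>2)"
proof -
  have i: "set_integrable vol \<Omega> (\<lambda>x. (u x)\<^sup>2)" "set_integrable vol \<Omega> (\<lambda>x. u x * v x)" "set_integrable vol \<Omega> (\<lambda>x. (v x)\<^sup>2)"
    using assms L2_on_mult_integrable[OF assms] by (auto simp: L2_on_def)
  show ?thesis
    unfolding square_lincomb
    by (subst set_integral_add; (intro set_integral_add set_integrable_mult_right i)?)+ simp
qed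

text \<open>Let \<open>m\<close> be the best constant in the inequality, and suppose that it lies below \<open>\<mu>\<close>. Then \<open>m\<close> is in the
  resolvent set, so each \<open>u\<close> is the right-hand side of an equation \<open>- \<Delta> v - m v = u\<close> with a bound on the norm
  of \<open>v\<close>. The form \<open>a(u, w) = \<integral>\<langle>\<nabla>u, \<nabla>w\<rangle> - m \<integral>u w\<close> is nonnegative with \<open>a(v, u) = |u|\<^sup>2\<close> and \<open>a(v, v) \<le> K |u|\<^sup>2\<close>.
  Expanding \<open>a(u - v/K, u - v/K) \<ge> 0\<close> gives \<open>a(u, u) \<ge> |u|\<^sup>2 / K\<close>, that is, the larger constant \<open>m + 1/K\<close>.\<close>

theorem rayleigh_bound:
  assumes \<Omega>: "open \<Omega>" and ev: "first_dirichlet_eigenvalue A g vol \<Omega> \<mu>" and u0: "W12_zero A g vol \<Omega> u0 X0"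
  shows "\<mu> * (LINT x:\<Omega>|vol. (u0 x)\<^sup>2) \<le> (LINT x:\<Omega>|vol. metric_inner A g X0 X0 x)"
proof (rule ccontr)
  define N where "N u = (LINT x:\<Omega>|vol. (u x)\<^sup>2)" for u :: "'a \<Rightarrow> real"
  define E where "E X = (LINT x:\<Omega>|vol. metric_inner A g X X x)" for X
  define S where "S = {t. \<forall>u X. W12_zero A g vol \<Omega> u X \<longrightarrow> t * N u \<le> E X}"
  have N0: "0 \<le> N u" for u unfolding N_def by (rule set_integral_nonneg_all) simp
  have E0: "0 \<le> E X" for X unfolding E_def by (rule set_integral_nonneg_all) (rule metric_inner_nonneg)
  assume "\<not> \<mu> * (LINT x:\<Omega>|vol. (u0 x)\<^sup>2) \<le> (LINT x:\<Omega>|vol. metric_inner A g X0 X0 x)"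
  then have less: "E X0 < \<mu> * N u0" by (simp add: N_def E_def)
  then have Npos: "0 < N u0" using E0[of X0] N0[of u0] by (cases "N u0 = 0") auto
  have Sle: "t \<le> E X0 / N u0" if "t \<in> S" for t
    using that u0 Npos by (auto simp: S_def le_divide_eq)
  have S0: "0 \<in> S" using E0 by (simp add: S_def)
  have bdd: "bdd_above S" by (rule bdd_aboveI) (rule Sle)
  define m where "m = Sup S"
  have "m \<le> E X0 / N u0" unfolding m_def using S0 Sle by (intro cSup_least) auto
  also have "\<dots> < \<mu>" using less Npos by (simp add: divide_less_eq)
  finally have "m < \<mu>" .
  \<comment> \<open>The supremum is attained, so the form stays nonnegative at \<open>m\<close>.\<close>
  have mS: "m * N u \<le> E X" if W: "W12_zero A g vol \<Omega> u X" for u X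
  proof (cases "N u = 0")
    case True
    then show ?thesis using E0 by simp
  next
    case False
    then have pos: "0 < N u" using N0[of u] by simp
    have "t \<le> E X / N u" if "t \<in> S" for t using that W pos by (auto simp: S_def le_divide_eq)
    then have "m \<le> E X / N u" unfolding m_def using S0 by (intro cSup_least) auto
    then show ?thesis using pos by (simp add: le_divide_eq)
  qed
  have "m \<notin> dirichlet_spectrum A g vol \<Omega>"
    using ev \<open>m < \<mu>\<close> unfolding first_dirichlet_eigenvalue_def by force
  then obtain C where C: "\<forall>h. L2_on vol \<Omega> h \<longrightarrow> (\<exists>u X. dirichlet_solution A g vol \<Omega> m h u X)
     \<and> (\<forall>u X. dirichlet_solution A g vol \<Omega> m h u X \<longrightarrow> (LINT x:\<Omega>|vol. (u x)\<^sup>2) \<le> C * (LINT x:\<Omega>|vol. (h x)\<^sup>2))"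
    unfolding dirichlet_spectrum_def by blast
  \<comment> \<open>The absolute value only ensures positivity of \<open>K\<close>; the constant \<open>C\<close> may be negative if
    all norms vanish.\<close>
  define K where "K = (1 + \<bar>C\<bar>) / 2"
  have K: "K > 0" by (simp add: K_def)
  have "m + 1 / K \<in> S"
    unfolding S_def
  proof (intro CollectI allI impI)
    fix u Y assume u: "W12_zero A g vol \<Omega> u Y"
    then have Lu: "L2_on vol \<Omega> u" "L2_field \<Omega> Y" by (auto simp: W12_zero_def W12_iff)
    obtain v Z where sol: "dirichlet_solution A g vol \<Omega> m u v Z" and "N v \<le> C * N u"
      using C Lu(1) unfolding N_def by blast
    then have v: "W12_zero A g vol \<Omega> v Z" by (simp add: dirichlet_solution_def)
    then have Lv: "L2_on vol \<Omega> v" "L2_field \<Omega> Z" by (auto simp: W12_zero_def W12_iff)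
    define I where "I = (LINT x:\<Omega>|vol. u x * v x)"
    define J where "J = (LINT x:\<Omega>|vol. metric_inner A g Y Z x)"
    have eq: "(LINT x:\<Omega>|vol. metric_inner A g Z W x) - m * (LINT x:\<Omega>|vol. v x * w x) = (LINT x:\<Omega>|vol. u x * w x)"
      if "W12_zero A g vol \<Omega> w W" for w W
      using sol that unfolding dirichlet_solution_def by blast
    have e1: "J - m * I = N u"
      using eq[OF u] metric_inner_sym[of Z Y] by (simp add: J_def I_def N_def mult.commute power2_eq_square)
    have e2: "E Z - m * N v = I"
      using eq[OF v] by (simp add: E_def I_def N_def power2_eq_square)
    have "0 \<le> (LINT x:\<Omega>|vol. (u x + (-1) * v x)\<^sup>2)" by (rule set_integral_nonneg_all) simp
    then have "2 * I \<le> N u + N v"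
      unfolding L2_norm_lincomb[OF Lu(1) Lv(1)] by (simp add: N_def I_def)
    moreover have "C * N u \<le> \<bar>C\<bar> * N u" using N0 by (intro mult_right_mono) auto
    ultimately have I: "I \<le> K * N u"
      using \<open>N v \<le> C * N u\<close> by (simp add: K_def field_simps)
    define t where "t = - (1 / K)"
    have "m * N (\<lambda>x. u x + t * v x) \<le> E (\<lambda>c x. Y c x + t *\<^sub>R Z c x)"
      by (rule mS[OF W12_zero_lincomb[OF \<Omega> u v]])
    then have "m * (N u + 2 * t * I + t\<^sup>2 * N v) \<le> E Y + 2 * t * J + t\<^sup>2 * E Z"
      unfolding N_def E_def I_def J_def
      by (simp only: L2_norm_lincomb[OF Lu(1) Lv(1)] dirichlet_energy_lincomb[OF \<Omega> Lu(2) Lv(2)])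
    then have "0 \<le> E Y - m * N u + 2 * t * (J - m * I) + t\<^sup>2 * (E Z - m * N v)"
      by (simp add: algebra_simps)
    then have "0 \<le> E Y - m * N u + 2 * t * N u + t\<^sup>2 * I" unfolding e1 e2 .
    also have "\<dots> \<le> E Y - m * N u + 2 * t * N u + t\<^sup>2 * (K * N u)"
      using I by (intro add_left_mono mult_left_mono) auto
    also have "\<dots> = E Y - (m + 1 / K) * N u"
      using K by (simp add: t_def power2_eq_square field_simps)
    finally show "(m + 1 / K) * N u \<le> E Y" by simp
  qed
  then have "m + 1 / K \<le> m" unfolding m_def using bdd by (rule cSup_upper)
  then show False using K by simp
qed

section \<open>Weights times test functions\<close>

lemma set_borel_measurable_mono:
  fixes h :: "'a \<Rightarrow> 'b::{banach,second_countable_topology}"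
  shows "set_borel_measurable borel S h \<Longrightarrow> open T \<Longrightarrow> T \<subseteq> S \<Longrightarrow> set_borel_measurable borel T h"
  by (rule set_borel_measurable_subset) auto

lemma set_borel_measurable_scaleR:
  fixes h :: "'a \<Rightarrow> real" and k :: "'a \<Rightarrow> 'b::euclidean_space"
  assumes "set_borel_measurable borel S h" "set_borel_measurable borel S k"
  shows "set_borel_measurable borel S (\<lambda>x. h x *\<^sub>R k x)"
proof -
  have "(\<lambda>x. (indicator S x *\<^sub>R h x) *\<^sub>R (indicator S x *\<^sub>R k x)) \<in> borel_measurable borel"
    using assms unfolding set_borel_measurable_def by (rule borel_measurable_scaleR)
  also have "(\<lambda>x. (indicator S x *\<^sub>R h x) *\<^sub>R (indicator S x *\<^sub>R k x)) = (\<lambda>x. indicator S x *\<^sub>R (h x *\<^sub>R k x))"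
    by (auto simp: fun_eq_iff indicator_def)
  finally show ?thesis by (simp add: set_borel_measurable_def)
qed

lemma set_borel_measurable_continuous:
  fixes h :: "'a \<Rightarrow> 'b::real_normed_vector"
  shows "continuous_on UNIV h \<Longrightarrow> open S \<Longrightarrow> set_borel_measurable borel S h"
  unfolding set_borel_measurable_def
  by (rule borel_measurable_continuous_on_indicator) (auto intro: continuous_on_subset)

lemma L2_on_subset:
  assumes "L2_on vol S u" "open T" "T \<subseteq> S"
  shows "L2_on vol T u"
  using assms set_borel_measurable_mono[of S u T] set_integrable_subset[of vol S "\<lambda>x. (u x)\<^sup>2" T]
  by (auto simp: L2_on_def)

lemma L2_field_subset:
  assumes "L2_field S X" "open T" "T \<subseteq> S"
  shows "L2_field T X"
  unfolding L2_field_def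
proof (intro conjI ballI)
  show "vector_field_on A T X" using assms(1,3) unfolding L2_field_def vector_field_on_def by blast
  show "set_borel_measurable borel (chart_dom c \<inter> T) (X c)" if c: "c \<in> A" for c
  proof (rule set_borel_measurable_mono)
    show "set_borel_measurable borel (chart_dom c \<inter> S) (X c)" using assms(1) c by (simp add: L2_field_def)
    show "open (chart_dom c \<inter> T)" by (intro open_Int chart_open c assms(2))
    show "chart_dom c \<inter> T \<subseteq> chart_dom c \<inter> S" using assms(3) by blast
  qed
  show "set_integrable vol T (metric_inner A g X X)"
  proof (rule set_integrable_subset)
    show "set_integrable vol S (metric_inner A g X X)" using assms(1) by (simp add: L2_field_def)
  qed (use assms in simp_all)
qed

lemma metric_inner_scale:
  "metric_inner A g (\<lambda>c x. h x *\<^sub>R X c x) (\<lambda>c x. h x *\<^sub>R X c x) x = metric_inner A g X X x * (h x)\<^sup>2"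
  by (simp add: metric_inner_def Let_def matrix_vector_mult_scaleR power2_eq_square)

lemma L2_field_scale:
  assumes \<Omega>: "open \<Omega>" and X: "vector_field_on A \<Omega> X" "\<And>c. c \<in> A \<Longrightarrow> set_borel_measurable borel (chart_dom c \<inter> \<Omega>) (X c)"
    and h: "set_borel_measurable borel \<Omega> h" and i: "set_integrable vol \<Omega> (\<lambda>x. metric_inner A g X X x * (h x)\<^sup>2)"
  shows "L2_field \<Omega> (\<lambda>c x. h x *\<^sub>R X c x)"
  unfolding L2_field_def
proof (intro conjI ballI)
  show "vector_field_on A \<Omega> (\<lambda>c x. h x *\<^sub>R X c x)"
    unfolding vector_field_on_def
  proof (intro ballI)
    fix c c' x assume c: "c \<in> A" "c' \<in> A" and x: "x \<in> chart_dom c \<inter> chart_dom c' \<inter> \<Omega>"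
    have "X c' x = jacobian c c' x *v X c x" using vector_fieldD[OF X(1) c] x by blast
    then show "h x *\<^sub>R X c' x = jacobian c c' x *v (h x *\<^sub>R X c x)"
      by (simp only: matrix_vector_mult_scaleR)
  qed
  show "set_borel_measurable borel (chart_dom c \<inter> \<Omega>) (\<lambda>x. h x *\<^sub>R X c x)" if c: "c \<in> A" for c
    by (rule set_borel_measurable_scaleR[OF set_borel_measurable_mono[OF h] X(2)[OF c]])
      (use open_Int[OF chart_open[OF c] \<Omega>] in simp_all)
  show "set_integrable vol \<Omega> (metric_inner A g (\<lambda>c x. h x *\<^sub>R X c x) (\<lambda>c x. h x *\<^sub>R X c x))"
    unfolding metric_inner_scale by (rule i)
qed

text \<open>The gradient of \<open>\<omega> f\<close>, where \<open>D\<close> is the weak gradient of \<open>\<omega>\<close>.\<close>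

definition weighted_gradient :: "('a \<Rightarrow> real) \<Rightarrow> 'a vfield \<Rightarrow> ('a \<Rightarrow> real) \<Rightarrow> 'a vfield" where
  "weighted_gradient \<omega> D f c x = \<omega> x *\<^sub>R gradient g f c x + f x *\<^sub>R D c x"

lemma weight_times_test_L2:
  assumes \<Omega>: "open \<Omega>" and w: "W12 A g vol UNIV \<omega> D" and f: "test_function A \<Omega>' f"
  shows "L2_on vol \<Omega> (\<lambda>x. \<omega> x * f x)" "L2_field \<Omega> (weighted_gradient \<omega> D f)"
    "set_integrable vol \<Omega> (\<lambda>x. (\<omega> x)\<^sup>2 * metric_inner A g (gradient g f) (gradient g f) x)"
    "set_integrable vol \<Omega> (\<lambda>x. metric_inner A g D D x * (f x)\<^sup>2)"
proof -
  have L: "L2_on vol \<Omega> \<omega>" "L2_field \<Omega> D"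
    using w L2_on_subset[of UNIV \<omega> \<Omega>] L2_field_subset[of UNIV D \<Omega>] \<Omega> by (auto simp: W12_iff)
  have wm: "set_borel_measurable borel \<Omega> \<omega>" and w2: "set_integrable vol \<Omega> (\<lambda>x. (\<omega> x)\<^sup>2)"
    using L(1) by (auto simp: L2_on_def)
  have fc: "continuous_on UNIV f" and f2c: "continuous_on UNIV (\<lambda>x. (f x)\<^sup>2)"
    using test_continuous[OF f] by (auto intro: continuous_intros)
  have fm: "set_borel_measurable borel \<Omega> f" by (rule set_borel_measurable_continuous[OF fc \<Omega>])
  have "set_integrable vol \<Omega> (\<lambda>x. (\<omega> x)\<^sup>2 * (f x)\<^sup>2)"
    by (rule set_integrable_mult_continuous[OF f2c test_supp(1)[OF f] _ w2]) (simp add: test_supp_0[OF f])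
  moreover have "set_borel_measurable borel \<Omega> (\<lambda>x. \<omega> x * f x)"
    using set_borel_measurable_scaleR[OF wm fm] by simp
  ultimately show "L2_on vol \<Omega> (\<lambda>x. \<omega> x * f x)" by (simp add: L2_on_def power_mult_distrib)
  show i1: "set_integrable vol \<Omega> (\<lambda>x. (\<omega> x)\<^sup>2 * metric_inner A g (gradient g f) (gradient g f) x)"
    by (rule set_integrable_mult_continuous[OF metric_inner_gradient_continuous[OF f f] test_supp(1)[OF f] _ w2])
      (rule metric_inner_gradient_eq_0[OF f])
  show i2: "set_integrable vol \<Omega> (\<lambda>x. metric_inner A g D D x * (f x)\<^sup>2)"
    by (rule set_integrable_mult_continuous[OF f2c test_supp(1)[OF f]])
      (use L(2) in \<open>simp_all add: test_supp_0[OF f] L2_field_def\<close>)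
  have "L2_field \<Omega> (\<lambda>c x. \<omega> x *\<^sub>R gradient g f c x)"
    by (rule L2_field_scale[OF \<Omega> gradient_vector_field[OF f] _ wm])
      (use L2_field_gradient[OF \<Omega> f] i1 in \<open>simp_all add: L2_field_def mult.commute\<close>)
  moreover have "L2_field \<Omega> (\<lambda>c x. f x *\<^sub>R D c x)"
    by (rule L2_field_scale[OF \<Omega> _ _ fm i2]) (use L(2) in \<open>simp_all add: L2_field_def\<close>)
  ultimately have "L2_field \<Omega> (\<lambda>c x. \<omega> x *\<^sub>R gradient g f c x + 1 *\<^sub>R (f x *\<^sub>R D c x))"
    by (rule L2_field_lincomb[OF \<Omega>])
  then show "L2_field \<Omega> (weighted_gradient \<omega> D f)"
    by (simp add: weighted_gradient_def[abs_def])
qed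

text \<open>The function \<open>f \<psi>\<close> in the chart is an admissible test function for \<open>\<omega>\<close>, and the ordinary product rule for
  it becomes the product rule for \<open>\<omega> f\<close>. It suffices that \<open>f \<psi>\<close> is supported in \<open>P\<close>: this covers test
  functions \<open>\<psi>\<close> supported in \<open>P\<close> as well as, for \<open>f\<close> supported in \<open>P\<close>, arbitrary smooth \<open>\<psi>\<close> such as mollifiers.\<close>

lemma weight_times_test_weak:
  assumes w: "W12 A g vol UNIV \<omega> D" and f: "test_function A \<Omega> f" and c: "c \<in> A"
    and P: "compact P" "P \<subseteq> inner_cod c" and \<psi>: "Csmooth UNIV \<psi>"
    and off: "\<And>p. p \<in> inner_cod c \<Longrightarrow> p \<notin> P \<Longrightarrow> f (chart_inv c p) * \<psi> p = 0"
  shows "(LINT p|lborel. pull_fun c P (\<lambda>x. \<omega> x * f x) p * pd i \<psi> p)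
    = - (LINT p|lborel. pull_covec c P (weighted_gradient \<omega> D f) i p * \<psi> p)"
proof -
  define \<Psi> where "\<Psi> p = (if p \<in> inner_cod c then f (chart_inv c p) * \<psi> p else 0)" for p
  have cP: "closed P" using P(1) by (rule compact_imp_closed)
  have o: "open (inner_cod c)" by (rule open_inner_cod[OF c])
  have \<Psi>0: "\<Psi> p = 0" if "p \<notin> P" for p using off that by (simp add: \<Psi>_def)
  have sf: "Csmooth (inner_cod c) (\<lambda>p. f (chart_inv c p))" by (rule test_function_smooth[OF f c])
  have s\<psi>: "Csmooth (inner_cod c) \<psi>" by (rule Csmooth_subset[OF \<psi>]) simp
  have s1: "Csmooth (inner_cod c) \<Psi>"
    by (rule Csmooth_cong[OF o Csmooth_mult[OF o sf s\<psi>]]) (simp add: \<Psi>_def)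
  have s\<Psi>: "Csmooth UNIV \<Psi>"
  proof (rule Csmooth_local)
    fix p
    show "\<exists>W. open W \<and> p \<in> W \<and> Csmooth W \<Psi>"
    proof (cases "p \<in> inner_cod c")
      case True
      then show ?thesis using s1 o by blast
    next
      case False
      have "Csmooth (- P) \<Psi>"
        by (rule Csmooth_cong[OF open_Compl[OF cP] Csmooth_const[of _ 0]]) (simp add: \<Psi>0)
      then show ?thesis using False P(2) open_Compl[OF cP] by blast
    qed
  qed
  have pd\<Psi>: "pd i \<Psi> p = f (chart_inv c p) * pd i \<psi> p + differential f c (chart_inv c p) $ i * \<psi> p"
    if p: "p \<in> inner_cod c" for p
  proof -
    have "pd i \<Psi> p = pd i (\<lambda>p. f (chart_inv c p) * \<psi> p) p"
      by (rule pd_cong[OF o p]) (simp add: \<Psi>_def)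
    also have "\<dots> = f (chart_inv c p) * pd i \<psi> p + pd i (\<lambda>p. f (chart_inv c p)) p * \<psi> p"
      by (rule pd_mult[OF test_differentiable[OF f c p] Csmooth_imp_differentiable[OF open_UNIV \<psi>]]) simp
    finally show ?thesis by (simp add: differential_chart[OF c p])
  qed
  let ?X = "weighted_gradient \<omega> D f"
  have P': "P \<subseteq> chart_map c ` (chart_dom c \<inter> UNIV)" "P \<subseteq> chart_map c ` (chart_dom c \<inter> UNIV \<inter> inner_pts)"
    using P(2) by (auto simp: inner_cod_def)
  obtain R where R: "P \<subseteq> cball 0 R" using compact_subset_cball_0[OF P(1)] by blast
  have W: "L2_on vol UNIV \<omega>" "L2_field UNIV D" "weak_gradient A g UNIV \<omega> D" using w by (auto simp: W12_iff)
  note L = weight_times_test_L2[OF open_UNIV w f]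
  have cont: "continuous_on UNIV \<psi>" "continuous_on UNIV (pd i \<psi>)" "continuous_on UNIV \<Psi>" "continuous_on UNIV (pd i \<Psi>)"
    using \<psi> s\<Psi> Csmooth_imp_continuous_on Csmooth_pd by blast+
  note I = planar_mult_integrable[OF pull_fun_L2[OF c P(1) P'(1) W(1) open_UNIV R] cont(4)]
    planar_mult_integrable[OF pull_covec_L2[OF c P(1) P'(1) L(2) open_UNIV R, of i] cont(1)]
    planar_mult_integrable[OF pull_covec_L2[OF c P(1) P'(1) W(2) open_UNIV R, of i] cont(3)]
  have e: "(LINT p|lborel. pull_fun c P \<omega> p * pd i \<Psi> p) = - (LINT p|lborel. pull_covec c P D i p * \<Psi> p)"
    using W(3)[unfolded weak_gradient_iff[OF open_UNIV W(1,2)]] c P(1) P'(2) s\<Psi> \<Psi>0 by blast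
  have pt: "pull_fun c P (\<lambda>x. \<omega> x * f x) p * pd i \<psi> p = pull_fun c P \<omega> p * pd i \<Psi> p
      - (pull_covec c P ?X i p * \<psi> p - pull_covec c P D i p * \<Psi> p)" for p
  proof (cases "p \<in> P")
    case True
    then have p: "p \<in> inner_cod c" using P(2) by blast
    have "(g c (chart_inv c p) *v ?X c (chart_inv c p)) $ i
        = \<omega> (chart_inv c p) * differential f c (chart_inv c p) $ i
          + f (chart_inv c p) * (g c (chart_inv c p) *v D c (chart_inv c p)) $ i"
      using metric_gradient[OF c, of "chart_inv c p" f] inner_cod_inv[OF c p]
      by (simp add: weighted_gradient_def matrix_vector_right_distrib matrix_vector_mult_scaleR)
    then show ?thesis
      using True p by (simp add: pull_fun_def pull_covec_def pd\<Psi>[OF p] \<Psi>_def algebra_simps)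
  qed (simp add: pull_fun_def pull_covec_def)
  have "(LINT p|lborel. pull_fun c P (\<lambda>x. \<omega> x * f x) p * pd i \<psi> p) = (LINT p|lborel. pull_fun c P \<omega> p * pd i \<Psi> p)
      - ((LINT p|lborel. pull_covec c P ?X i p * \<psi> p) - (LINT p|lborel. pull_covec c P D i p * \<Psi> p))"
    unfolding pt using I by simp
  then show ?thesis by (simp add: e)
qed

lemma weight_times_test_W12:
  assumes \<Omega>: "open \<Omega>" and w: "W12 A g vol UNIV \<omega> D" and f: "test_function A \<Omega>' f"
  shows "W12 A g vol \<Omega> (\<lambda>x. \<omega> x * f x) (weighted_gradient \<omega> D f)"
proof -
  note L = weight_times_test_L2[OF \<Omega> w f]
  have "weak_gradient A g \<Omega> (\<lambda>x. \<omega> x * f x) (weighted_gradient \<omega> D f)"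
    unfolding weak_gradient_iff[OF \<Omega> L(1,2)]
  proof (intro ballI allI impI)
    fix c i P \<psi> assume c: "c \<in> A" and H: "compact P \<and> P \<subseteq> chart_map c ` (chart_dom c \<inter> \<Omega> \<inter> inner_pts)
      \<and> Csmooth UNIV (\<psi> :: real^2 \<Rightarrow> real) \<and> (\<forall>p. p \<notin> P \<longrightarrow> \<psi> p = 0)"
    show "(LINT p|lborel. pull_fun c P (\<lambda>x. \<omega> x * f x) p * pd i \<psi> p)
      = - (LINT p|lborel. pull_covec c P (weighted_gradient \<omega> D f) i p * \<psi> p)"
      by (rule weight_times_test_weak[OF w f c]) (use H in \<open>auto simp: inner_cod_def\<close>)
  qed
  then show ?thesis using L by (simp add: W12_iff)
qed

section \<open>Approximation in a chart\<close>

definition chart_ext :: "'a chart \<Rightarrow> (real^2 \<Rightarrow> real) \<Rightarrow> 'a \<Rightarrow> real" where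
  "chart_ext c F y = (if y \<in> chart_dom c then F (chart_map c y) else 0)"

lemma chart_inv_image_compact:
  assumes "c \<in> A" "compact P" "P \<subseteq> chart_map c ` (chart_dom c \<inter> S)"
  shows "compact (chart_inv c ` P)" "chart_inv c ` P \<subseteq> chart_dom c \<inter> S" "chart_map c ` chart_inv c ` P = P"
proof -
  have "P \<subseteq> chart_cod c" using assms(3) by blast
  then show "compact (chart_inv c ` P)"
    by (intro compact_continuous_image assms continuous_on_subset[OF chart_inv_cont[OF assms(1)]])
  show "chart_inv c ` P \<subseteq> chart_dom c \<inter> S" using assms(3) chart_inv_map[OF assms(1)] by auto
  show "chart_map c ` chart_inv c ` P = P"
    using \<open>P \<subseteq> chart_cod c\<close> chart_map_inv[OF assms(1)] by (force simp: image_def)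
qed

lemma chart_inv_image_iff:
  assumes "c \<in> A" "x \<in> chart_dom c" "P \<subseteq> chart_cod c"
  shows "x \<in> chart_inv c ` P \<longleftrightarrow> chart_map c x \<in> P"
proof
  assume "x \<in> chart_inv c ` P"
  then show "chart_map c x \<in> P" using assms(3) chart_map_inv[OF assms(1)] by auto
next
  assume "chart_map c x \<in> P"
  then show "x \<in> chart_inv c ` P" using chart_inv_map[OF assms(1,2)] by (metis imageI)
qed

lemma chart_ext_test:
  assumes c: "c \<in> A" and F: "Csmooth UNIV F" "\<And>p. p \<notin> P \<Longrightarrow> F p = 0"
    and P: "compact P" "P \<subseteq> chart_map c ` (chart_dom c \<inter> (\<Omega> \<inter> inner_pts))"
  shows "test_function A \<Omega> (chart_ext c F)" "\<And>x. x \<notin> chart_inv c ` P \<Longrightarrow> chart_ext c F x = 0"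
proof -
  note K = chart_inv_image_compact[OF c P]
  have Pc: "P \<subseteq> chart_cod c" using P(2) by blast
  show off: "chart_ext c F x = 0" if "x \<notin> chart_inv c ` P" for x
    using that F(2) chart_inv_image_iff[OF c _ Pc, of x] by (auto simp: chart_ext_def)
  show "test_function A \<Omega> (chart_ext c F)"
  proof (rule test_functionI[OF K(1) _ off])
    show "chart_inv c ` P \<subseteq> \<Omega> \<inter> inner_pts" using K(2) by blast
    fix x assume "x \<in> chart_inv c ` P"
    then have x: "x \<in> chart_dom c" "x \<in> inner_pts" using K(2) by auto
    have "Csmooth (inner_cod c) (\<lambda>p. chart_ext c F (chart_inv c p))"
    proof (rule Csmooth_cong[OF open_inner_cod[OF c] Csmooth_subset[OF F(1)]])
      fix p assume "p \<in> inner_cod c"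
      then show "F p = chart_ext c F (chart_inv c p)"
        using inner_cod_inv[OF c, of p] inner_cod_map_inv[OF c, of p] by (simp add: chart_ext_def)
    qed simp
    moreover have "chart_map c x \<in> inner_cod c" using x by (simp add: inner_cod_def)
    ultimately show "\<exists>c'\<in>A. \<exists>U. x \<in> chart_dom c' \<and> open U \<and> chart_map c' x \<in> U \<and> U \<subseteq> inner_cod c'
      \<and> Csmooth U (\<lambda>p. chart_ext c F (chart_inv c' p))"
      using c x(1) open_inner_cod[OF c] by blast
  qed
qed

text \<open>The converse estimate to the one for pull-backs: here the density of the measure is bounded above.\<close>

lemma push_integral_le:
  assumes c: "c \<in> A" and P: "compact P" "P \<subseteq> chart_map c ` (chart_dom c \<inter> \<Omega>)"
    and h: "set_borel_measurable borel \<Omega> h" "\<And>x. 0 \<le> h x" "\<And>x. x \<notin> chart_inv c ` P \<Longrightarrow> h x = 0"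
    and k: "integrable lborel k" "\<And>p. 0 \<le> k p" "\<And>p. p \<in> P \<Longrightarrow> h (chart_inv c p) \<le> k p"
    and C: "C > 0" "\<And>p. p \<in> P \<Longrightarrow> vol_density c p \<le> C"
  shows "(LINT x:\<Omega>|vol. h x) \<le> C * (LINT p|lborel. k p)"
  unfolding set_lebesgue_integral_def
proof (rule integral_real_bounded)
  let ?N = "chart_inv c ` P"
  note K = chart_inv_image_compact[OF c P]
  have Pc: "P \<subseteq> chart_cod c" using P(2) by blast
  have Nm: "?N \<in> sets borel" using K(1) by (simp add: compact_imp_closed)
  have "set_borel_measurable borel ?N h"
    by (rule set_borel_measurable_subset[OF h(1)]) (use Nm K(2) in auto)
  then have "(\<lambda>x. ennreal (indicator ?N x *\<^sub>R h x)) \<in> borel_measurable borel"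
    unfolding set_borel_measurable_def by measurable
  also have "(\<lambda>x. ennreal (indicator ?N x *\<^sub>R h x)) = (\<lambda>x. ennreal (h x) * indicator ?N x)"
    by (auto simp: fun_eq_iff indicator_def)
  finally have m: "(\<lambda>x. ennreal (h x) * indicator ?N x) \<in> borel_measurable borel" .
  show "0 \<le> C * (LINT p|lborel. k p)" using C(1) k(2) by simp
  have "(\<integral>\<^sup>+x. ennreal (indicator \<Omega> x *\<^sub>R h x) \<partial>vol) \<le> (\<integral>\<^sup>+x\<in>?N. ennreal (h x) \<partial>vol)"
    using h(3) by (intro nn_integral_mono) (auto simp: indicator_def)
  also have "\<dots> = (\<integral>\<^sup>+p\<in>chart_map c ` ?N. ennreal (vol_density c p) * ennreal (h (chart_inv c p)) \<partial>lborel)"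
    by (rule chart_change_of_variables[OF c Nm _ m]) (use K(2) in blast)
  also have "\<dots> \<le> (\<integral>\<^sup>+p. ennreal (C * k p) \<partial>lborel)"
    unfolding K(3)
  proof (rule nn_integral_mono)
    fix p
    show "ennreal (vol_density c p) * ennreal (h (chart_inv c p)) * indicator P p \<le> ennreal (C * k p)"
    proof (cases "p \<in> P")
      case True
      have "0 \<le> vol_density c p" using vol_density_pos[OF c] Pc True by force
      then have "vol_density c p * h (chart_inv c p) \<le> C * k p"
        using C k(3)[OF True] C(2)[OF True] h(2) by (intro mult_mono) auto
      then show ?thesis
        using True \<open>0 \<le> vol_density c p\<close> h(2) by (simp add: ennreal_mult[symmetric] ennreal_leI)
    qed simp
  qed
  also have "\<dots> = ennreal (LINT p|lborel. C * k p)"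
    using k C(1) by (intro nn_integral_eq_integral) auto
  finally show "(\<integral>\<^sup>+x. ennreal (indicator \<Omega> x *\<^sub>R h x) \<partial>vol) \<le> ennreal (C * (LINT p|lborel. k p))" by simp
qed

text \<open>In the chart, \<open>\<omega> f\<close> has compact support and weak derivatives in \<open>L\<^sup>2\<close>. Its mollifications are smooth,
  their derivatives are the mollified weak derivatives, and their supports stay in a compact neighbourhood
  \<open>P1\<close> of \<open>P\<close>, so they extend by zero to test functions on the surface. On \<open>P1\<close> planar and Riemannian norms
  are comparable.\<close>

lemma weight_times_chart_test_W12_zero:
  assumes \<Omega>: "open \<Omega>" and w: "W12 A g vol UNIV \<omega> D" and f: "test_function A \<Omega> f" and c: "c \<in> A"
    and P: "compact P" "P \<subseteq> chart_map c ` (chart_dom c \<inter> (\<Omega> \<inter> inner_pts))"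
    and off: "\<And>x. x \<notin> chart_inv c ` P \<Longrightarrow> f x = 0"
  shows "W12_zero A g vol \<Omega> (\<lambda>x. \<omega> x * f x) (weighted_gradient \<omega> D f)"
proof -
  let ?X = "weighted_gradient \<omega> D f"
  define V where "V = chart_map c ` (chart_dom c \<inter> (\<Omega> \<inter> inner_pts))"
  have oV: "open V" unfolding V_def
    by (rule chart_image_open[OF c]) (auto intro!: open_Int chart_open c \<Omega> open_inner_pts)
  have PV: "P \<subseteq> V" using P(2) by (simp add: V_def)
  obtain d where d: "d > 0" "(\<Union>x\<in>P. cball x d) \<subseteq> V"
    using compact_subset_open_imp_cball_epsilon_subset[OF P(1) oV PV] by blast
  define P1 where "P1 = {x + w |x w. x \<in> P \<and> w \<in> cball (0::real^2) d}"
  have cP1: "compact P1" unfolding P1_def by (rule compact_sums[OF P(1) compact_cball])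
  have P1near: "x \<in> P1" if "y \<in> P" "dist x y \<le> d" for x y
  proof -
    have "x = y + (x - y)" "x - y \<in> cball 0 d" using that(2) by (auto simp: dist_norm norm_minus_commute)
    then show ?thesis using that(1) unfolding P1_def by blast
  qed
  have PP1: "P \<subseteq> P1" using P1near[of _ _] d(1) by force
  have P1V: "P1 \<subseteq> V"
  proof
    fix z assume "z \<in> P1"
    then obtain x w where "x \<in> P" "w \<in> cball 0 d" "z = x + w" unfolding P1_def by blast
    then have "x \<in> P" "z \<in> cball x d" by (auto simp: dist_norm)
    then show "z \<in> V" using d(2) by blast
  qed
  have V': "V \<subseteq> chart_map c ` (chart_dom c \<inter> \<Omega>)" "V \<subseteq> inner_cod c" by (auto simp: V_def inner_cod_def)
  obtain R where R: "P1 \<subseteq> cball 0 R" using compact_subset_cball_0[OF cP1] by blast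
  have W12X: "W12 A g vol \<Omega> (\<lambda>x. \<omega> x * f x) ?X" by (rule weight_times_test_W12[OF \<Omega> w f])
  then have LX: "L2_on vol \<Omega> (\<lambda>x. \<omega> x * f x)" "L2_field \<Omega> ?X" by (auto simp: W12_iff)
  define U where "U = pull_fun c P (\<lambda>x. \<omega> x * f x)"
  define G where "G i = pull_covec c P ?X i" for i
  have PO: "P \<subseteq> chart_map c ` (chart_dom c \<inter> \<Omega>)" "P \<subseteq> cball 0 R" "P \<subseteq> inner_cod c" using PV V' PP1 R by auto
  have LU: "planar_L2 R U" unfolding U_def by (rule pull_fun_L2[OF c P(1) PO(1) LX(1) \<Omega> PO(2)])
  have LG: "planar_L2 R (G i)" for i unfolding G_def by (rule pull_covec_L2[OF c P(1) PO(1) LX(2) \<Omega> PO(2)])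
  have Pcod: "P \<subseteq> chart_cod c" using PO(3) inner_cod_subset by (rule order_trans)
  have f0: "f (chart_inv c p) = 0" if "p \<in> inner_cod c" "p \<notin> P" for p
  proof (rule off)
    show "chart_inv c p \<notin> chart_inv c ` P"
      using chart_inv_image_iff[OF c _ Pcod, of "chart_inv c p"] inner_cod_inv[OF c that(1)]
        inner_cod_map_inv[OF c that(1)] that(2) by simp
  qed
  have weak: "(LINT p|lborel. U p * pd i \<psi> p) = - (LINT p|lborel. G i p * \<psi> p)" if "Csmooth UNIV \<psi>" for i \<psi>
    unfolding U_def G_def by (rule weight_times_test_weak[OF w f c P(1) PO(3) that]) (simp add: f0)
  note K = chart_inv_image_compact[OF c P]
  have X0: "?X c' x = 0" if "x \<notin> chart_inv c ` P" "c' \<in> A" "x \<in> chart_dom c'" for c' x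
  proof -
    have "gradient g f c' x = 0"
      by (rule gradient_eq_0[OF that(2,3), of "- (chart_inv c ` P)"])
        (use that(1) off K(1) in \<open>auto simp: open_Compl compact_imp_closed\<close>)
    then show ?thesis using off[OF that(1)] by (simp add: weighted_gradient_def)
  qed
  have P1c: "P1 \<subseteq> chart_cod c" using P1V V'(2) inner_cod_subset by blast
  obtain C where C: "C > 0" "\<And>p. p \<in> P1 \<Longrightarrow> vol_density c p \<le> C"
    "\<And>p v. p \<in> P1 \<Longrightarrow> v \<bullet> (g c (chart_inv c p) *v v) \<le> C * (norm (g c (chart_inv c p) *v v))\<^sup>2"
    using chart_compact_bounds[OF c cP1 P1c] by metis
  have approx: "\<exists>\<psi>. test_function A \<Omega> \<psi> \<and> (LINT x:\<Omega>|vol. (\<omega> x * f x - \<psi> x)\<^sup>2) \<le> e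
      \<and> (LINT x:\<Omega>|vol. metric_inner A g (\<lambda>c y. ?X c y - gradient g \<psi> c y) (\<lambda>c y. ?X c y - gradient g \<psi> c y) x) \<le> e"
    if e: "e > 0" for e
  proof -
    \<comment> \<open>One factor \<open>C\<close> comes from the density, the second from comparing the norm of a field with
      that of its covector, which has two components.\<close>
    define e1 where "e1 = e / (C + 2 * C\<^sup>2)"
    have e1: "e1 > 0" "C * e1 \<le> e" "2 * C\<^sup>2 * e1 \<le> e"
      using e C(1) by (auto simp: e1_def field_simps add_pos_pos)
    obtain dU where dU: "dU > 0" "\<And>r \<phi>. r \<le> dU \<Longrightarrow> mollifier r \<phi> \<Longrightarrow> (LINT x|lborel. (U x - conv U \<phi> x)\<^sup>2) \<le> e1"
      using conv_tendsto_L2[OF LU e1(1)] by blast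
    obtain d1 where d1: "d1 > 0" "\<And>r \<phi>. r \<le> d1 \<Longrightarrow> mollifier r \<phi> \<Longrightarrow> (LINT x|lborel. (G 1 x - conv (G 1) \<phi> x)\<^sup>2) \<le> e1"
      using conv_tendsto_L2[OF LG e1(1)] by blast
    obtain d2 where d2: "d2 > 0" "\<And>r \<phi>. r \<le> d2 \<Longrightarrow> mollifier r \<phi> \<Longrightarrow> (LINT x|lborel. (G 2 x - conv (G 2) \<phi> x)\<^sup>2) \<le> e1"
      using conv_tendsto_L2[OF LG e1(1)] by blast
    define r where "r = min (min d dU) (min d1 d2)"
    have r: "r > 0" "r \<le> d" "r \<le> dU" "r \<le> d1" "r \<le> d2" using d dU d1 d2 by (auto simp: r_def)
    obtain \<phi> where \<phi>: "mollifier r \<phi>" using mollifier_exists[OF r(1)] by blast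
    then have s\<phi>: "Csmooth UNIV \<phi>" and \<phi>0: "\<And>p. p \<notin> ball 0 r \<Longrightarrow> \<phi> p = 0" by (auto simp: mollifier_def)
    define Uc where "Uc = conv U \<phi>"
    have sUn: "Csmooth UNIV Uc" unfolding Uc_def
      by (rule Csmooth_conv[OF planar_L2_integrable[OF LU] P(1) _ s\<phi>]) (simp add: U_def pull_fun_def)
    have Un0: "Uc p = 0" if "p \<notin> P1" for p
      unfolding Uc_def
    proof (rule conv_eq_0[of P])
      show "U y = 0" if "y \<notin> P" for y using that by (simp add: U_def pull_fun_def)
      show "r \<le> dist p y" if "y \<in> P" for y
        using P1near[OF that, of p] \<open>p \<notin> P1\<close> r(2) by force
    qed (rule \<phi>0)
    have pdUn: "pd i Uc p = conv (G i) \<phi> p" for i p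
      unfolding Uc_def by (rule pd_conv_weak[OF LU weak s\<phi>])
    define \<psi> where "\<psi> = chart_ext c Uc"
    have t: "test_function A \<Omega> \<psi>" and \<psi>0: "\<And>x. x \<notin> chart_inv c ` P1 \<Longrightarrow> \<psi> x = 0"
      unfolding \<psi>_def using chart_ext_test[OF c sUn Un0 cP1, of \<Omega>] P1V unfolding V_def by blast+
    have \<psi>p: "\<psi> (chart_inv c p) = Uc p" if "p \<in> inner_cod c" for p
      using inner_cod_inv[OF c that] inner_cod_map_inv[OF c that] by (simp add: \<psi>_def chart_ext_def)
    have d\<psi>: "differential \<psi> c (chart_inv c p) $ i = conv (G i) \<phi> p" if p: "p \<in> inner_cod c" for p i
    proof -
      have "differential \<psi> c (chart_inv c p) $ i = pd i (\<lambda>p. \<psi> (chart_inv c p)) p"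
        by (rule differential_chart[OF c p])
      also have "\<dots> = pd i Uc p" by (rule pd_cong[OF open_inner_cod[OF c] p]) (rule \<psi>p)
      finally show ?thesis by (simp add: pdUn)
    qed
    have P1': "P1 \<subseteq> chart_map c ` (chart_dom c \<inter> \<Omega>)" using P1V V'(1) by blast
    have sub: "chart_inv c ` P \<subseteq> chart_inv c ` P1" using PP1 by blast
    have Ln: "planar_L2 (R + r) (\<lambda>p. v p - conv v \<phi> p)" if "planar_L2 R v" for v
      by (rule planar_L2_diff[OF planar_L2_mono[OF that] planar_L2_conv[OF that \<phi>]]) (use r in simp)
    have "(LINT x:\<Omega>|vol. (\<omega> x * f x - \<psi> x)\<^sup>2) \<le> C * (LINT p|lborel. (U p - conv U \<phi> p)\<^sup>2)"
    proof (rule push_integral_le[OF c cP1 P1'])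
      have "L2_on vol \<Omega> (\<lambda>x. \<omega> x * f x + (-1) * \<psi> x)"
        by (rule L2_on_lincomb[OF LX(1) L2_on_test[OF \<Omega> t]])
      then have "set_integrable vol \<Omega> (\<lambda>x. (\<omega> x * f x - \<psi> x)\<^sup>2)" by (simp add: L2_on_def)
      from borel_measurable_integrable[OF this[unfolded set_integrable_def]]
      show "set_borel_measurable borel \<Omega> (\<lambda>x. (\<omega> x * f x - \<psi> x)\<^sup>2)" by (simp add: set_borel_measurable_def)
      show "(\<omega> x * f x - \<psi> x)\<^sup>2 = 0" if "x \<notin> chart_inv c ` P1" for x
        using off[of x] \<psi>0[OF that] sub that by auto
      show "integrable lborel (\<lambda>p. (U p - conv U \<phi> p)\<^sup>2)" using Ln[OF LU] by (simp add: planar_L2_def)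
      fix p assume p: "p \<in> P1"
      then have pi: "p \<in> inner_cod c" using P1V V'(2) by blast
      have "\<omega> (chart_inv c p) * f (chart_inv c p) = U p"
        using f0[OF pi] by (simp add: U_def pull_fun_def)
      then show "(\<omega> (chart_inv c p) * f (chart_inv c p) - \<psi> (chart_inv c p))\<^sup>2 \<le> (U p - conv U \<phi> p)\<^sup>2"
        by (simp add: \<psi>p[OF pi] Uc_def)
    qed (use C in auto)
    also have "\<dots> \<le> C * e1" using dU(2)[OF r(3) \<phi>] C(1) by (intro mult_left_mono) auto
    finally have 1: "(LINT x:\<Omega>|vol. (\<omega> x * f x - \<psi> x)\<^sup>2) \<le> e" using e1(2) by simp
    define Y where "Y c y = ?X c y - gradient g \<psi> c y" for c y
    have LY: "L2_field \<Omega> Y"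
      using L2_field_lincomb[OF \<Omega> LX(2) L2_field_gradient[OF \<Omega> t], of "-1"] by (simp add: Y_def[abs_def])
    let ?k = "\<lambda>p. C * ((G 1 p - conv (G 1) \<phi> p)\<^sup>2 + (G 2 p - conv (G 2) \<phi> p)\<^sup>2)"
    have ik: "integrable lborel (\<lambda>p. (G i p - conv (G i) \<phi> p)\<^sup>2)" for i
      using Ln[OF LG, of i] by (simp add: planar_L2_def)
    have "(LINT x:\<Omega>|vol. metric_inner A g Y Y x) \<le> C * (LINT p|lborel. ?k p)"
    proof (rule push_integral_le[OF c cP1 P1'])
      have "set_integrable vol \<Omega> (metric_inner A g Y Y)" using LY by (simp add: L2_field_def)
      from borel_measurable_integrable[OF this[unfolded set_integrable_def]]
      show "set_borel_measurable borel \<Omega> (metric_inner A g Y Y)" by (simp add: set_borel_measurable_def)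
      show "0 \<le> metric_inner A g Y Y x" for x by (rule metric_inner_nonneg)
      show "metric_inner A g Y Y x = 0" if x: "x \<notin> chart_inv c ` P1" for x
      proof -
        have "compact (chart_inv c ` P1)" using chart_inv_image_compact[OF c cP1 P1'] by blast
        then have "gradient g \<psi> (chart_at A x) x = 0"
          by (intro gradient_eq_0[OF chart_at, of "- (chart_inv c ` P1)"])
            (use x \<psi>0 in \<open>auto simp: open_Compl compact_imp_closed\<close>)
        moreover have "?X (chart_at A x) x = 0"
          by (rule X0[OF _ chart_at]) (use x sub in blast)
        ultimately show ?thesis by (simp add: metric_inner_def Let_def Y_def)
      qed
      show "integrable lborel ?k" using ik by (intro integrable_mult_right Bochner_Integration.integrable_add)
      fix p
      show "0 \<le> ?k p" using C(1) by simp
      assume p: "p \<in> P1"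
      then have pi: "p \<in> inner_cod c" using P1V V'(2) by blast
      let ?x = "chart_inv c p"
      have x: "?x \<in> chart_dom c \<inter> \<Omega>" using p P1' chart_inv_map[OF c] by auto
      have xd: "?x \<in> chart_dom c" using x by blast
      have gX: "(g c ?x *v ?X c ?x) $ i = G i p" for i
      proof (cases "p \<in> P")
        case True
        then show ?thesis by (simp add: G_def pull_covec_def)
      next
        case False
        have "?x \<notin> chart_inv c ` P"
          using chart_inv_image_iff[OF c xd Pcod] False inner_cod_map_inv[OF c pi] by simp
        then have "?X c ?x = 0" by (rule X0[OF _ c xd])
        then show ?thesis using False by (simp add: G_def pull_covec_def)
      qed
      have gY: "(g c ?x *v Y c ?x) $ i = G i p - conv (G i) \<phi> p" for i
      proof -
        have "g c ?x *v Y c ?x = g c ?x *v ?X c ?x - differential \<psi> c ?x"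
          by (simp add: Y_def matrix_vector_mult_diff_distrib metric_gradient[OF c xd])
        then show ?thesis by (simp add: gX d\<psi>[OF pi])
      qed
      have "metric_inner A g Y Y ?x = Y c ?x \<bullet> (g c ?x *v Y c ?x)"
        using LY by (intro metric_inner_chart[OF _ _ c x]) (simp_all add: L2_field_def)
      also have "\<dots> \<le> C * (norm (g c ?x *v Y c ?x))\<^sup>2" by (rule C(3)[OF p])
      also have "\<dots> = ?k p"
        by (simp add: power2_norm_eq_inner inner_2 gY power2_eq_square[of "_ - _"])
      finally show "metric_inner A g Y Y ?x \<le> ?k p" .
    qed (use C in auto)
    also have "\<dots> = C * (C * ((LINT p|lborel. (G 1 p - conv (G 1) \<phi> p)\<^sup>2) + (LINT p|lborel. (G 2 p - conv (G 2) \<phi> p)\<^sup>2)))"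
      using ik by simp
    also have "\<dots> \<le> C * (C * (e1 + e1))"
      using d1(2)[OF r(4) \<phi>] d2(2)[OF r(5) \<phi>] C(1) by (intro mult_left_mono add_mono) auto
    also have "\<dots> = 2 * C\<^sup>2 * e1" by (simp add: power2_eq_square)
    finally have 2: "(LINT x:\<Omega>|vol. metric_inner A g Y Y x) \<le> e" using e1(3) by simp
    show ?thesis using t 1 2 unfolding Y_def[abs_def] by blast
  qed
  let ?en = "\<lambda>n::nat. 1 / (real n + 1)"
  have "\<forall>n. \<exists>\<psi>. test_function A \<Omega> \<psi> \<and> (LINT x:\<Omega>|vol. (\<omega> x * f x - \<psi> x)\<^sup>2) \<le> ?en n
      \<and> (LINT x:\<Omega>|vol. metric_inner A g (\<lambda>c y. ?X c y - gradient g \<psi> c y) (\<lambda>c y. ?X c y - gradient g \<psi> c y) x) \<le> ?en n"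
    by (intro allI approx) simp
  from choice[OF this] obtain \<psi> where \<psi>: "\<And>n. test_function A \<Omega> (\<psi> n)"
    "\<And>n. (LINT x:\<Omega>|vol. (\<omega> x * f x - \<psi> n x)\<^sup>2) \<le> ?en n"
    "\<And>n. (LINT x:\<Omega>|vol. metric_inner A g (\<lambda>c y. ?X c y - gradient g (\<psi> n) c y) (\<lambda>c y. ?X c y - gradient g (\<psi> n) c y) x) \<le> ?en n"
    by blast
  have en: "?en \<longlonglongrightarrow> 0" using LIMSEQ_inverse_real_of_nat by (simp add: inverse_eq_divide add.commute)
  have "(\<lambda>n. LINT x:\<Omega>|vol. (\<omega> x * f x - \<psi> n x)\<^sup>2) \<longlonglongrightarrow> 0"
    by (rule tendsto_sandwich[OF always_eventually always_eventually tendsto_const en])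
      (use \<psi>(2) in \<open>auto intro!: set_integral_nonneg_all\<close>)
  moreover have "(\<lambda>n. LINT x:\<Omega>|vol. metric_inner A g (\<lambda>c y. ?X c y - gradient g (\<psi> n) c y)
      (\<lambda>c y. ?X c y - gradient g (\<psi> n) c y) x) \<longlonglongrightarrow> 0"
    by (rule tendsto_sandwich[OF always_eventually always_eventually tendsto_const en])
      (use \<psi>(3) in \<open>auto intro!: set_integral_nonneg_all metric_inner_nonneg\<close>)
  ultimately show ?thesis
    unfolding W12_zero_def Let_def using W12X \<psi>(1) by blast
qed

section \<open>Partition of unity\<close>

lemma local_bump_exists:
  assumes \<Omega>: "open \<Omega>" and x: "x \<in> \<Omega> \<inter> inner_pts"
  shows "\<exists>c P b. c \<in> A \<and> compact P \<and> P \<subseteq> chart_map c ` (chart_dom c \<inter> (\<Omega> \<inter> inner_pts))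
    \<and> test_function A \<Omega> b \<and> (\<forall>y. y \<notin> chart_inv c ` P \<longrightarrow> b y = 0) \<and> (\<forall>y. 0 \<le> b y) \<and> 0 < b x"
proof -
  have "open (\<Omega> \<inter> inner_pts)" using \<Omega> open_inner_pts by (rule open_Int)
  then obtain c r where c: "c \<in> A" "x \<in> chart_dom c" "0 < r" "cball (chart_map c x) r \<subseteq> inner_cod c"
    "chart_inv c ` cball (chart_map c x) r \<subseteq> \<Omega> \<inter> inner_pts"
    using chart_ball_exists[OF x] by blast
  let ?P = "cball (chart_map c x) r"
  have P: "?P \<subseteq> chart_map c ` (chart_dom c \<inter> (\<Omega> \<inter> inner_pts))"
  proof
    fix p assume p: "p \<in> ?P"
    then have pi: "p \<in> inner_cod c" using c(4) by blast
    have "chart_inv c p \<in> chart_dom c \<inter> (\<Omega> \<inter> inner_pts)" using inner_cod_inv[OF c(1) pi] c(5) p by blast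
    then show "p \<in> chart_map c ` (chart_dom c \<inter> (\<Omega> \<inter> inner_pts))"
      using inner_cod_map_inv[OF c(1) pi] by (metis imageI)
  qed
  have b0: "bump (chart_map c x) r p = 0" if "p \<notin> ?P" for p
    using bump_eq_0[OF c(3)] that by auto
  note t = chart_ext_test[OF c(1) Csmooth_bump b0 compact_cball P]
  have "0 \<le> chart_ext c (bump (chart_map c x) r) y" for y by (simp add: chart_ext_def bump_nonneg)
  moreover have "0 < chart_ext c (bump (chart_map c x) r) x"
    using bump_pos_iff[OF c(3)] c(2,3) by (simp add: chart_ext_def)
  ultimately show ?thesis
    by (intro exI[of _ c] exI[of _ ?P] exI[of _ "chart_ext c (bump (chart_map c x) r)"] conjI allI impI)
      (use c(1) P t in \<open>auto simp del: mem_cball\<close>)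
qed

text \<open>Finitely many local bumps have a sum \<open>B\<close> that is positive on the support of \<open>f\<close>, and \<open>f\<close> is
  distributed in proportion to the bumps. Off the support of \<open>f\<close> a vanishing denominator is harmless, as the
  numerator vanishes.\<close>

lemma test_function_partition:
  assumes \<Omega>: "open \<Omega>" and f: "test_function A \<Omega> f"
  shows "\<exists>(I :: 'a set) F c P. finite I \<and> (\<forall>x. f x = (\<Sum>j\<in>I. F j x))
    \<and> (\<forall>j\<in>I. test_function A \<Omega> (F j) \<and> c j \<in> A \<and> compact (P j)
      \<and> P j \<subseteq> chart_map (c j) ` (chart_dom (c j) \<inter> (\<Omega> \<inter> inner_pts))
      \<and> (\<forall>x. x \<notin> chart_inv (c j) ` P j \<longrightarrow> F j x = 0))"
proof -
  define K where "K = supp f"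
  have K: "compact K" "K \<subseteq> \<Omega> \<inter> inner_pts" "\<And>x. x \<notin> K \<Longrightarrow> f x = 0"
    using test_supp[OF f] test_supp_0[OF f] by (auto simp: K_def)
  define Q where "Q x c P b \<longleftrightarrow> c \<in> A \<and> compact P \<and> P \<subseteq> chart_map c ` (chart_dom c \<inter> (\<Omega> \<inter> inner_pts))
    \<and> test_function A \<Omega> b \<and> (\<forall>y. y \<notin> chart_inv c ` P \<longrightarrow> b y = 0) \<and> (\<forall>y. 0 \<le> b y) \<and> 0 < b x" for x c P b
  have "\<forall>x\<in>K. \<exists>c P b. Q x c P b"
    unfolding Q_def using local_bump_exists[OF \<Omega>] K(2) by blast
  from bchoice[OF this] obtain c where "\<forall>x\<in>K. \<exists>P b. Q x (c x) P b" by blast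
  from bchoice[OF this] obtain P where "\<forall>x\<in>K. \<exists>b. Q x (c x) (P x) b" by blast
  from bchoice[OF this] obtain b where Q: "\<forall>x\<in>K. Q x (c x) (P x) (b x)" by blast
  have bt: "test_function A \<Omega> (b j)" and b0: "0 \<le> b j y" and bj: "0 < b j j" if "j \<in> K" for j y
    using Q that by (auto simp: Q_def)
  have ob: "open {y. 0 < b j y}" if "j \<in> K" for j
    using open_Collect_less[OF continuous_on_const[of UNIV 0] test_continuous[OF bt[OF that]]] by simp
  have cov: "K \<subseteq> (\<Union>j\<in>K. {y. 0 < b j y})" using bj by blast
  obtain I where I: "I \<subseteq> K" "finite I" "K \<subseteq> (\<Union>j\<in>I. {y. 0 < b j y})"
    using compactE_image[OF K(1) ob cov] by blast
  define B where "B y = (\<Sum>j\<in>I. b j y)" for y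
  have Bpos: "0 < B y" if y: "y \<in> K" for y
  proof -
    obtain j where "j \<in> I" "0 < b j y" using I(3) y by blast
    then show ?thesis unfolding B_def using I(1) b0 by (intro sum_pos2[OF I(2)]) auto
  qed
  define F where "F j y = f y * b j y / B y" for j y
  have sB: "Csmooth (inner_cod c') (\<lambda>p. B (chart_inv c' p))" if c': "c' \<in> A" for c'
    unfolding B_def
    by (rule Csmooth_sum[OF open_inner_cod[OF c']]) (rule test_function_smooth[OF bt c'], use I(1) in blast)
  have Ft: "test_function A \<Omega> (F j)" if j: "j \<in> I" for j
  proof (rule test_functionI[OF K(1,2)])
    show "F j x = 0" if "x \<notin> K" for x using K(3)[OF that] by (simp add: F_def)
    fix x assume x: "x \<in> K"
    define c' where "c' = chart_at A x"
    have c': "c' \<in> A" "x \<in> chart_dom c'" using chart_at[of x] by (auto simp: c'_def)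
    define U where "U = inner_cod c' \<inter> (\<lambda>p. B (chart_inv c' p)) -` {0<..}"
    have oU: "open U" unfolding U_def
      by (rule continuous_open_preimage[OF Csmooth_imp_continuous_on[OF sB[OF c'(1)]] open_inner_cod[OF c'(1)]]) simp
    have sub: "U \<subseteq> inner_cod c'" by (auto simp: U_def)
    have xU: "chart_map c' x \<in> U"
      using c' x K(2) Bpos[OF x] by (auto simp: U_def inner_cod_def chart_inv_map[OF c'])
    have jK: "j \<in> K" using j I(1) by blast
    have "Csmooth U (\<lambda>p. f (chart_inv c' p) * b j (chart_inv c' p) / B (chart_inv c' p))"
      by (intro Csmooth_divide_pos Csmooth_mult oU Csmooth_subset[OF test_function_smooth[OF f c'(1)] sub]
          Csmooth_subset[OF test_function_smooth[OF bt[OF jK] c'(1)] sub] Csmooth_subset[OF sB[OF c'(1)] sub])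
        (auto simp: U_def)
    then have "Csmooth U (\<lambda>p. F j (chart_inv c' p))" by (simp add: F_def)
    then show "\<exists>c\<in>A. \<exists>U. x \<in> chart_dom c \<and> open U \<and> chart_map c x \<in> U \<and> U \<subseteq> inner_cod c
        \<and> Csmooth U (\<lambda>p. F j (chart_inv c p))"
      using c' oU sub xU by blast
  qed
  have "f x = (\<Sum>j\<in>I. F j x)" for x
  proof (cases "x \<in> K")
    case True
    then show ?thesis
      using Bpos[OF True] by (simp add: F_def sum_divide_distrib[symmetric] sum_distrib_left[symmetric] B_def[symmetric])
  qed (simp add: K(3) F_def)
  moreover have "\<forall>j\<in>I. test_function A \<Omega> (F j) \<and> c j \<in> A \<and> compact (P j)
      \<and> P j \<subseteq> chart_map (c j) ` (chart_dom (c j) \<inter> (\<Omega> \<inter> inner_pts))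
      \<and> (\<forall>x. x \<notin> chart_inv (c j) ` P j \<longrightarrow> F j x = 0)"
  proof
    fix j assume j: "j \<in> I"
    then have "Q j (c j) (P j) (b j)" using Q I(1) by blast
    then show "test_function A \<Omega> (F j) \<and> c j \<in> A \<and> compact (P j)
      \<and> P j \<subseteq> chart_map (c j) ` (chart_dom (c j) \<inter> (\<Omega> \<inter> inner_pts))
      \<and> (\<forall>x. x \<notin> chart_inv (c j) ` P j \<longrightarrow> F j x = 0)"
      using Ft[OF j] by (auto simp: Q_def F_def)
  qed
  ultimately show ?thesis using I(2) by blast
qed

text \<open>Each piece of a partition of \<open>f\<close> lives in one chart, where mollification applies; the
  pieces are then added up.\<close>

lemma weight_times_test_W12_zero:
  assumes \<Omega>: "open \<Omega>" and w: "W12 A g vol UNIV \<omega> D" and f: "test_function A \<Omega> f"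
  shows "\<exists>X. W12_zero A g vol \<Omega> (\<lambda>x. \<omega> x * f x) X
    \<and> (\<forall>c\<in>A. \<forall>x\<in>chart_dom c. X c x = weighted_gradient \<omega> D f c x)"
proof -
  obtain I :: "'a set" and F c P where I: "finite I" "\<And>x. f x = (\<Sum>j\<in>I. F j x)"
    and F: "\<forall>j\<in>I. test_function A \<Omega> (F j) \<and> c j \<in> A \<and> compact (P j)
      \<and> P j \<subseteq> chart_map (c j) ` (chart_dom (c j) \<inter> (\<Omega> \<inter> inner_pts))
      \<and> (\<forall>x. x \<notin> chart_inv (c j) ` P j \<longrightarrow> F j x = 0)"
    using test_function_partition[OF \<Omega> f] by blast
  have z: "test_function A \<Omega> (\<lambda>_. 0)" by (rule test_functionI[of "{}"]) auto
  have "test_function A \<Omega> (\<lambda>x. \<Sum>j\<in>J. F j x) \<and>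
      (\<exists>X. W12_zero A g vol \<Omega> (\<lambda>x. \<omega> x * (\<Sum>j\<in>J. F j x)) X
      \<and> (\<forall>c\<in>A. \<forall>x\<in>chart_dom c. X c x = weighted_gradient \<omega> D (\<lambda>x. \<Sum>j\<in>J. F j x) c x))"
    if "finite J" "J \<subseteq> I" for J
    using that
  proof (induction J)
    case empty
    have "W12_zero A g vol \<Omega> (\<lambda>x. \<omega> x * 0) (weighted_gradient \<omega> D (\<lambda>_. 0))"
      by (rule weight_times_chart_test_W12_zero[OF \<Omega> w z chart_at(1)[of undefined] compact_empty]) auto
    then show ?case using z by auto
  next
    case (insert j J)
    then obtain X where t: "test_function A \<Omega> (\<lambda>x. \<Sum>j\<in>J. F j x)"
      and X: "W12_zero A g vol \<Omega> (\<lambda>x. \<omega> x * (\<Sum>j\<in>J. F j x)) X"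
        "\<forall>c\<in>A. \<forall>x\<in>chart_dom c. X c x = weighted_gradient \<omega> D (\<lambda>x. \<Sum>j\<in>J. F j x) c x"
      by blast
    have j: "test_function A \<Omega> (F j)" "c j \<in> A" "compact (P j)"
      "P j \<subseteq> chart_map (c j) ` (chart_dom (c j) \<inter> (\<Omega> \<inter> inner_pts))"
      "\<And>x. x \<notin> chart_inv (c j) ` P j \<Longrightarrow> F j x = 0"
      using F insert.prems by auto
    have s: "(\<Sum>i\<in>insert j J. F i x) = (\<Sum>j\<in>J. F j x) + 1 * F j x" for x
      using insert.hyps by simp
    have t': "test_function A \<Omega> (\<lambda>x. \<Sum>i\<in>insert j J. F i x)"
      unfolding s by (rule test_function_add[OF t test_function_cmult[OF j(1)]])
    have "W12_zero A g vol \<Omega> (\<lambda>x. \<omega> x * F j x) (weighted_gradient \<omega> D (F j))"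
      by (rule weight_times_chart_test_W12_zero[OF \<Omega> w j])
    from W12_zero_lincomb[OF \<Omega> X(1) this, of 1]
    have "W12_zero A g vol \<Omega> (\<lambda>x. \<omega> x * (\<Sum>i\<in>insert j J. F i x))
        (\<lambda>c x. X c x + 1 *\<^sub>R weighted_gradient \<omega> D (F j) c x)"
      unfolding s by (simp add: distrib_left)
    moreover have "X c x + 1 *\<^sub>R weighted_gradient \<omega> D (F j) c x
        = weighted_gradient \<omega> D (\<lambda>x. \<Sum>i\<in>insert j J. F i x) c x" if "c \<in> A" "x \<in> chart_dom c" for c x
    proof -
      have "gradient g (\<lambda>x. \<Sum>i\<in>insert j J. F i x) c x
          = gradient g (\<lambda>x. \<Sum>j\<in>J. F j x) c x + 1 *\<^sub>R gradient g (F j) c x"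
        unfolding s by (rule gradient_lincomb[OF t j(1) that])
      then show ?thesis
        using X(2) that unfolding weighted_gradient_def s by (simp add: scaleR_add_right scaleR_add_left)
    qed
    ultimately show ?case using t' by blast
  qed
  from this[OF I(1) order_refl] show ?thesis
    unfolding I(2)[symmetric] by blast
qed

section \<open>The weighted inequality\<close>

text \<open>Completing the square, \<open>- a s \<le> a\<^sup>2 / d + d s\<^sup>2 / 4\<close>. If \<open>d = 0\<close> and \<open>a \<noteq> 0\<close>, the quotient is infinite.\<close>

lemma weighted_pointwise_bound:
  fixes \<alpha> \<gamma> a d s :: real
  assumes "0 \<le> \<alpha>" "\<alpha> \<le> 2" "\<gamma> + \<alpha> / 4 \<le> 5" "0 \<le> d"
  shows "ennreal (\<gamma> * (d * s\<^sup>2) - \<alpha> * (a * s)) \<le> 2 * (ennreal (a\<^sup>2) / ennreal d) + ennreal (5 * d * s\<^sup>2)"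
proof (cases "d = 0")
  case True
  show ?thesis
  proof (cases "a = 0")
    case False
    then have "ennreal (a\<^sup>2) / ennreal d = top" using True by (simp add: ennreal_divide_eq_top_iff)
    then show ?thesis by (simp add: ennreal_mult_top)
  qed (simp add: True)
next
  case False
  then have d: "d > 0" using assms(4) by simp
  have "0 \<le> (a + d * s / 2)\<^sup>2 / d" using d by simp
  also have "\<dots> = a\<^sup>2 / d + a * s + d * s\<^sup>2 / 4"
    using d by (simp add: power2_eq_square field_simps)
  finally have "- (a * s) \<le> a\<^sup>2 / d + d * s\<^sup>2 / 4" by simp
  then have "\<alpha> * (- (a * s)) \<le> \<alpha> * (a\<^sup>2 / d + d * s\<^sup>2 / 4)" using assms(1) by (rule mult_left_mono)
  then have "\<gamma> * (d * s\<^sup>2) - \<alpha> * (a * s) \<le> \<alpha> * (a\<^sup>2 / d) + (\<gamma> + \<alpha> / 4) * (d * s\<^sup>2)"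
    by (simp add: algebra_simps)
  also have "\<dots> \<le> 2 * (a\<^sup>2 / d) + 5 * (d * s\<^sup>2)"
    using assms d by (intro add_mono mult_right_mono) auto
  finally have "\<gamma> * (d * s\<^sup>2) - \<alpha> * (a * s) \<le> 2 * (a\<^sup>2 / d) + 5 * d * s\<^sup>2" by simp
  then have "ennreal (\<gamma> * (d * s\<^sup>2) - \<alpha> * (a * s)) \<le> ennreal (2 * (a\<^sup>2 / d) + 5 * d * s\<^sup>2)"
    by (rule ennreal_leI)
  also have "\<dots> = 2 * (ennreal (a\<^sup>2) / ennreal d) + ennreal (5 * d * s\<^sup>2)"
  proof -
    have "ennreal (2 * (a\<^sup>2 / d)) = 2 * (ennreal (a\<^sup>2) / ennreal d)"
      using ennreal_mult[of 2 "a\<^sup>2 / d"] d by (simp add: divide_ennreal del: times_divide_eq_right)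
    moreover have "ennreal (2 * (a\<^sup>2 / d) + 5 * d * s\<^sup>2) = ennreal (2 * (a\<^sup>2 / d)) + ennreal (5 * d * s\<^sup>2)"
      using d by (intro ennreal_plus) auto
    ultimately show ?thesis by simp
  qed
  finally show ?thesis .
qed

lemma ennreal_integral_le_nn_integral:
  fixes h :: "'b \<Rightarrow> real"
  assumes "integrable M h"
  shows "ennreal (integral\<^sup>L M h) \<le> (\<integral>\<^sup>+x. ennreal (h x) \<partial>M)"
proof -
  have i: "integrable M (\<lambda>x. max 0 (h x))" using assms by simp
  have "integral\<^sup>L M h \<le> (LINT x|M. max 0 (h x))" by (rule integral_mono[OF assms i]) simp
  then have "ennreal (integral\<^sup>L M h) \<le> ennreal (LINT x|M. max 0 (h x))" by (rule ennreal_leI)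
  also have "\<dots> = (\<integral>\<^sup>+x. ennreal (max 0 (h x)) \<partial>M)"
    by (rule nn_integral_eq_integral[OF i, symmetric]) simp
  also have "\<dots> = (\<integral>\<^sup>+x. ennreal (h x) \<partial>M)"
    by (intro nn_integral_cong) (auto simp: max_def ennreal_neg)
  finally show ?thesis .
qed

text \<open>With \<open>L = \<integral>\<omega>\<^sup>2|\<nabla>f|\<^sup>2\<close>, \<open>P = \<integral>|\<nabla>\<omega>|\<^sup>2f\<^sup>2\<close>, \<open>N = \<integral>\<kappa>\<omega>\<^sup>2f\<^sup>2\<close> and \<open>S = \<integral>\<omega>\<^sup>2f\<Delta>f\<close>, the equation
  tested with \<open>f\<^sup>2\<close> reads \<open>L = 2P - N - S\<close>, and the Poincare inequality for \<open>\<omega> f\<close> gives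
  \<open>- N \<le> (2 - \<tau>)/4 (L + P)\<close>. Hence \<open>(2 + \<tau>) L \<le> (10 - \<tau>) P - 4 S\<close>, an inequality between integrals of
  which the integrand on the right is bounded pointwise.\<close>

theorem weighted_gradient_inequality:
  assumes \<Omega>: "open \<Omega>" and adm: "admissible_weight A g vol \<Omega> \<omega> D \<kappa>"
    and lam: "is_lambda1 A g vol \<Omega> lambda1" and \<tau>: "0 < \<tau>" "\<tau> \<le> 2"
    and \<kappa>: "\<And>x. x \<in> \<Omega> \<Longrightarrow> - (lambda1 / 8) * (2 - \<tau>) \<le> \<kappa> x" and f: "test_function A \<Omega> f"
  shows "(\<integral>\<^sup>+x\<in>\<Omega>. ennreal ((\<omega> x)\<^sup>2 * metric_inner A g (gradient g f) (gradient g f) x) \<partial>vol)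
    \<le> ennreal (1 / \<tau>) *
      (\<integral>\<^sup>+x\<in>\<Omega>. (2 * (ennreal ((\<omega> x) ^ 4 * (laplace_beltrami A g f x)\<^sup>2)
                        / ennreal (metric_inner A g D D x))
                + ennreal (5 * metric_inner A g D D x * (f x)\<^sup>2)) \<partial>vol)"
proof -
  have w: "W12 A g vol UNIV \<omega> D" using adm by (simp add: admissible_weight_def)
  define G where "G = metric_inner A g (gradient g f) (gradient g f)"
  define d where "d = metric_inner A g D D"
  define lap where "lap = laplace_beltrami A g f"
  note wt = weight_times_test_L2[OF \<Omega> w f]
  have d0: "0 \<le> d x" and G0: "0 \<le> G x" for x unfolding d_def G_def by (rule metric_inner_nonneg)+
  have iL: "set_integrable vol \<Omega> (\<lambda>x. (\<omega> x)\<^sup>2 * G x)" using wt(3) by (simp add: G_def)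
  have iP: "set_integrable vol \<Omega> (\<lambda>x. d x * (f x)\<^sup>2)" using wt(4) by (simp add: d_def)
  have iM: "set_integrable vol \<Omega> (\<lambda>x. (\<omega> x * f x)\<^sup>2)" using wt(1) by (simp add: L2_on_def)
  have "set_integrable vol UNIV (\<lambda>x. (\<omega> x)\<^sup>2)" using w by (simp add: W12_def L2_on_def)
  then have w2: "set_integrable vol \<Omega> (\<lambda>x. (\<omega> x)\<^sup>2)"
    by (rule set_integrable_subset) (use \<Omega> in auto)
  have iS: "set_integrable vol \<Omega> (\<lambda>x. (\<omega> x)\<^sup>2 * (f x * lap x))"
    by (rule set_integrable_mult_continuous[OF _ test_supp(1)[OF f] _ w2])
      (auto intro!: continuous_intros test_continuous[OF f] laplace_continuous[OF f] simp: lap_def test_supp_0[OF f])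
  have iN: "set_integrable vol \<Omega> (\<lambda>x. \<kappa> x * (\<omega> x)\<^sup>2 * (f x)\<^sup>2)"
  proof -
    have "set_integrable vol (supp f) (\<lambda>x. \<kappa> x * (\<omega> x)\<^sup>2)"
      using adm test_supp[OF f] unfolding admissible_weight_def by blast
    then have "set_integrable vol (supp f) (\<lambda>x. \<kappa> x * (\<omega> x)\<^sup>2 * (f x)\<^sup>2)"
      by (rule set_integrable_mult_continuous[OF _ test_supp(1)[OF f], rotated 2])
        (auto intro!: continuous_intros test_continuous[OF f] simp: test_supp_0[OF f])
    moreover have "(\<lambda>x. indicator (supp f) x *\<^sub>R (\<kappa> x * (\<omega> x)\<^sup>2 * (f x)\<^sup>2))
        = (\<lambda>x. indicator \<Omega> x *\<^sub>R (\<kappa> x * (\<omega> x)\<^sup>2 * (f x)\<^sup>2))"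
      using test_supp(2)[OF f] test_supp_0[OF f] by (auto simp: indicator_def fun_eq_iff)
    ultimately show ?thesis unfolding set_integrable_def by simp
  qed
  define L where "L = (LINT x:\<Omega>|vol. (\<omega> x)\<^sup>2 * G x)"
  define P where "P = (LINT x:\<Omega>|vol. d x * (f x)\<^sup>2)"
  define S where "S = (LINT x:\<Omega>|vol. (\<omega> x)\<^sup>2 * (f x * lap x))"
  define N where "N = (LINT x:\<Omega>|vol. \<kappa> x * (\<omega> x)\<^sup>2 * (f x)\<^sup>2)"
  define M where "M = (LINT x:\<Omega>|vol. (\<omega> x * f x)\<^sup>2)"
  \<comment> \<open>The equation of the weight, tested with \<open>f\<^sup>2\<close>.\<close>
  have "0 = (LINT x:\<Omega>|vol. (4 * d x - 2 * \<kappa> x * (\<omega> x)\<^sup>2) * (f x * f x)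
      - (\<omega> x)\<^sup>2 * laplace_beltrami A g (\<lambda>x. f x * f x) x)"
    using adm test_function_mult[OF f f] unfolding admissible_weight_def d_def by auto
  also have "\<dots> = (LINT x:\<Omega>|vol. (4 * (d x * (f x)\<^sup>2) - 2 * (\<kappa> x * (\<omega> x)\<^sup>2 * (f x)\<^sup>2))
      - (2 * ((\<omega> x)\<^sup>2 * (f x * lap x)) + 2 * ((\<omega> x)\<^sup>2 * G x)))"
    unfolding set_lebesgue_integral_def laplace_square[OF f] lap_def[symmetric] G_def[symmetric]
    by (intro Bochner_Integration.integral_cong) (auto simp: power2_eq_square algebra_simps)
  also have "\<dots> = (4 * P - 2 * N) - (2 * S + 2 * L)"
    using iP iN iS iL by (simp add: set_integral_diff set_integral_add P_def N_def S_def L_def)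
  finally have weak: "L = 2 * P - N - S" by simp
  \<comment> \<open>For unbounded domains the convention \<open>\<lambda>\<^sub>1 = 0\<close> makes this trivial; otherwise
    it is the spectral bound for \<open>\<omega> f\<close>.\<close>
  have poincare: "lambda1 * M \<le> 2 * L + 2 * P"
  proof (cases "riemannian_bounded A g \<Omega>")
    case False
    then have "lambda1 = 0" using lam by (simp add: is_lambda1_def)
    moreover have "0 \<le> L" "0 \<le> P" unfolding L_def P_def by (auto intro!: set_integral_nonneg_all simp: d0 G0)
    ultimately show ?thesis by simp
  next
    case True
    then have ev: "first_dirichlet_eigenvalue A g vol \<Omega> lambda1" using lam by (simp add: is_lambda1_def)
    obtain X where X: "W12_zero A g vol \<Omega> (\<lambda>x. \<omega> x * f x) X"
      "\<forall>c\<in>A. \<forall>x\<in>chart_dom c. X c x = weighted_gradient \<omega> D f c x"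
      using weight_times_test_W12_zero[OF \<Omega> w f] by blast
    have iX: "set_integrable vol \<Omega> (metric_inner A g X X)" using X(1) by (simp add: W12_zero_def W12_def)
    have bound: "metric_inner A g X X x \<le> 2 * ((\<omega> x)\<^sup>2 * G x) + 2 * (d x * (f x)\<^sup>2)" for x
    proof -
      have "X (chart_at A x) x = \<omega> x *\<^sub>R gradient g f (chart_at A x) x + 1 *\<^sub>R (f x *\<^sub>R D (chart_at A x) x)"
        using X(2) chart_at[of x] by (simp add: weighted_gradient_def)
      then have "metric_inner A g X X x
        = metric_inner A g (\<lambda>c x. \<omega> x *\<^sub>R gradient g f c x + 1 *\<^sub>R (f x *\<^sub>R D c x))
          (\<lambda>c x. \<omega> x *\<^sub>R gradient g f c x + 1 *\<^sub>R (f x *\<^sub>R D c x)) x"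
        by (simp add: metric_inner_def Let_def)
      also have "\<dots> \<le> 2 * (G x * (\<omega> x)\<^sup>2) + 2 * 1\<^sup>2 * (d x * (f x)\<^sup>2)"
        using metric_inner_lincomb_le[of "\<lambda>c x. \<omega> x *\<^sub>R gradient g f c x" 1 "\<lambda>c x. f x *\<^sub>R D c x" x]
        by (simp only: metric_inner_scale G_def d_def)
      finally show ?thesis by (simp add: mult.commute)
    qed
    have "lambda1 * M \<le> (LINT x:\<Omega>|vol. metric_inner A g X X x)"
      unfolding M_def by (rule rayleigh_bound[OF \<Omega> ev X(1)])
    also have "\<dots> \<le> (LINT x:\<Omega>|vol. 2 * ((\<omega> x)\<^sup>2 * G x) + 2 * (d x * (f x)\<^sup>2))"
      by (rule set_integral_mono_all[OF iX _ bound]) (intro set_integral_add set_integrable_mult_right iL iP)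
    also have "\<dots> = 2 * L + 2 * P" using iL iP by (simp add: set_integral_add L_def P_def)
    finally show ?thesis .
  qed
  have kappa: "- N \<le> (lambda1 / 8) * (2 - \<tau>) * M"
  proof -
    have "- N = (LINT x:\<Omega>|vol. - (\<kappa> x * (\<omega> x)\<^sup>2 * (f x)\<^sup>2))"
      by (simp add: N_def set_lebesgue_integral_def)
    also have "\<dots> \<le> (LINT x:\<Omega>|vol. (lambda1 / 8) * (2 - \<tau>) * (\<omega> x * f x)\<^sup>2)"
    proof (rule set_integral_mono)
      show "set_integrable vol \<Omega> (\<lambda>x. - (\<kappa> x * (\<omega> x)\<^sup>2 * (f x)\<^sup>2))"
        using iN by (simp add: set_integrable_def)
      show "set_integrable vol \<Omega> (\<lambda>x. (lambda1 / 8) * (2 - \<tau>) * (\<omega> x * f x)\<^sup>2)"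
        by (intro set_integrable_mult_right iM)
      fix x assume "x \<in> \<Omega>"
      then have "- \<kappa> x \<le> (lambda1 / 8) * (2 - \<tau>)" using \<kappa>[of x] by linarith
      then have "- \<kappa> x * (\<omega> x * f x)\<^sup>2 \<le> (lambda1 / 8) * (2 - \<tau>) * (\<omega> x * f x)\<^sup>2" by (rule mult_right_mono) simp
      then show "- (\<kappa> x * (\<omega> x)\<^sup>2 * (f x)\<^sup>2) \<le> (lambda1 / 8) * (2 - \<tau>) * (\<omega> x * f x)\<^sup>2"
        by (simp add: power_mult_distrib mult.assoc)
    qed
    also have "\<dots> = (lambda1 / 8) * (2 - \<tau>) * M" by (simp add: M_def)
    finally show ?thesis .
  qed
  \<comment> \<open>The coefficients of \<open>- S\<close> and of \<open>P\<close> after multiplication by \<open>\<tau> / (2 + \<tau>)\<close>.\<close>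
  define \<alpha> where "\<alpha> = 4 * \<tau> / (2 + \<tau>)"
  define \<gamma> where "\<gamma> = \<tau> * (10 - \<tau>) / (2 + \<tau>)"
  have \<alpha>: "0 \<le> \<alpha>" "\<alpha> \<le> 2" using \<tau> by (auto simp: \<alpha>_def divide_le_eq)
  have \<gamma>: "\<gamma> + \<alpha> / 4 \<le> 5"
  proof -
    \<comment> \<open>This is where the constant \<open>5\<close> comes from: \<open>\<tau>(11 - \<tau>) \<le> 5(2 + \<tau>)\<close>
      amounts to \<open>\<tau>\<^sup>2 - 6\<tau> + 10 \<ge> 0\<close>.\<close>
    have "0 \<le> (\<tau> - 3)\<^sup>2 + 1" by simp
    then have "\<tau> * (10 - \<tau>) + \<tau> \<le> 5 * (2 + \<tau>)" by (simp add: power2_eq_square algebra_simps)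
    moreover have "\<gamma> + \<alpha> / 4 = (\<tau> * (10 - \<tau>) + \<tau>) / (2 + \<tau>)"
    proof -
      have "\<alpha> = 4 * (\<tau> / (2 + \<tau>))" by (simp add: \<alpha>_def)
      then have "\<alpha> / 4 = \<tau> / (2 + \<tau>)" by linarith
      then show ?thesis by (simp only: \<gamma>_def add_divide_distrib)
    qed
    ultimately show ?thesis using \<tau> by (simp add: divide_le_eq)
  qed
  have "- N \<le> ((2 - \<tau>) / 8) * (2 * L + 2 * P)"
  proof -
    note kappa
    also have "(lambda1 / 8) * (2 - \<tau>) * M = ((2 - \<tau>) / 8) * (lambda1 * M)" by simp
    also have "\<dots> \<le> ((2 - \<tau>) / 8) * (2 * L + 2 * P)"
      by (rule mult_left_mono[OF poincare]) (use \<tau> in simp)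
    finally show ?thesis .
  qed
  then have "(2 + \<tau>) * L \<le> (10 - \<tau>) * P - 4 * S"
  proof -
    assume "- N \<le> ((2 - \<tau>) / 8) * (2 * L + 2 * P)"
    then have "L \<le> 2 * P - S + ((2 - \<tau>) / 8) * (2 * L + 2 * P)" using weak by linarith
    moreover have "4 * (((2 - \<tau>) / 8) * (2 * L + 2 * P)) = (2 - \<tau>) * (L + P)" by (simp add: field_simps)
    ultimately have "4 * L \<le> 8 * P - 4 * S + (2 - \<tau>) * (L + P)" by linarith
    then show ?thesis by (simp add: algebra_simps)
  qed
  then have "\<tau> / (2 + \<tau>) * ((2 + \<tau>) * L) \<le> \<tau> / (2 + \<tau>) * ((10 - \<tau>) * P - 4 * S)"
    using \<tau> by (intro mult_left_mono) auto
  moreover have "\<tau> / (2 + \<tau>) * ((2 + \<tau>) * L) = \<tau> * L" using \<tau> by simp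
  moreover have "\<tau> / (2 + \<tau>) * ((10 - \<tau>) * P - 4 * S) = \<gamma> * P - \<alpha> * S"
  proof -
    have "k * ((10 - \<tau>) * P - 4 * S) = (k * (10 - \<tau>)) * P - (k * 4) * S" for k
      by (simp add: algebra_simps)
    moreover have "\<gamma> = \<tau> / (2 + \<tau>) * (10 - \<tau>)" "\<alpha> = \<tau> / (2 + \<tau>) * 4"
      by (simp_all add: \<gamma>_def \<alpha>_def)
    ultimately show ?thesis by metis
  qed
  ultimately have "\<tau> * L \<le> \<gamma> * P - \<alpha> * S" by simp
  also have "\<dots> = (LINT x:\<Omega>|vol. \<gamma> * (d x * (f x)\<^sup>2) - \<alpha> * ((\<omega> x)\<^sup>2 * (f x * lap x)))"
    using iP iS by (simp add: set_integral_diff P_def S_def)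
  finally have main: "\<tau> * L \<le> (LINT x:\<Omega>|vol. \<gamma> * (d x * (f x)\<^sup>2) - \<alpha> * ((\<omega> x)\<^sup>2 * (f x * lap x)))" .
  have i: "set_integrable vol \<Omega> (\<lambda>x. \<gamma> * (d x * (f x)\<^sup>2) - \<alpha> * ((\<omega> x)\<^sup>2 * (f x * lap x)))"
    by (intro set_integral_diff set_integrable_mult_right iP iS)
  have "(\<integral>\<^sup>+x\<in>\<Omega>. ennreal ((\<omega> x)\<^sup>2 * G x) \<partial>vol) = (\<integral>\<^sup>+x. ennreal (indicator \<Omega> x *\<^sub>R ((\<omega> x)\<^sup>2 * G x)) \<partial>vol)"
    by (intro nn_integral_cong) (auto simp: indicator_def)
  also have "\<dots> = ennreal L"
    unfolding L_def set_lebesgue_integral_def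
    by (rule nn_integral_eq_integral[OF iL[unfolded set_integrable_def]]) (simp add: G0)
  also have "\<dots> = ennreal (1 / \<tau>) * ennreal (\<tau> * L)"
    using \<tau> by (subst ennreal_mult'[symmetric]) auto
  also have "\<dots> \<le> ennreal (1 / \<tau>) * (\<integral>\<^sup>+x. ennreal (indicator \<Omega> x *\<^sub>R
      (\<gamma> * (d x * (f x)\<^sup>2) - \<alpha> * ((\<omega> x)\<^sup>2 * (f x * lap x)))) \<partial>vol)"
    using order_trans[OF ennreal_leI[OF main[unfolded set_lebesgue_integral_def]]
        ennreal_integral_le_nn_integral[OF i[unfolded set_integrable_def]]]
    by (rule mult_left_mono) simp
  also have "\<dots> \<le> ennreal (1 / \<tau>) * (\<integral>\<^sup>+x\<in>\<Omega>. (2 * (ennreal ((\<omega> x) ^ 4 * (lap x)\<^sup>2) / ennreal (d x))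
      + ennreal (5 * d x * (f x)\<^sup>2)) \<partial>vol)"
  proof (intro mult_left_mono nn_integral_mono)
    fix x
    have e: "(\<omega> x) ^ 4 * (lap x)\<^sup>2 = ((\<omega> x)\<^sup>2 * lap x)\<^sup>2"
      "(\<omega> x)\<^sup>2 * (f x * lap x) = ((\<omega> x)\<^sup>2 * lap x) * f x" by (simp_all add: power_mult_distrib)
    show "ennreal (indicator \<Omega> x *\<^sub>R (\<gamma> * (d x * (f x)\<^sup>2) - \<alpha> * ((\<omega> x)\<^sup>2 * (f x * lap x))))
      \<le> (2 * (ennreal ((\<omega> x) ^ 4 * (lap x)\<^sup>2) / ennreal (d x)) + ennreal (5 * d x * (f x)\<^sup>2)) * indicator \<Omega> x"
      unfolding e using weighted_pointwise_bound[OF \<alpha> \<gamma> d0[of x], of "f x" "(\<omega> x)\<^sup>2 * lap x"]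
      by (cases "x \<in> \<Omega>") simp_all
  qed simp
  finally show ?thesis unfolding G_def d_def lap_def .
qed

end

theorem theorem1p2:
  fixes A :: "'a::{second_countable_topology,t2_space} chart set"
    and g :: "'a metric" and vol :: "'a measure" and \<Omega> :: "'a set"
    and \<omega> \<kappa> f :: "'a \<Rightarrow> real" and D\<omega> :: "'a vfield" and lambda1 \<tau> :: real
  assumes "riemannian_surface A g" and "riemannian_volume A g vol"
    and "smooth_domain A \<Omega>"
    and "admissible_weight A g vol \<Omega> \<omega> D\<omega> \<kappa>"
    and "is_lambda1 A g vol \<Omega> lambda1"
    and "0 < \<tau>" and "\<tau> \<le> 2"
    and "\<forall>x\<in>\<Omega>. - (lambda1 / 8) * (2 - \<tau>) \<le> \<kappa> x \<and> \<kappa> x \<le> lambda1"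
    and "test_function A \<Omega> f"
  shows "(\<integral>\<^sup>+x\<in>\<Omega>. ennreal ((\<omega> x)\<^sup>2 * metric_inner A g (gradient g f) (gradient g f) x) \<partial>vol)
    \<le> ennreal (1 / \<tau>) *
      (\<integral>\<^sup>+x\<in>\<Omega>. (2 * (ennreal ((\<omega> x) ^ 4 * (laplace_beltrami A g f x)\<^sup>2)
                        / ennreal (metric_inner A g D\<omega> D\<omega> x))
                + ennreal (5 * metric_inner A g D\<omega> D\<omega> x * (f x)\<^sup>2)) \<partial>vol)"
proof -
  interpret measured_surface A g vol
    by (intro measured_surface.intro surface.intro measured_surface_axioms.intro assms)
  have "open \<Omega>" using assms(3) by (simp add: smooth_domain_def)
  then show ?thesis
    by (rule weighted_gradient_inequality[OF _ assms(4,5,6,7) _ assms(9)]) (use assms(8) in blast)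
qed

end
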